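(* Fix some $S>1$, $A>1$, $H>1$, $\bar h\in[H]$, transition kernels $\{P_h\}_{h=1}^{\bar h-1}$, and gaps $\{\mathrm{gap}(s,a)\}_{s\in[S],a\in[A-1]}$ with each $\mathrm{gap}(s,a)\in(0,1/2)$. Then there exists some MDP $\mathcal{M}$ with $S$ states, $A$ actions, horizon $H$, transition kernel $P_h$ for $h\le\bar h-1$, and gaps $$\Delta_{\bar h}(s,a)=\mathrm{gap}(s,a)\quad\forall s\in\mathcal{S},\,a\in\mathcal{A},\,a\ne\pi^\star_{\bar h}(s),\qquad \Delta_h(s,a)\ge1\quad\forall s\in\mathcal{S},\,h\ne\bar h,\,a\in\mathcal{A},\,a\ne\pi^\star_h(s),$$ such that any $(0,\delta)$-PAC algorithm with stopping time $K_\delta$ requires $$\mathbb{E}_{\mathcal{M}}[K_\delta]\ \gtrsim\ \inf_\pi\ \max_{s,\;a\ne\pi^\star_{\bar h}(s)}\frac{1}{w^\pi_{\bar h}(s,a)\,\Delta_{\bar h}(s,a)^2}\cdot\log\frac1{2.4\,\delta}.$$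
   Context: **MDPs.** A finite-horizon time-inhomogeneous MDP $\mathcal{M}$ has finite state set $\mathcal{S}$, finite action set $\mathcal{A}$, horizon $H$, initial distribution $P_0$, transition kernels $P_h(\cdot|s,a)$, and reward distributions $R_h(s,a)$ on $[0,1]$. An episode is $s_1\sim P_0$, $s_{h+1}\sim P_h(\cdot|s_h,a_h)$ with reward $\sim R_h(s_h,a_h)$ for $h=1,\dots,H$. Policies are maps $\pi:\mathcal{S}\times[H]\to\triangle(\mathcal{A})$. $Q_h^\star,V_h^\star$ are the optimal action-value and value functions at step $h$, $\Delta_h(s,a)=V^\star_h(s)-Q^\star_h(s,a)$, and $\pi^\star$ is an optimal (deterministic) policy, $\pi^\star_h(s)$ being the action it plays at $(s,h)$. For each $s$, the $A-1$ actions other than $\pi^\star_{\bar h}(s)$ are indexed by $[A-1]$. $w^\pi_h(s,a)=\mathbb{P}_\pi[s_h=s,a_h=a]$. The infimum is over all (deterministic and stochastic) policies. **PAC algorithm.** An algorithm adaptively selects a policy in each episode, observes the trajectory and rewards, stops after a (random) number $K_\delta$ of episodes and returns a policy $\widehat\pi$. With $V_0^\pi$ the expected total reward of $\pi$ in an episode and $V_0^\star=\sup_\pi V_0^\pi$, it is $(\epsilon,\delta)$-PAC if it returns $\widehat\pi$ with $V_0^\star-V_0^{\widehat\pi}\le\epsilon$ with probability at least $1-\delta$; thus $(0,\delta)$-PAC means returning an optimal policy with probability at least $1-\delta$. $\mathbb{E}_{\mathcal{M}}$ is expectation when the algorithm is run on $\mathcal{M}$. $\gtrsim$ denotes inequality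 up to an absolute constant. *)

theory Defs
  imports "HOL-Probability.Probability"
begin

text \<open>
  States and actions are the numbers below \<open>S\<close> and \<open>A\<close>; steps run from \<open>1\<close> to \<open>H\<close>.
  These sizes are natural numbers rather than finite types so that an absolute constant can be
  quantified before them.
\<close>

record mdp =
  init :: "nat pmf"
  trans :: "nat \<Rightarrow> nat \<Rightarrow> nat \<Rightarrow> nat pmf"
  reward :: "nat \<Rightarrow> nat \<Rightarrow> nat \<Rightarrow> real measure"

text \<open>
  The kernels act between consecutive steps, so only \<open>trans M h\<close> with \<open>1 \<le> h < H\<close> plays a role.
  Every \<open>reward M h s a\<close> is a distribution on the unit interval, also at indices that are out of
  range; those never influence anything, and the convention only saves guards.
\<close>

definition is_mdp :: "nat \<Rightarrow> nat \<Rightarrow> nat \<Rightarrow> mdp \<Rightarrow> bool" where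
  "is_mdp S A H M \<longleftrightarrow>
     set_pmf (init M) \<subseteq> {..<S} \<and>
     (\<forall>h\<in>{1..<H}. \<forall>s<S. \<forall>a<A. set_pmf (trans M h s a) \<subseteq> {..<S}) \<and>
     (\<forall>h s a. sets (reward M h s a) = sets borel \<and> prob_space (reward M h s a) \<and>
              (AE r in reward M h s a. 0 \<le> r \<and> r \<le> 1))"

type_synonym policy = "nat \<Rightarrow> nat \<Rightarrow> nat pmf"

text \<open>\<open>\<pi> h s\<close> is the distribution of the action played in state \<open>s\<close> at step \<open>h\<close>.\<close>

definition policies :: "nat \<Rightarrow> nat \<Rightarrow> nat \<Rightarrow> policy set" where
  "policies S A H = {\<pi>. \<forall>h\<in>{1..H}. \<forall>s<S. set_pmf (\<pi> h s) \<subseteq> {..<A}}"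

text \<open>
  \<open>paths M \<pi> n h \<mu>\<close> is the law of the \<open>n\<close> state-action pairs visited at steps
  \<open>h, \<dots>, h + n - 1\<close> when the state at step \<open>h\<close> is drawn from \<open>\<mu>\<close>.
\<close>

primrec paths :: "mdp \<Rightarrow> policy \<Rightarrow> nat \<Rightarrow> nat \<Rightarrow> nat pmf \<Rightarrow> (nat \<times> nat) list pmf" where
  "paths M \<pi> 0 h \<mu> = return_pmf []"
| "paths M \<pi> (Suc n) h \<mu> =
     bind_pmf \<mu> (\<lambda>s. bind_pmf (\<pi> h s) (\<lambda>a.
       map_pmf (Cons (s, a)) (paths M \<pi> n (Suc h) (trans M h s a))))"

text \<open>
  A trajectory pairs the list of visited state-action pairs with the rewards, both indexed from
  \<open>0\<close>. Given the visited pairs, the rewards are independent with the laws prescribed by the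
  MDP; here \<open>h\<close> is the step of the first entry and \<open>n\<close> the number of entries.
\<close>

type_synonym trajectory = "(nat \<times> nat) list \<times> (nat \<Rightarrow> real)"

definition traj_space :: "nat \<Rightarrow> trajectory measure" where
  "traj_space n = count_space UNIV \<Otimes>\<^sub>M PiM {..<n} (\<lambda>_. borel)"

definition rewarded :: "mdp \<Rightarrow> nat \<Rightarrow> nat \<Rightarrow> (nat \<times> nat) list pmf \<Rightarrow> trajectory measure" where
  "rewarded M n h D = measure_pmf D \<bind> (\<lambda>p.
     distr (PiM {..<n} (\<lambda>i. reward M (h + i) (fst (p ! i)) (snd (p ! i))))
           (traj_space n) (\<lambda>r. (p, r)))"

definition expected_return :: "mdp \<Rightarrow> nat \<Rightarrow> nat \<Rightarrow> (nat \<times> nat) list pmf \<Rightarrow> real" where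
  "expected_return M n h D = (LINT \<tau>|rewarded M n h D. (\<Sum>i<n. snd \<tau> i))"

definition episode :: "mdp \<Rightarrow> nat \<Rightarrow> policy \<Rightarrow> trajectory measure" where
  "episode M H \<pi> = rewarded M H 1 (paths M \<pi> H 1 (init M))"

definition V0 :: "mdp \<Rightarrow> nat \<Rightarrow> policy \<Rightarrow> real" where
  "V0 M H \<pi> = expected_return M H 1 (paths M \<pi> H 1 (init M))"

definition V_pol :: "mdp \<Rightarrow> nat \<Rightarrow> policy \<Rightarrow> nat \<Rightarrow> nat \<Rightarrow> real" where
  "V_pol M H \<pi> h s = expected_return M (Suc H - h) h (paths M \<pi> (Suc H - h) h (return_pmf s))"

definition Q_pol :: "mdp \<Rightarrow> nat \<Rightarrow> policy \<Rightarrow> nat \<Rightarrow> nat \<Rightarrow> nat \<Rightarrow> real" where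
  "Q_pol M H \<pi> h s a = expected_return M (Suc H - h) h
     (map_pmf (Cons (s, a)) (paths M \<pi> (H - h) (Suc h) (trans M h s a)))"

definition V0_opt :: "nat \<Rightarrow> nat \<Rightarrow> nat \<Rightarrow> mdp \<Rightarrow> real" where
  "V0_opt S A H M = (SUP \<pi>\<in>policies S A H. V0 M H \<pi>)"

definition V_opt :: "nat \<Rightarrow> nat \<Rightarrow> nat \<Rightarrow> mdp \<Rightarrow> nat \<Rightarrow> nat \<Rightarrow> real" where
  "V_opt S A H M h s = (SUP \<pi>\<in>policies S A H. V_pol M H \<pi> h s)"

definition Q_opt :: "nat \<Rightarrow> nat \<Rightarrow> nat \<Rightarrow> mdp \<Rightarrow> nat \<Rightarrow> nat \<Rightarrow> nat \<Rightarrow> real" where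
  "Q_opt S A H M h s a = (SUP \<pi>\<in>policies S A H. Q_pol M H \<pi> h s a)"

definition Delta :: "nat \<Rightarrow> nat \<Rightarrow> nat \<Rightarrow> mdp \<Rightarrow> nat \<Rightarrow> nat \<Rightarrow> nat \<Rightarrow> real" where
  "Delta S A H M h s a = V_opt S A H M h s - Q_opt S A H M h s a"

definition optimal_det :: "nat \<Rightarrow> nat \<Rightarrow> nat \<Rightarrow> mdp \<Rightarrow> (nat \<Rightarrow> nat \<Rightarrow> nat) \<Rightarrow> bool" where
  "optimal_det S A H M \<pi> \<longleftrightarrow>
     (\<forall>h\<in>{1..H}. \<forall>s<S. \<pi> h s < A \<and>
        V_pol M H (\<lambda>h s. return_pmf (\<pi> h s)) h s = V_opt S A H M h s)"

definition visit :: "mdp \<Rightarrow> nat \<Rightarrow> policy \<Rightarrow> nat \<Rightarrow> nat \<Rightarrow> nat \<Rightarrow> real" where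
  "visit M H \<pi> h s a =
     measure_pmf.prob (paths M \<pi> H 1 (init M)) {p. p ! (h - 1) = (s, a)}"

text \<open>
  Round \<open>k = 0, 1, \<dots>\<close> of an algorithm begins after \<open>k\<close> episodes. The algorithm draws a fresh
  seed from its own randomness and then, as a function of \<open>k\<close>, of the seeds and trajectories of
  the previous rounds, and of the new seed, decides whether to stop; if it stops it returns
  \<open>recommend\<close>, otherwise it plays an episode with the policy \<open>select\<close>.
\<close>

type_synonym history = "nat \<Rightarrow> real \<times> trajectory"

record algorithm =
  seed :: "real measure"
  stop :: "nat \<Rightarrow> history \<Rightarrow> real \<Rightarrow> bool"
  select :: "nat \<Rightarrow> history \<Rightarrow> real \<Rightarrow> policy"
  recommend :: "nat \<Rightarrow> history \<Rightarrow> real \<Rightarrow> policy"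

definition round_space :: "nat \<Rightarrow> (real \<times> trajectory) measure" where
  "round_space H = borel \<Otimes>\<^sub>M traj_space H"

definition info_space :: "nat \<Rightarrow> nat \<Rightarrow> (history \<times> real) measure" where
  "info_space H k = PiM {0..<k} (\<lambda>_. round_space H) \<Otimes>\<^sub>M borel"

definition measurable_rule ::
    "nat \<Rightarrow> nat \<Rightarrow> nat \<Rightarrow> (nat \<Rightarrow> history \<Rightarrow> real \<Rightarrow> policy) \<Rightarrow> bool" where
  "measurable_rule S A H f \<longleftrightarrow>
     (\<forall>k x u. f k x u \<in> policies S A H) \<and>
     (\<forall>k. \<forall>h\<in>{1..H}. \<forall>s<S. \<forall>a<A.
        (\<lambda>(x, u). pmf (f k x u h s) a) \<in> borel_measurable (info_space H k))"

definition is_algorithm :: "nat \<Rightarrow> nat \<Rightarrow> nat \<Rightarrow> algorithm \<Rightarrow> bool" where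
  "is_algorithm S A H alg \<longleftrightarrow>
     sets (seed alg) = sets borel \<and> prob_space (seed alg) \<and>
     (\<forall>k. (\<lambda>(x, u). stop alg k x u) \<in> measurable (info_space H k) (count_space UNIV)) \<and>
     measurable_rule S A H (select alg) \<and>
     measurable_rule S A H (recommend alg)"

definition round_law ::
    "mdp \<Rightarrow> nat \<Rightarrow> algorithm \<Rightarrow> nat \<Rightarrow> history \<Rightarrow> (real \<times> trajectory) measure" where
  "round_law M H alg k x = seed alg \<bind> (\<lambda>u.
     distr (episode M H (select alg k x u)) (round_space H) (\<lambda>\<tau>. (u, \<tau>)))"

text \<open>
  The joint law of all rounds is the Ionescu-Tulcea measure of the round laws. It formally also
  contains rounds after the stopping time; these affect neither the number of episodes nor the
  returned policy.
\<close>

definition run :: "mdp \<Rightarrow> nat \<Rightarrow> algorithm \<Rightarrow> history measure" where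
  "run M H alg = projective_family.lim UNIV
     (Ionescu_Tulcea.CI (round_law M H alg) (\<lambda>_. round_space H)) (\<lambda>_. round_space H)"

definition stops_at :: "algorithm \<Rightarrow> history \<Rightarrow> nat \<Rightarrow> bool" where
  "stops_at alg \<omega> k \<longleftrightarrow> stop alg k (restrict \<omega> {0..<k}) (fst (\<omega> k))"

text \<open>The number of episodes is \<open>\<infinity>\<close>, the infimum of the empty set, if the algorithm never stops.\<close>

definition num_episodes :: "algorithm \<Rightarrow> history \<Rightarrow> ennreal" where
  "num_episodes alg \<omega> = (INF k\<in>{k. stops_at alg \<omega> k}. of_nat k)"

definition returned :: "algorithm \<Rightarrow> history \<Rightarrow> policy" where
  "returned alg \<omega> = (let k = LEAST k. stops_at alg \<omega> k
                     in recommend alg k (restrict \<omega> {0..<k}) (fst (\<omega> k)))"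

text \<open>
  The guarantee is required on every MDP of the given size; the MDP is unknown to the algorithm.
  With probability at least \<open>1 - \<delta>\<close>, any policy that is returned is \<open>\<epsilon>\<close>-optimal. Not stopping is no
  error here: if it were, no algorithm would be PAC for \<open>\<epsilon> = 0\<close> and \<open>\<delta> < 1 / 3\<close>, because an MDP
  with two optimal actions can be perturbed so that either one becomes the only optimal one, and
  an algorithm that is correct on both perturbations stops with probability at most \<open>2 * \<delta>\<close> on the
  original. The number of episodes is infinite on runs that do not stop.
\<close>

definition PAC :: "nat \<Rightarrow> nat \<Rightarrow> nat \<Rightarrow> real \<Rightarrow> real \<Rightarrow> algorithm \<Rightarrow> bool" where
  "PAC S A H \<epsilon> \<delta> alg \<longleftrightarrow> is_algorithm S A H alg \<and>
     (\<forall>M. is_mdp S A H M \<longrightarrow>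
        measure (run M H alg)
          {\<omega> \<in> space (run M H alg). (\<exists>k. stops_at alg \<omega> k) \<longrightarrow>
             V0_opt S A H M - V0 M H (returned alg \<omega>) \<le> \<epsilon>} \<ge> 1 - \<delta>)"

definition expected_episodes :: "mdp \<Rightarrow> nat \<Rightarrow> algorithm \<Rightarrow> ennreal" where
  "expected_episodes M H alg = (\<integral>\<^sup>+\<omega>. num_episodes alg \<omega> \<partial>run M H alg)"

text \<open>
  The values are extended reals because \<open>visit\<close> may vanish: the quotient is then \<open>\<infinity>\<close>.
\<close>

definition complexity ::
    "nat \<Rightarrow> nat \<Rightarrow> nat \<Rightarrow> mdp \<Rightarrow> (nat \<Rightarrow> nat \<Rightarrow> nat) \<Rightarrow> nat \<Rightarrow> ennreal" where
  "complexity S A H M \<pi>s h =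
     (INF \<pi>\<in>policies S A H. MAX (s, a)\<in>{(s, a). s < S \<and> a < A \<and> a \<noteq> \<pi>s h s}.
        1 / (ennreal (visit M H \<pi> h s a) * ennreal ((Delta S A H M h s a)\<^sup>2)))"

end

theory Submission
  imports Defs
begin

text \<open>
  In the hard MDP action \<open>0\<close> is optimal everywhere and the values do not depend on the state. An
  alternative MDP makes one pair \<open>(s, a)\<close> at step \<open>hbar\<close> slightly better than \<open>(s, 0)\<close> and, with a
  tiny probability \<open>\<eta>\<close>, jumps to \<open>s\<close> at every step, so that an optimal policy of it has to play \<open>a\<close>
  in \<open>s\<close> even if \<open>s\<close> cannot be reached in the original. A PAC algorithm tells the two apart, so a
  change of measure on the stopped run bounds the expected number of visits of \<open>(s, a)\<close> from below
  by a constant times \<open>ln (1 / (2.4 * \<delta>)) / gap\<^sup>2\<close> when \<open>\<eta>\<close> tends to \<open>0\<close>. A single Markov policy has, for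
  all pairs at once, the occupancies averaged over the episodes played before stopping, so these
  bounds together bound the expected number of episodes by the complexity of that policy.
\<close>

section \<open>Marginals of the visited pairs\<close>

text \<open>The kernels before the critical step are prescribed, so nothing can be assumed about
  which states are reachable, and optimality in the hard MDP says nothing about the recommendation
  in an unreachable state. Hence each pair \<open>(s, a)\<close> needs two alternatives: one that
  only adds the jumps, so that an optimal policy must play \<open>0\<close> in \<open>s\<close>, and
  one that also raises the reward of \<open>(s, a)\<close>. The first shows that on the hard MDP
  actions other than \<open>0\<close> are rarely recommended in \<open>s\<close>; the second gives
  the information bound.

  Jumps create paths that are impossible in the original, so the likelihood ratio is used
  one-sidedly: the alternative dominates \<open>(1 - \<eta>) ^ H\<close> times the reward ratio. The
  total price of the jumps over \<open>n\<close> episodes is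
  \<open>n * H * (- ln (1 - \<eta>))\<close>, which vanishes with \<eta> only for fixed
  \<open>n\<close>. Therefore runs are first cut off after \<open>n\<close> rounds, and Markov's
  inequality controls the probability of not having stopped by then.

  The constant \<open>1 / 144\<close> is a product of two factors \<open>1 / 12\<close>: one is the
  margin by which recommending \<open>0\<close> is more likely than not, the other comes from the
  relative entropy of the two reward laws.\<close>

definition pair_law :: "policy \<Rightarrow> nat \<Rightarrow> nat pmf \<Rightarrow> (nat \<times> nat) pmf" where
  "pair_law \<pi> h \<mu> = bind_pmf \<mu> (\<lambda>s. map_pmf (Pair s) (\<pi> h s))"

definition next_law :: "mdp \<Rightarrow> policy \<Rightarrow> nat \<Rightarrow> nat pmf \<Rightarrow> nat pmf" where
  "next_law M \<pi> h \<mu> = bind_pmf (pair_law \<pi> h \<mu>) (\<lambda>(s, a). trans M h s a)"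

text \<open>The recursion appends the last step, as occupancy recursions require, whereas
  \<open>paths\<close> unfolds from the first step; \<open>state_law_Suc_shift\<close> reconciles
  the two.\<close>

primrec state_law :: "mdp \<Rightarrow> policy \<Rightarrow> nat \<Rightarrow> nat \<Rightarrow> nat pmf \<Rightarrow> nat pmf" where
  "state_law M \<pi> h 0 \<mu> = \<mu>"
| "state_law M \<pi> h (Suc i) \<mu> = next_law M \<pi> (h + i) (state_law M \<pi> h i \<mu>)"

lemma pair_law_bind: "pair_law \<pi> h (bind_pmf X f) = bind_pmf X (\<lambda>x. pair_law \<pi> h (f x))"
  by (simp add: pair_law_def bind_assoc_pmf)

lemma next_law_bind: "next_law M \<pi> h (bind_pmf X f) = bind_pmf X (\<lambda>x. next_law M \<pi> h (f x))"
  by (simp add: next_law_def pair_law_bind bind_assoc_pmf)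

lemma state_law_bind:
  "state_law M \<pi> h i (bind_pmf X f) = bind_pmf X (\<lambda>x. state_law M \<pi> h i (f x))"
  by (induction i) (simp_all add: next_law_bind)

lemma state_law_Suc_shift:
  "state_law M \<pi> h (Suc i) \<mu> = state_law M \<pi> (Suc h) i (next_law M \<pi> h \<mu>)"
  by (induction i) simp_all

lemma next_law_alt:
  "next_law M \<pi> h \<mu> = bind_pmf \<mu> (\<lambda>s. bind_pmf (\<pi> h s) (\<lambda>a. trans M h s a))"
  by (simp add: next_law_def pair_law_def bind_assoc_pmf bind_map_pmf)

text \<open>Returns and visits involve one coordinate of a path at a time, so values and occupancies
  are determined by these marginals.\<close>

lemma map_nth_paths:
  "i < n \<Longrightarrow> map_pmf (\<lambda>p. p ! i) (paths M \<pi> n h \<mu>) = pair_law \<pi> (h + i) (state_law M \<pi> h i \<mu>)"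
proof (induction n arbitrary: i h \<mu>)
  case (Suc n)
  show ?case
  proof (cases i)
    case 0
    have "map_pmf (\<lambda>p. p ! 0) (map_pmf (Cons z) X) = return_pmf z" for z :: "nat \<times> nat" and X
      by (simp add: pmf.map_comp o_def map_pmf_const)
    then have "map_pmf (\<lambda>p. p ! i) (paths M \<pi> (Suc n) h \<mu>) =
      bind_pmf \<mu> (\<lambda>s. bind_pmf (\<pi> h s) (\<lambda>a. return_pmf (s, a)))"
      by (simp only: 0 paths.simps map_bind_pmf)
    then show ?thesis
      by (simp add: 0 pair_law_def map_pmf_def)
  next
    case (Suc j)
    with Suc.prems have j: "j < n" by simp
    have "map_pmf (\<lambda>p. p ! i) (map_pmf (Cons (s, a)) X) = map_pmf (\<lambda>p. p ! j) X"
      for s a :: nat and X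
      by (simp add: pmf.map_comp o_def Suc)
    then have "map_pmf (\<lambda>p. p ! i) (paths M \<pi> (Suc n) h \<mu>) =
      bind_pmf \<mu> (\<lambda>s. bind_pmf (\<pi> h s) (\<lambda>a.
         pair_law \<pi> (Suc h + j) (state_law M \<pi> (Suc h) j (trans M h s a))))"
      by (simp add: map_bind_pmf Suc.IH[OF j])
    also have "\<dots> = pair_law \<pi> (h + i) (state_law M \<pi> (Suc h) j (next_law M \<pi> h \<mu>))"
      by (simp add: next_law_alt state_law_bind pair_law_bind Suc)
    finally show ?thesis
      by (simp only: Suc state_law_Suc_shift)
  qed
qed simp

lemma length_paths: "p \<in> set_pmf (paths M \<pi> n h \<mu>) \<Longrightarrow> length p = n"
  by (induction n arbitrary: p h \<mu>) auto

lemma pmf_pair_law: "pmf (pair_law \<pi> h \<mu>) (s, a) = pmf \<mu> s * pmf (\<pi> h s) a"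
proof -
  have "pmf (map_pmf (Pair s') (\<pi> h s')) (s, a) = indicator {s} s' * pmf (\<pi> h s) a" for s'
  proof (cases "s' = s")
    case True
    then show ?thesis by (simp add: pmf_map_inj' inj_def)
  next
    case False
    then show ?thesis by (auto simp: pmf_eq_0_set_pmf)
  qed
  then show ?thesis
    by (simp add: pair_law_def pmf_bind measure_pmf_single)
qed

lemma set_pair_law: "set_pmf (pair_law \<pi> h \<mu>) = {(s, a). s \<in> set_pmf \<mu> \<and> a \<in> set_pmf (\<pi> h s)}"
  by (auto simp: pair_law_def)

lemma pmf_next_law:
  assumes "set_pmf \<mu> \<subseteq> {..<S}" "\<And>s. s < S \<Longrightarrow> set_pmf (\<pi> h s) \<subseteq> {..<A}"
  shows "pmf (next_law M \<pi> h \<mu>) t =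
    (\<Sum>s<S. \<Sum>a<A. pmf \<mu> s * pmf (\<pi> h s) a * pmf (trans M h s a) t)"
proof -
  have "pmf (next_law M \<pi> h \<mu>) t = (\<Sum>(s, a)\<in>{..<S} \<times> {..<A}. pmf (pair_law \<pi> h \<mu>) (s, a) * pmf (trans M h s a) t)"
    unfolding next_law_def pmf_bind
    using assms by (subst integral_measure_pmf_real[where A="{..<S} \<times> {..<A}"])
      (auto simp: set_pair_law subset_iff split_def mult.commute)
  then show ?thesis
    by (simp add: sum.cartesian_product pmf_pair_law)
qed

lemma set_state_law:
  assumes "is_mdp S A H M" "\<pi> \<in> policies S A H" "set_pmf \<mu> \<subseteq> {..<S}" "1 \<le> h" "h + i \<le> H"
  shows "set_pmf (state_law M \<pi> h i \<mu>) \<subseteq> {..<S}"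
  using assms(5)
proof (induction i)
  case (Suc i)
  then have "h + i \<in> {1..<H}" "h + i \<in> {1..H}" using assms(4) by auto
  then show ?case
    using Suc assms(1,2) by (fastforce simp: next_law_alt is_mdp_def policies_def subset_iff)
qed (use assms in simp)

lemma visit_eq:
  assumes "h \<in> {1..H}"
  shows "visit M H \<pi> h s a = pmf (state_law M \<pi> 1 (h - 1) (init M)) s * pmf (\<pi> h s) a"
proof -
  have "visit M H \<pi> h s a = measure_pmf.prob (map_pmf (\<lambda>p. p ! (h - 1)) (paths M \<pi> H 1 (init M))) {(s, a)}"
    by (simp add: visit_def vimage_def)
  also have "map_pmf (\<lambda>p. p ! (h - 1)) (paths M \<pi> H 1 (init M)) = pair_law \<pi> h (state_law M \<pi> 1 (h - 1) (init M))"
    using assms by (subst map_nth_paths) auto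
  finally show ?thesis
    by (simp add: measure_pmf_single pmf_pair_law)
qed

section \<open>Expected returns\<close>

definition valid_rewards :: "mdp \<Rightarrow> bool" where
  "valid_rewards M \<longleftrightarrow> (\<forall>h s a. sets (reward M h s a) = sets borel \<and> prob_space (reward M h s a) \<and>
     (AE r in reward M h s a. 0 \<le> r \<and> r \<le> 1))"

definition mean_reward :: "mdp \<Rightarrow> nat \<Rightarrow> nat \<times> nat \<Rightarrow> real" where
  "mean_reward M h z = (LINT r|reward M h (fst z) (snd z). r)"

abbreviation reward_space :: "mdp \<Rightarrow> nat \<Rightarrow> nat \<Rightarrow> (nat \<times> nat) list \<Rightarrow> (nat \<Rightarrow> real) measure" where
  "reward_space M n h p \<equiv> PiM {..<n} (\<lambda>i. reward M (h + i) (fst (p ! i)) (snd (p ! i)))"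

lemma
  assumes "valid_rewards M"
  shows sets_reward: "sets (reward M h s a) = sets borel"
    and prob_space_reward: "prob_space (reward M h s a)"
    and AE_reward: "AE r in reward M h s a. 0 \<le> r \<and> r \<le> 1"
  using assms by (auto simp: valid_rewards_def)

lemma sets_reward_space:
  assumes "valid_rewards M"
  shows "sets (reward_space M n h p) = sets (PiM {..<n} (\<lambda>_. borel))"
  using assms by (intro sets_PiM_cong) (auto simp: sets_reward)

lemma prob_space_reward_space:
  assumes "valid_rewards M"
  shows "prob_space (reward_space M n h p)"
  using assms by (intro prob_space_PiM) (auto simp: prob_space_reward)

lemma measurable_Pair_reward_space:
  assumes "valid_rewards M"
  shows "Pair p \<in> measurable (reward_space M n h p) (traj_space n)"
proof -
  have "Pair p \<in> measurable (PiM {..<n} (\<lambda>_. borel)) (traj_space n)"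
    unfolding traj_space_def by measurable
  then show ?thesis
    using measurable_cong_sets[OF sets_reward_space[OF assms] refl] by blast
qed

lemma rewarded_kernel:
  assumes "valid_rewards M"
  shows "(\<lambda>p. distr (reward_space M n h p) (traj_space n) (Pair p))
    \<in> measurable (count_space UNIV) (prob_algebra (traj_space n))"
  using assms
  by (auto simp: space_prob_algebra intro!: prob_space.prob_space_distr prob_space_reward_space
        measurable_Pair_reward_space)

lemma rewarded_kernel_pmf:
  assumes "valid_rewards M"
  shows "(\<lambda>p. distr (reward_space M n h p) (traj_space n) (Pair p))
    \<in> measurable (measure_pmf D) (subprob_algebra (traj_space n))"
  using measurable_prob_algebraD[OF rewarded_kernel[OF assms]]
  by (simp add: measurable_def)

lemma
  assumes "valid_rewards M"
  shows sets_rewarded: "sets (rewarded M n h D) = sets (traj_space n)"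
    and prob_space_rewarded: "prob_space (rewarded M n h D)"
proof -
  show "sets (rewarded M n h D) = sets (traj_space n)"
    unfolding rewarded_def by (subst sets_bind[of _ _ "traj_space n"]) auto
  show "prob_space (rewarded M n h D)"
    unfolding rewarded_def
    by (rule measure_pmf.prob_space_bind[OF _ rewarded_kernel_pmf[OF assms]])
       (auto intro!: prob_space.prob_space_distr prob_space_reward_space
        measurable_Pair_reward_space assms)
qed

lemma nn_integral_rewarded:
  assumes "valid_rewards M" "f \<in> borel_measurable (traj_space n)"
  shows "(\<integral>\<^sup>+\<tau>. f \<tau> \<partial>rewarded M n h D) = (\<integral>\<^sup>+p. (\<integral>\<^sup>+r. f (p, r) \<partial>reward_space M n h p) \<partial>D)"
  unfolding rewarded_def
  by (subst nn_integral_bind[OF assms(2) rewarded_kernel_pmf[OF assms(1)]])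
     (simp add: nn_integral_distr measurable_Pair_reward_space assms)

lemma integral_rewarded:
  fixes f :: "trajectory \<Rightarrow> real"
  assumes M: "valid_rewards M" and f: "f \<in> borel_measurable (traj_space n)" and B: "\<And>\<tau>. \<bar>f \<tau>\<bar> \<le> B"
  shows "(\<integral>\<tau>. f \<tau> \<partial>rewarded M n h D) = (\<integral>p. (\<integral>r. f (p, r) \<partial>reward_space M n h p) \<partial>D)"
proof -
  have "(\<integral>\<tau>. f \<tau> \<partial>rewarded M n h D) =
    (\<integral>p. (\<integral>\<tau>. f \<tau> \<partial>distr (reward_space M n h p) (traj_space n) (Pair p)) \<partial>D)"
    unfolding rewarded_def
  proof (rule integral_bind[where B=B and B'=1, OF f B rewarded_kernel_pmf[OF M]])
    show "finite_measure (measure_pmf D)" by (rule measure_pmf.finite_measure)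
    show "AE p in measure_pmf D. emeasure (distr (reward_space M n h p) (traj_space n) (Pair p))
      (space (distr (reward_space M n h p) (traj_space n) (Pair p))) \<le> ennreal 1"
      by (intro AE_I2) (simp add: prob_space.emeasure_space_1 prob_space.prob_space_distr
          prob_space_reward_space measurable_Pair_reward_space M del: space_distr)
  qed
  also have "\<dots> = (\<integral>p. (\<integral>r. f (p, r) \<partial>reward_space M n h p) \<partial>D)"
    by (intro Bochner_Integration.integral_cong refl integral_distr measurable_Pair_reward_space M f)
  finally show ?thesis .
qed

lemma mean_reward_le_1:
  assumes "valid_rewards M"
  shows "\<bar>mean_reward M h z\<bar> \<le> 1"
proof -
  interpret R: prob_space "reward M h (fst z) (snd z)"
    by (rule prob_space_reward[OF assms])
  have "AE r in reward M h (fst z) (snd z). 0 \<le> r"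
    and "AE r in reward M h (fst z) (snd z). r \<le> 1"
    using AE_reward[OF assms, of h "fst z" "snd z"] by (auto elim: eventually_mono)
  then show ?thesis
    unfolding mean_reward_def
    using integral_nonneg_AE[of "\<lambda>r. r"] 
      integral_mono_AE'[of "reward M h (fst z) (snd z)" "\<lambda>_. 1" "\<lambda>r. r"]
    by (auto simp: R.prob_space)
qed

text \<open>The sum of rewards is bounded only almost everywhere, while
  \<open>integral_rewarded\<close> asks for a bound at every trajectory. Clipping each reward to the
  unit interval changes nothing almost everywhere and makes linearity and the component laws
  applicable.\<close>

lemma expected_return_eq:
  assumes M: "valid_rewards M"
  shows "expected_return M n h D = (\<Sum>i<n. \<integral>p. mean_reward M (h + i) (p ! i) \<partial>measure_pmf D)"
proof -
  define clip :: "real \<Rightarrow> real" where "clip x = min 1 (max 0 x)" for x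
  have clip_meas[measurable]: "clip \<in> borel_measurable borel" unfolding clip_def by measurable
  have clip_b: "0 \<le> clip x" "clip x \<le> 1" for x by (auto simp: clip_def)
  have clip_id: "0 \<le> x \<Longrightarrow> x \<le> 1 \<Longrightarrow> clip x = x" for x by (auto simp: clip_def)
  have ms[measurable]: "(\<lambda>\<tau>. snd \<tau> i) \<in> borel_measurable (traj_space n)" if "i < n" for i
    unfolding traj_space_def using that
    by (intro measurable_compose[OF measurable_snd measurable_component_singleton]) simp
  have ms1[measurable]: "(\<lambda>\<tau>. \<Sum>i<n. snd \<tau> i) \<in> borel_measurable (traj_space n)"
    by (rule borel_measurable_sum) (simp add: ms)
  have ms2[measurable]: "(\<lambda>\<tau>. \<Sum>i<n. clip (snd \<tau> i)) \<in> borel_measurable (traj_space n)"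
    by (rule borel_measurable_sum) (rule measurable_compose[OF ms clip_meas], simp)
  have AEi: "AE r in reward_space M n h p. \<forall>i\<in>{..<n}. 0 \<le> r i \<and> r i \<le> 1" for p
  proof (subst AE_finite_all, simp, intro ballI)
    fix i assume i: "i \<in> {..<n}"
    show "AE r in reward_space M n h p. 0 \<le> r i \<and> r i \<le> 1"
      by (rule AE_PiM_component[where P="\<lambda>x. 0 \<le> x \<and> x \<le> 1"])
         (use i prob_space_reward[OF M] AE_reward[OF M] in auto)
  qed
  have ms3: "Measurable.pred (traj_space n) (\<lambda>\<tau>. (\<Sum>i<n. snd \<tau> i) = (\<Sum>i<n. clip (snd \<tau> i)))"
    by measurable
  have "AE \<tau> in rewarded M n h D. (\<Sum>i<n. snd \<tau> i) = (\<Sum>i<n. clip (snd \<tau> i))"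
    unfolding rewarded_def
  proof (subst AE_bind[OF rewarded_kernel_pmf[OF M] ms3], rule AE_I2)
    fix p
    show "AE \<tau> in distr (reward_space M n h p) (traj_space n) (Pair p).
       (\<Sum>i<n. snd \<tau> i) = (\<Sum>i<n. clip (snd \<tau> i))"
    proof (subst AE_distr_iff[OF measurable_Pair_reward_space[OF M]])
      show "AE r in reward_space M n h p. (\<Sum>i<n. snd (p, r) i) = (\<Sum>i<n. clip (snd (p, r) i))"
        using AEi[of p] by eventually_elim (auto simp: clip_id intro!: sum.cong)
    qed (use ms3 in \<open>simp add: pred_def\<close>)
  qed
  then have "expected_return M n h D = (LINT \<tau>|rewarded M n h D. (\<Sum>i<n. clip (snd \<tau> i)))"
    unfolding expected_return_def
    by (intro integral_cong_AE)
       (auto simp: measurable_cong_sets[OF sets_rewarded[OF M] refl])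
  also have "\<dots> = (\<integral>p. (\<integral>r. (\<Sum>i<n. clip (r i)) \<partial>reward_space M n h p) \<partial>D)"
  proof (subst integral_rewarded[where B="real n", OF M ms2])
    show "\<bar>\<Sum>i<n. clip (snd x i)\<bar> \<le> real n" for x :: trajectory
    proof -
      have "\<bar>\<Sum>i<n. clip (snd x i)\<bar> \<le> (\<Sum>i<n. 1)"
        using clip_b by (intro order.trans[OF sum_abs sum_mono]) auto
      then show ?thesis by simp
    qed
  qed simp
  also have "\<dots> = (\<integral>p. (\<Sum>i<n. mean_reward M (h + i) (p ! i)) \<partial>D)"
  proof (rule Bochner_Integration.integral_cong[OF refl])
    fix p
    interpret R: prob_space "reward_space M n h p" by (rule prob_space_reward_space[OF M])
    have *: "(\<integral>r. clip (r i) \<partial>reward_space M n h p) = mean_reward M (h + i) (p ! i)"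
      and **: "integrable (reward_space M n h p) (\<lambda>r. clip (r i))" if "i < n" for i
    proof -
      let ?R = "reward M (h + i) (fst (p ! i)) (snd (p ! i))"
      have mi: "(\<lambda>r. r i) \<in> measurable (reward_space M n h p) ?R"
        using that by simp
      have cm: "clip \<in> borel_measurable ?R"
        using clip_meas measurable_cong_sets[OF sets_reward[OF M] refl] by blast
      have "(\<integral>r. clip (r i) \<partial>reward_space M n h p) = (\<integral>x. clip x \<partial>distr (reward_space M n h p) ?R (\<lambda>r. r i))"
        by (subst integral_distr[OF mi cm]) simp
      also have "distr (reward_space M n h p) ?R (\<lambda>r. r i) = ?R"
        using distr_PiM_component[of "{..<n}" "\<lambda>i. reward M (h + i) (fst (p ! i)) (snd (p ! i))" i] that
        by (simp add: prob_space_reward M)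
      also have "(\<integral>x. clip x \<partial>?R) = mean_reward M (h + i) (p ! i)"
        unfolding mean_reward_def
      proof (rule integral_cong_AE)
        show "AE x in ?R. clip x = x"
          using AE_reward[OF M, of "h+i" "fst (p ! i)" "snd (p ! i)"]
          by eventually_elim (simp add: clip_id)
      qed (auto simp: cm measurable_cong_sets[OF sets_reward[OF M] refl])
      finally show "(\<integral>r. clip (r i) \<partial>reward_space M n h p) = mean_reward M (h + i) (p ! i)" .
      show "integrable (reward_space M n h p) (\<lambda>r. clip (r i))"
        using clip_b measurable_compose[OF mi cm]
        by (intro R.integrable_const_bound[where B=1]) auto
    qed
    show "(\<integral>r. (\<Sum>i<n. clip (r i)) \<partial>reward_space M n h p) = (\<Sum>i<n. mean_reward M (h + i) (p ! i))"
      using * ** by (subst Bochner_Integration.integral_sum) auto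
  qed
  also have "\<dots> = (\<Sum>i<n. \<integral>p. mean_reward M (h + i) (p ! i) \<partial>D)"
  proof (rule Bochner_Integration.integral_sum)
    fix i
    show "integrable (measure_pmf D) (\<lambda>p. mean_reward M (h + i) (p ! i))"
      by (intro measure_pmf.integrable_const_bound[where B=1]) (auto simp: mean_reward_le_1[OF M])
  qed
  finally show ?thesis .
qed

lemma expected_return_paths:
  assumes "valid_rewards M"
  shows "expected_return M n h (paths M \<pi> n h \<mu>) =
    (\<Sum>i<n. \<integral>z. mean_reward M (h + i) z \<partial>pair_law \<pi> (h + i) (state_law M \<pi> h i \<mu>))"
  unfolding expected_return_eq[OF assms]
  by (intro sum.cong refl) (simp add: map_nth_paths[symmetric] integral_map_pmf)

lemma expected_return_Cons_paths:
  assumes "valid_rewards M"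
  shows "expected_return M (Suc n) h (map_pmf (Cons z) (paths M \<pi> n (Suc h) \<mu>)) =
    mean_reward M h z +
    (\<Sum>i<n. \<integral>z. mean_reward M (Suc h + i) z \<partial>pair_law \<pi> (Suc h + i) (state_law M \<pi> (Suc h) i \<mu>))"
proof -
  have "(\<integral>p. mean_reward M (Suc h + i) (p ! i) \<partial>paths M \<pi> n (Suc h) \<mu>) =
    (\<integral>z. mean_reward M (Suc h + i) z \<partial>pair_law \<pi> (Suc h + i) (state_law M \<pi> (Suc h) i \<mu>))"
    if "i < n" for i
    using that by (simp add: map_nth_paths[symmetric] integral_map_pmf del: add_Suc)
  then show ?thesis
    unfolding expected_return_eq[OF assms]
    by (subst sum.lessThan_Suc_shift) (simp add: integral_map_pmf)
qed

lemma integral_mean_reward_le: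
  assumes "valid_rewards M" "\<And>z. z \<in> set_pmf D \<Longrightarrow> mean_reward M h z \<le> c"
  shows "(\<integral>z. mean_reward M h z \<partial>measure_pmf D) \<le> c"
proof (rule measure_pmf.integral_le_const)
  show "integrable (measure_pmf D) (mean_reward M h)"
    by (intro measure_pmf.integrable_const_bound[where B=1]) (auto simp: mean_reward_le_1[OF assms(1)])
qed (use assms(2) in \<open>auto simp: AE_measure_pmf_iff\<close>)

lemma integral_mean_reward_eq:
  assumes "\<And>z. z \<in> set_pmf D \<Longrightarrow> mean_reward M h z = c"
  shows "(\<integral>z. mean_reward M h z \<partial>measure_pmf D) = c"
proof -
  have "(\<integral>z. mean_reward M h z \<partial>measure_pmf D) = (\<integral>z. c \<partial>measure_pmf D)"
    using assms by (intro integral_cong_AE) (auto simp: AE_measure_pmf_iff)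
  then show ?thesis by simp
qed

section \<open>Values and gaps when action \<open>0\<close> has the largest mean in every
  state\<close>

context
  fixes S A H :: nat and M :: mdp and R :: "nat \<Rightarrow> real"
  assumes M: "valid_rewards M" and A: "0 < A"
    and le: "\<And>h s a. mean_reward M h (s, a) \<le> R h"
    and eq: "\<And>h s. mean_reward M h (s, 0) = R h"
begin

lemma const_0_in_policies: "(\<lambda>h s. return_pmf 0) \<in> policies S A H"
  using A by (auto simp: policies_def)

lemma V_pol_const_0: "V_pol M H (\<lambda>h s. return_pmf 0) h s = (\<Sum>i<Suc H - h. R (h + i))"
  unfolding V_pol_def expected_return_paths[OF M]
  by (intro sum.cong refl integral_mean_reward_eq) (auto simp: set_pair_law eq)

text \<open>No policy collects more than \<open>R\<close> per step, and always playing
  \<open>0\<close> attains this from every state. The transitions thus have no influence on optimal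
  values.\<close>

lemma V_opt_eq: "V_opt S A H M h s = (\<Sum>i<Suc H - h. R (h + i))"
  unfolding V_opt_def
proof (rule antisym)
  have le': "V_pol M H \<pi> h s \<le> (\<Sum>i<Suc H - h. R (h + i))" for \<pi>
    unfolding V_pol_def expected_return_paths[OF M]
    by (intro sum_mono integral_mean_reward_le M) (auto simp: le)
  show "(SUP \<pi>\<in>policies S A H. V_pol M H \<pi> h s) \<le> (\<Sum>i<Suc H - h. R (h + i))"
    using const_0_in_policies le' by (intro cSUP_least) auto
  show "(\<Sum>i<Suc H - h. R (h + i)) \<le> (SUP \<pi>\<in>policies S A H. V_pol M H \<pi> h s)"
    using const_0_in_policies le'
    by (subst V_pol_const_0[of h s, symmetric], intro cSUP_upper) (auto simp: bdd_above_def)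
qed

lemma Q_opt_eq:
  assumes "h \<le> H"
  shows "Q_opt S A H M h s a = mean_reward M h (s, a) + (\<Sum>i<H - h. R (Suc h + i))"
  unfolding Q_opt_def
proof (rule antisym)
  have Q: "Q_pol M H \<pi> h s a = mean_reward M h (s, a) + (\<Sum>i<H - h. \<integral>z. mean_reward M (Suc h + i) z
      \<partial>pair_law \<pi> (Suc h + i) (state_law M \<pi> (Suc h) i (trans M h s a)))" for \<pi>
    using assms by (simp add: Q_pol_def Suc_diff_le expected_return_Cons_paths[OF M])
  have le': "Q_pol M H \<pi> h s a \<le> mean_reward M h (s, a) + (\<Sum>i<H - h. R (Suc h + i))" for \<pi>
    unfolding Q
    by (intro add_left_mono sum_mono integral_mean_reward_le M) (auto simp: le)
  have eq': "Q_pol M H (\<lambda>h s. return_pmf 0) h s a = mean_reward M h (s, a) + (\<Sum>i<H - h. R (Suc h + i))"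
    unfolding Q
    by (intro arg_cong2[where f="(+)"] sum.cong refl integral_mean_reward_eq) (auto simp: set_pair_law eq)
  show "(SUP \<pi>\<in>policies S A H. Q_pol M H \<pi> h s a) \<le> mean_reward M h (s, a) + (\<Sum>i<H - h. R (Suc h + i))"
    using const_0_in_policies le' by (intro cSUP_least) auto
  show "mean_reward M h (s, a) + (\<Sum>i<H - h. R (Suc h + i)) \<le> (SUP \<pi>\<in>policies S A H. Q_pol M H \<pi> h s a)"
    using const_0_in_policies le'
    by (subst eq'[symmetric], intro cSUP_upper) (auto simp: bdd_above_def)
qed

text \<open>The optimal continuation is worth the same in every successor state and cancels, leaving
  the difference of immediate means. This is how arbitrary gaps can be imposed on arbitrary
  kernels.\<close>

lemma Delta_eq:
  assumes "h \<le> H"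
  shows "Delta S A H M h s a = R h - mean_reward M h (s, a)"
proof -
  have "(\<Sum>i<Suc H - h. R (h + i)) = R h + (\<Sum>i<H - h. R (Suc h + i))"
    using assms by (simp only: Suc_diff_le sum.lessThan_Suc_shift) simp
  then show ?thesis
    unfolding Delta_def V_opt_eq Q_opt_eq[OF assms] by simp
qed

lemma optimal_det_const_0: "optimal_det S A H M (\<lambda>h s. 0)"
  using A by (simp add: optimal_det_def V_pol_const_0 V_opt_eq del: sum.lessThan_Suc)

end

text \<open>
  If the transitions from step \<open>g\<close> on forget the current pair, changing the action at step \<open>g\<close>
  changes the value only through the reward at that step.
\<close>

lemma optimal_plays_best:
  fixes b :: real
  assumes mdp: "is_mdp S A H M" and g: "g \<in> {1..H}" and s: "s < S" and a: "a < A"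
    and forget: "\<And>h s a. g \<le> h \<Longrightarrow> trans M h s a = trans M h 0 0"
    and reach: "\<And>\<pi>. 0 < pmf (state_law M \<pi> 1 (g - 1) (init M)) s"
    and best: "\<And>a'. a' < A \<Longrightarrow> a' \<noteq> a \<Longrightarrow> mean_reward M g (s, a') < mean_reward M g (s, a)"
    and \<pi>: "\<pi> \<in> policies S A H" and opt: "V0_opt S A H M - V0 M H \<pi> \<le> 0"
  shows "pmf (\<pi> g s) a = 1"
proof (rule ccontr)
  assume neq: "pmf (\<pi> g s) a \<noteq> 1"
  have M: "valid_rewards M" using mdp by (simp add: is_mdp_def valid_rewards_def)
  define \<rho> where "\<rho> = \<pi>(g := (\<pi> g)(s := return_pmf a))"
  have \<rho>: "\<rho> \<in> policies S A H"
    using \<pi> a by (auto simp: policies_def \<rho>_def)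
  have V0: "V0 M H \<pi> = (\<Sum>i<H. \<integral>z. mean_reward M (1 + i) z \<partial>pair_law \<pi> (1 + i) (state_law M \<pi> 1 i (init M)))" for \<pi>
    unfolding V0_def expected_return_paths[OF M] ..
  have "V0 M H \<sigma> \<le> real H" for \<sigma>
  proof -
    have "V0 M H \<sigma> \<le> (\<Sum>i<H. 1)"
      unfolding V0 using mean_reward_le_1[OF M]
      by (intro sum_mono integral_mean_reward_le M) (auto simp: abs_le_iff)
    then show ?thesis by simp
  qed
  then have "V0 M H \<rho> \<le> V0_opt S A H M"
    unfolding V0_opt_def using \<rho> by (intro cSUP_upper) (auto simp: bdd_above_def)
  with opt have le: "V0 M H \<rho> \<le> V0 M H \<pi>" by simp
  have pre: "state_law M \<rho> 1 i (init M) = state_law M \<pi> 1 i (init M)" if "i < g" for i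
    using that by (induction i) (auto simp: next_law_alt \<rho>_def)
  have next_forget: "next_law M \<sigma> h \<mu> = trans M h 0 0" if "g \<le> h" for \<sigma> h \<mu>
  proof -
    have "next_law M \<sigma> h \<mu> = bind_pmf \<mu> (\<lambda>s. bind_pmf (\<sigma> h s) (\<lambda>a. trans M h 0 0))"
      unfolding next_law_alt by (rule bind_pmf_cong bind_pmf_cong[OF refl] refl forget[OF that])+
    then show ?thesis by (simp only: bind_pmf_const)
  qed
  have post: "state_law M \<rho> 1 i (init M) = state_law M \<pi> 1 i (init M)" if "g \<le> i" for i
    using that g by (cases i) (auto simp: next_forget)
  \<comment> \<open>Up to step \<open>g\<close> the two policies meet the same states because they
    differ only at step \<open>g\<close>; afterwards the state law is fixed by
    \<open>forget\<close>. So their values can differ only through the reward at step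
    \<open>g\<close>, which has index \<open>g - 1\<close>.\<close>
  have st: "state_law M \<rho> 1 i (init M) = state_law M \<pi> 1 i (init M)" for i
    using pre[of i] post[of i] by linarith
  define \<mu> where "\<mu> = state_law M \<pi> 1 (g - 1) (init M)"
  let ?m = "mean_reward M g"
  let ?J = "\<lambda>\<sigma> i. \<integral>z. mean_reward M (1 + i) z \<partial>pair_law \<sigma> (1 + i) (state_law M \<pi> 1 i (init M))"
  have pl: "pair_law \<rho> (Suc i) \<nu> = pair_law \<pi> (Suc i) \<nu>" if "i \<noteq> g - 1" for i \<nu>
    using that g by (auto simp: pair_law_def \<rho>_def)
  have g': "1 + (g - 1) = g" "g - 1 < H" using g by auto
  have "V0 M H \<rho> - V0 M H \<pi> = (\<Sum>i<H. ?J \<rho> i - ?J \<pi> i)"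
    unfolding V0 st by (simp add: sum_subtractf)
  also have "\<dots> = (\<Sum>i\<in>{g - 1}. ?J \<rho> i - ?J \<pi> i)"
    using g' by (intro sum.mono_neutral_right) (auto simp: pl)
  also have "\<dots> = (\<integral>z. ?m z \<partial>pair_law \<rho> g \<mu>) - (\<integral>z. ?m z \<partial>pair_law \<pi> g \<mu>)"
    using g' by (simp add: \<mu>_def)
  finally have diff: "(\<integral>z. ?m z \<partial>pair_law \<rho> g \<mu>) \<le> (\<integral>z. ?m z \<partial>pair_law \<pi> g \<mu>)"
    using le by simp
  have sub: "set_pmf \<mu> \<subseteq> {..<S}"
    unfolding \<mu>_def using mdp \<pi> g by (intro set_state_law[where H=H and A=A]) (auto simp: is_mdp_def)
  have fin: "(\<integral>z. ?m z \<partial>pair_law \<sigma> g \<mu>) = (\<Sum>t<S. pmf \<mu> t * (\<Sum>b<A. pmf (\<sigma> g t) b * ?m (t, b)))"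
    if "\<sigma> \<in> policies S A H" for \<sigma>
  proof -
    have "(\<integral>z. ?m z \<partial>pair_law \<sigma> g \<mu>) = (\<Sum>z\<in>{..<S} \<times> {..<A}. ?m z * pmf (pair_law \<sigma> g \<mu>) z)"
      using sub that g by (intro integral_measure_pmf_real) (auto simp: set_pair_law policies_def subset_iff)
    then show ?thesis
      by (simp add: sum.cartesian_product' pmf_pair_law sum_distrib_left mult_ac)
  qed
  let ?G = "\<lambda>\<sigma> t. \<Sum>b<A. pmf (\<sigma> g t) b * ?m (t, b)"
  have sum1: "(\<Sum>b<A. pmf (\<pi> g s) b) = 1"
    using \<pi> g s by (intro sum_pmf_eq_1) (auto simp: policies_def)
  \<comment> \<open>Some mass of \<open>\<pi> g s\<close> lies on an action with strictly smaller
    mean. In all other states the two policies earn the same, and \<open>s\<close> has positive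
    weight by \<open>reach\<close>, so the modified policy would be strictly better.\<close>
  have "?G \<pi> s < (\<Sum>b<A. pmf (\<pi> g s) b * ?m (s, a))"
  proof (rule sum_strict_mono_ex1)
    show "\<forall>b\<in>{..<A}. pmf (\<pi> g s) b * ?m (s, b) \<le> pmf (\<pi> g s) b * ?m (s, a)"
      using best by (auto intro!: mult_left_mono) (metis less_imp_le order_refl)
    have "\<exists>b<A. b \<noteq> a \<and> pmf (\<pi> g s) b \<noteq> 0"
    proof (rule ccontr)
      assume "\<not> ?thesis"
      then have "(\<Sum>b<A. pmf (\<pi> g s) b) = (\<Sum>b\<in>{a}. pmf (\<pi> g s) b)"
        using a by (intro sum.mono_neutral_right) auto
      with sum1 neq show False by simp
    qed
    then obtain b where b: "b < A" "b \<noteq> a" "0 < pmf (\<pi> g s) b"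
      using pmf_nonneg by (metis less_le)
    then show "\<exists>b\<in>{..<A}. pmf (\<pi> g s) b * ?m (s, b) < pmf (\<pi> g s) b * ?m (s, a)"
      using best by (intro bexI[of _ b]) auto
  qed simp
  also have "\<dots> = ?m (s, a)"
    using sum1 by (simp add: sum_distrib_right[symmetric])
  also have "\<dots> = ?G \<rho> s"
    using a by (simp add: \<rho>_def indicator_def sum.delta if_distrib[where f="\<lambda>x. x * _"] cong: if_cong)
  finally have "?G \<pi> s < ?G \<rho> s" .
  then have "(\<Sum>t<S. pmf \<mu> t * ?G \<pi> t) < (\<Sum>t<S. pmf \<mu> t * ?G \<rho> t)"
    using s reach[of \<pi>, folded \<mu>_def]
    by (intro sum_strict_mono_ex1) (auto simp: \<rho>_def intro!: mult_left_mono bexI[of _ s] mult_strict_left_mono)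
  with diff show False
    unfolding fin[OF \<rho>] fin[OF \<pi>] by simp
qed

section \<open>Runs of an algorithm\<close>

text \<open>Policies carry no sigma-algebra of their own; measurability is expressed through the
  action probabilities in range, which are all that an episode depends on.\<close>

definition policy_valued :: "nat \<Rightarrow> nat \<Rightarrow> nat \<Rightarrow> 'a measure \<Rightarrow> ('a \<Rightarrow> policy) \<Rightarrow> bool" where
  "policy_valued S A H N \<sigma> \<longleftrightarrow> (\<forall>\<omega>. \<sigma> \<omega> \<in> policies S A H) \<and>
     (\<forall>h\<in>{1..H}. \<forall>s<S. \<forall>a<A. (\<lambda>\<omega>. pmf (\<sigma> \<omega> h s) a) \<in> borel_measurable N)"

lemma pmf_paths_Nil: "pmf (paths M \<pi> (Suc n) h \<mu>) [] = 0"
  by (auto simp: pmf_eq_0_set_pmf dest: length_paths)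

lemma pmf_paths_Cons:
  "pmf (paths M \<pi> (Suc n) h \<mu>) ((s, a) # p) =
     pmf \<mu> s * pmf (\<pi> h s) a * pmf (paths M \<pi> n (Suc h) (trans M h s a)) p"
proof -
  let ?D = "\<lambda>(s, a). map_pmf (Cons (s, a)) (paths M \<pi> n (Suc h) (trans M h s a))"
  have "paths M \<pi> (Suc n) h \<mu> = bind_pmf (pair_law \<pi> h \<mu>) ?D"
    by (simp add: pair_law_def bind_assoc_pmf bind_map_pmf)
  moreover have "pmf (?D z) ((s, a) # p) =
      indicator {(s, a)} z * pmf (paths M \<pi> n (Suc h) (trans M h s a)) p" for z
  proof (cases "z = (s, a)")
    case True
    then show ?thesis by (simp add: pmf_map_inj' inj_def)
  next
    case False
    then show ?thesis by (auto simp: pmf_eq_0_set_pmf split: prod.split)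
  qed
  ultimately show ?thesis
    by (simp add: pmf_bind measure_pmf_single pmf_pair_law)
qed

text \<open>The probability of a path is a product of constants and action probabilities, or zero if
  the path leaves the range.\<close>

lemma measurable_pmf_paths:
  assumes \<sigma>: "policy_valued S A H N \<sigma>" and M: "is_mdp S A H M"
    and "1 \<le> h" "h + n \<le> Suc H" "set_pmf \<mu> \<subseteq> {..<S}"
  shows "(\<lambda>\<omega>. pmf (paths M (\<sigma> \<omega>) n h \<mu>) p) \<in> borel_measurable N"
  using assms(3-)
proof (induction n arbitrary: h \<mu> p)
  case (Suc n)
  show ?case
  proof (cases p)
    case (Cons z q)
    obtain s a where z: "z = (s, a)" by fastforce
    have h: "h \<in> {1..H}" using Suc.prems by auto
    show ?thesis
    proof (cases "s < S \<and> a < A")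
      case True
      \<comment> \<open>The last pair is treated separately: there \<open>h\<close> may equal
        \<open>H\<close>, where nothing confines the kernel to the states, but the remaining path is
        empty.\<close>
      show ?thesis
      proof (cases "n = 0")
        case False
        then have "h \<in> {1..<H}" using Suc.prems by auto
        then have "set_pmf (trans M h s a) \<subseteq> {..<S}" using M True by (simp add: is_mdp_def)
        then show ?thesis
          using True \<sigma> h Suc.prems
          unfolding Cons z pmf_paths_Cons
          by (intro borel_measurable_times Suc.IH) (auto simp: policy_valued_def)
      next
        case n: True
        show ?thesis
          using True \<sigma> h unfolding Cons z pmf_paths_Cons
          by (intro borel_measurable_times) (auto simp: policy_valued_def n)
      qed
    next
      case False
      \<comment> \<open>Out of range the action probability need not be measurable, but the product
        vanishes for every policy.\<close>
      have "pmf \<mu> s * pmf (\<sigma> \<omega> h s) a = 0" for \<omega>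
      proof (cases "s < S")
        case True
        then have "set_pmf (\<sigma> \<omega> h s) \<subseteq> {..<A}"
          using \<sigma> h by (auto simp: policy_valued_def policies_def)
        with True False show ?thesis by (auto simp: pmf_eq_0_set_pmf)
      next
        case False
        then show ?thesis using Suc.prems(3) by (auto simp: pmf_eq_0_set_pmf)
      qed
      then have "(\<lambda>\<omega>. pmf (paths M (\<sigma> \<omega>) (Suc n) h \<mu>) p) = (\<lambda>\<omega>. 0)"
        unfolding Cons z pmf_paths_Cons by (intro ext) (simp only: mult_zero_left)
      then show ?thesis
        by (simp only: borel_measurable_const)
    qed
  qed (simp add: pmf_paths_Nil del: paths.simps)
qed simp

text \<open>On a countable type every event probability is a countable sum of point
  probabilities.\<close>

lemma measurable_pmf_kernel:
  fixes D :: "'a \<Rightarrow> 'b::countable pmf"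
  assumes "\<And>x. (\<lambda>\<omega>. pmf (D \<omega>) x) \<in> borel_measurable N"
  shows "(\<lambda>\<omega>. measure_pmf (D \<omega>)) \<in> measurable N (prob_algebra (count_space UNIV))"
proof (rule measurable_prob_algebraI)
  interpret sigma_finite_measure "count_space B" for B :: "'b set"
    by (rule sigma_finite_measure_count_space_countable) simp
  have *: "(\<lambda>(\<omega>, x). ennreal (pmf (D \<omega>) x)) \<in> borel_measurable (N \<Otimes>\<^sub>M count_space B)" for B
    by (subst measurable_pair_swap_iff, rule measurable_pair_measure_countable1) (auto simp: assms)
  show "(\<lambda>\<omega>. measure_pmf (D \<omega>)) \<in> measurable N (subprob_algebra (count_space UNIV))"
  proof (rule measurable_subprob_algebra)
    fix B :: "'b set"
    have "(\<lambda>\<omega>. \<integral>\<^sup>+x. ennreal (pmf (D \<omega>) x) \<partial>count_space B) \<in> borel_measurable N"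
      by (rule borel_measurable_nn_integral[OF *])
    then show "(\<lambda>\<omega>. emeasure (measure_pmf (D \<omega>)) B) \<in> borel_measurable N"
      by (simp add: nn_integral_pmf)
  qed (auto intro: measure_pmf.prob_space_axioms prob_space_imp_subprob_space)
qed (rule measure_pmf.prob_space_axioms)

lemma is_mdp_valid_rewards: "is_mdp S A H M \<Longrightarrow> valid_rewards M"
  by (simp add: is_mdp_def valid_rewards_def)

lemma episode_kernel:
  assumes \<sigma>: "policy_valued S A H N \<sigma>" and M: "is_mdp S A H M"
  shows "(\<lambda>\<omega>. episode M H (\<sigma> \<omega>)) \<in> measurable N (prob_algebra (traj_space H))"
  unfolding episode_def rewarded_def
proof (rule measurable_bind_prob_space)
  show "(\<lambda>\<omega>. measure_pmf (paths M (\<sigma> \<omega>) H 1 (init M))) \<in> measurable N (prob_algebra (count_space UNIV))"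
    using M by (intro measurable_pmf_kernel measurable_pmf_paths[OF \<sigma> M]) (auto simp: is_mdp_def)
  show "(\<lambda>p. distr (reward_space M H 1 p) (traj_space H) (Pair p))
      \<in> measurable (count_space UNIV) (prob_algebra (traj_space H))"
    by (rule rewarded_kernel[OF is_mdp_valid_rewards[OF M]])
qed

text \<open>Exactly what the decisions of round \<open>k\<close> may depend on: all earlier rounds
  and the fresh seed, but not the trajectory of round \<open>k\<close>.\<close>

definition info :: "nat \<Rightarrow> history \<Rightarrow> history \<times> real" where
  "info k \<omega> = (restrict \<omega> {0..<k}, fst (\<omega> k))"

locale interaction =
  fixes S A H :: nat and M :: mdp and alg :: algorithm
  assumes mdp: "is_mdp S A H M" and algorithm: "is_algorithm S A H alg"
begin

lemma policy_valued_select: "policy_valued S A H (info_space H k) (\<lambda>z. select alg k (fst z) (snd z))"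
  using algorithm
  by (auto simp: policy_valued_def is_algorithm_def measurable_rule_def split_def)

lemma seed_in_prob_algebra: "seed alg \<in> space (prob_algebra borel)"
  using algorithm by (simp add: is_algorithm_def space_prob_algebra)

lemma sets_seed[measurable_cong]: "sets (seed alg) = sets borel"
  using algorithm by (simp add: is_algorithm_def)

sublocale seed: prob_space "seed alg"
  using algorithm by (simp add: is_algorithm_def)

lemma episode_select_kernel:
  "(\<lambda>z. episode M H (select alg k (fst z) (snd z)))
     \<in> measurable (info_space H k) (prob_algebra (traj_space H))"
  by (rule episode_kernel[OF policy_valued_select mdp])

lemma tagged_episode_kernel:
  "(\<lambda>(x, u). distr (episode M H (select alg k x u)) (round_space H) (Pair u))
     \<in> measurable (PiM {0..<k} (\<lambda>_. round_space H) \<Otimes>\<^sub>M borel) (prob_algebra (round_space H))"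
proof -
  have "(\<lambda>z. distr (episode M H (select alg k (fst z) (snd z))) (round_space H) (Pair (snd z)))
     \<in> measurable (info_space H k) (prob_algebra (round_space H))"
    by (rule measurable_distr_prob_space2[OF episode_select_kernel])
       (simp add: info_space_def round_space_def)
  then show ?thesis
    by (simp add: info_space_def split_def)
qed

lemma round_law_kernel:
  "round_law M H alg k \<in> measurable (PiM {0..<k} (\<lambda>_. round_space H)) (prob_algebra (round_space H))"
  unfolding round_law_def
  by (rule measurable_bind_prob_space2[OF measurable_const[OF seed_in_prob_algebra] tagged_episode_kernel])

sublocale Ionescu_Tulcea "round_law M H alg" "\<lambda>_. round_space H"
proof (rule Ionescu_Tulcea.intro)
  fix i :: nat
  show "round_law M H alg i \<in> measurable (PiM {0..<i} (\<lambda>_. round_space H)) (subprob_algebra (round_space H))"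
    by (rule measurable_prob_algebraD[OF round_law_kernel])
  fix x assume "x \<in> space (PiM {0..<i} (\<lambda>_. round_space H))"
  from measurable_space[OF round_law_kernel this] show "prob_space (round_law M H alg i x)"
    by (simp add: space_prob_algebra)
qed

lemma run_eq_lim: "run M H alg = PF.lim"
  by (simp add: run_def)

lemma sets_run[measurable_cong]: "sets (run M H alg) = sets (PiM UNIV (\<lambda>_. round_space H))"
  by (simp add: run_eq_lim)

text \<open>The law of the first \<open>k\<close> rounds; the empty history is the single point of
  the empty product, the constant \<open>undefined\<close>. Inductions over rounds take place on
  these finite products and are carried to the infinite run by \<open>distr_run\<close>.\<close>

definition prefix_law :: "nat \<Rightarrow> history measure" where
  "prefix_law k = C 0 k (\<lambda>_. undefined)"

lemma sets_prefix_law[measurable_cong]: "sets (prefix_law k) = sets (PiM {0..<k} (\<lambda>_. round_space H))"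
  by (simp add: prefix_law_def sets_C)

lemma space_prefix_law: "space (prefix_law k) = space (PiM {0..<k} (\<lambda>_. round_space H))"
  by (rule sets_eq_imp_space_eq[OF sets_prefix_law])

lemma distr_run: "distr (run M H alg) (PiM {0..<k} (\<lambda>_. round_space H)) (\<lambda>\<omega>. restrict \<omega> {0..<k}) = prefix_law k"
proof -
  \<comment> \<open>\<open>up_to J\<close> is the least bound beyond which \<open>J\<close> has no
    index, so for an initial segment the finite marginal \<open>CI\<close> is \<open>C 0 k\<close>
    without any further projection.\<close>
  have "up_to {0..<k} \<le> k"
    by (simp add: up_to_iff)
  moreover have "k \<le> up_to {0..<k}"
    using up_to[of "{0..<k}"] by (cases k) (auto simp: subset_iff)
  ultimately have u: "up_to {0..<k} = k" by simp
  show ?thesis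
    unfolding run_eq_lim prefix_law_def
    using distr_C[of k k "\<lambda>_. undefined" 0] by (subst distr_lim) (simp_all add: CI_def u)
qed

lemma measurable_restrict_run: "(\<lambda>\<omega>. restrict \<omega> {0..<k}) \<in> measurable (run M H alg) (PiM {0..<k} (\<lambda>_. round_space H))"
  unfolding measurable_cong_sets[OF sets_run refl]
  by (intro measurable_restrict measurable_component_singleton) simp

sublocale run: prob_space "run M H alg"
proof (rule prob_space_distrD[OF measurable_restrict_run])
  show "prob_space (distr (run M H alg) (PiM {0..<0} (\<lambda>_. round_space H)) (\<lambda>\<omega>. restrict \<omega> {0..<0}))"
    unfolding distr_run prefix_law_def by (rule prob_space_C) simp
qed

lemma nn_integral_run_prefix:
  assumes "f \<in> borel_measurable (PiM {0..<k} (\<lambda>_. round_space H))"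
  shows "(\<integral>\<^sup>+\<omega>. f (restrict \<omega> {0..<k}) \<partial>run M H alg) = (\<integral>\<^sup>+x. f x \<partial>prefix_law k)"
  unfolding distr_run[symmetric]
  by (subst nn_integral_distr[OF measurable_restrict_run]) (simp_all add: assms)

lemma sets_episode: "sets (episode M H \<pi>) = sets (traj_space H)"
  by (simp add: episode_def sets_rewarded[OF is_mdp_valid_rewards[OF mdp]])

lemma nn_integral_round_law:
  assumes x: "x \<in> space (PiM {0..<k} (\<lambda>_. round_space H))" and f: "f \<in> borel_measurable (round_space H)"
  shows "(\<integral>\<^sup>+y. f y \<partial>round_law M H alg k x) =
    (\<integral>\<^sup>+u. \<integral>\<^sup>+\<tau>. f (u, \<tau>) \<partial>episode M H (select alg k x u) \<partial>seed alg)"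
proof -
  have k: "(\<lambda>u. distr (episode M H (select alg k x u)) (round_space H) (Pair u))
      \<in> measurable (seed alg) (subprob_algebra (round_space H))"
    unfolding measurable_cong_sets[OF sets_seed refl]
    by (rule measurable_prob_algebraD) (use measurable_compose_Pair1[OF x tagged_episode_kernel[of k]] in simp)
  have "Pair u \<in> measurable (traj_space H) (round_space H)" for u
    by (simp add: round_space_def)
  then have p: "Pair u \<in> measurable (episode M H \<pi>) (round_space H)" for u \<pi>
    using measurable_cong_sets[OF sets_episode refl] by blast
  show ?thesis
    unfolding round_law_def
    unfolding nn_integral_bind[OF f k]
    by (intro nn_integral_cong, subst nn_integral_distr[OF p]) (simp_all add: f)
qed

text \<open>The recursion behind the change of measure: it isolates the last episode given the past
  and the seed, and only the episode's law depends on the MDP.\<close>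

lemma nn_integral_prefix_law_Suc:
  assumes f: "f \<in> borel_measurable (PiM {0..<Suc k} (\<lambda>_. round_space H))"
  shows "(\<integral>\<^sup>+x. f x \<partial>prefix_law (Suc k)) =
    (\<integral>\<^sup>+x. \<integral>\<^sup>+u. \<integral>\<^sup>+\<tau>. f (x(k := (u, \<tau>))) \<partial>episode M H (select alg k x u) \<partial>seed alg \<partial>prefix_law k)"
proof -
  have "(\<integral>\<^sup>+x. f x \<partial>prefix_law (Suc k)) = (\<integral>\<^sup>+x. \<integral>\<^sup>+y. f y \<partial>eP k x \<partial>prefix_law k)"
    using measurable_eP[of k] unfolding prefix_law_def
    by (simp, subst nn_integral_bind[where B="PiM {0..<Suc k} (\<lambda>_. round_space H)"])
       (auto simp: f measurable_cong_sets[OF sets_C refl])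
  also have "\<dots> = (\<integral>\<^sup>+x. \<integral>\<^sup>+y. f (x(k := y)) \<partial>round_law M H alg k x \<partial>prefix_law k)"
    by (intro nn_integral_cong) (simp add: space_prefix_law nn_integral_eP f)
  also have "\<dots> = (\<integral>\<^sup>+x. \<integral>\<^sup>+u. \<integral>\<^sup>+\<tau>. f (x(k := (u, \<tau>))) \<partial>episode M H (select alg k x u) \<partial>seed alg \<partial>prefix_law k)"
  proof (rule nn_integral_cong)
    fix x assume x: "x \<in> space (prefix_law k)"
    have "(\<lambda>y. x(k := y)) \<in> measurable (round_space H) (PiM {0..<Suc k} (\<lambda>_. round_space H))"
      using x by (intro measurable_fun_upd[where J="{0..<k}"]) (auto simp: space_prefix_law)
    then have "(\<lambda>y. f (x(k := y))) \<in> borel_measurable (round_space H)"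
      by (rule measurable_compose) (rule f)
    then show "(\<integral>\<^sup>+y. f (x(k := y)) \<partial>round_law M H alg k x) =
      (\<integral>\<^sup>+u. \<integral>\<^sup>+\<tau>. f (x(k := (u, \<tau>))) \<partial>episode M H (select alg k x u) \<partial>seed alg)"
      using x by (subst nn_integral_round_law) (auto simp: space_prefix_law)
  qed
  finally show ?thesis .
qed

end

section \<open>Stopping rounds\<close>

text \<open>Since a round decides on stopping before it plays, the episode of round \<open>j\<close>
  is played exactly when \<open>unstopped alg (Suc j)\<close> holds; this shift by one recurs
  throughout.\<close>

definition unstopped :: "algorithm \<Rightarrow> nat \<Rightarrow> history \<Rightarrow> bool" where
  "unstopped alg k \<omega> \<longleftrightarrow> (\<forall>i<k. \<not> stops_at alg \<omega> i)"

definition halts :: "algorithm \<Rightarrow> nat \<Rightarrow> history \<Rightarrow> bool" where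
  "halts alg k \<omega> \<longleftrightarrow> unstopped alg k \<omega> \<and> stops_at alg \<omega> k"

text \<open>
  Whether the algorithm has stopped by round \<open>k\<close> depends on a history only through \<open>info k\<close>; the
  following canonical history with given information turns this into a measurability statement.
\<close>

definition extend :: "nat \<Rightarrow> history \<times> real \<Rightarrow> history" where
  "extend k z = (fst z)(k := (snd z, undefined))"

lemma stops_at_extend_info: "i \<le> k \<Longrightarrow> stops_at alg (extend k (info k \<omega>)) i = stops_at alg \<omega> i"
proof -
  assume "i \<le> k"
  then have "restrict (extend k (info k \<omega>)) {0..<i} = restrict \<omega> {0..<i}"
    and "fst (extend k (info k \<omega>) i) = fst (\<omega> i)"
    by (auto simp: extend_def info_def restrict_def)
  then show ?thesis by (simp add: stops_at_def)
qed

lemma unstopped_extend_info: "i \<le> Suc k \<Longrightarrow> unstopped alg i (extend k (info k \<omega>)) = unstopped alg i \<omega>"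
  by (auto simp: unstopped_def stops_at_extend_info)

lemma halts_extend_info: "i \<le> k \<Longrightarrow> halts alg i (extend k (info k \<omega>)) = halts alg i \<omega>"
  by (simp add: halts_def unstopped_extend_info stops_at_extend_info)

text \<open>Once the first stopping round is known, every \<open>halts\<close> and
  \<open>unstopped\<close> becomes a comparison of indices, so sums and products over rounds
  collapse.\<close>

lemma halting_cases:
  obtains (unstopped) "unstopped alg n \<omega>" "\<And>j. j < n \<Longrightarrow> \<not> halts alg j \<omega> \<and> unstopped alg (Suc j) \<omega>"
  | (halts) k where "k < n" "halts alg k \<omega>" "\<not> unstopped alg n \<omega>"
      "\<And>j. halts alg j \<omega> \<longleftrightarrow> j = k" "\<And>j. unstopped alg (Suc j) \<omega> \<longleftrightarrow> j < k"
proof (cases "unstopped alg n \<omega>")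
  case True
  then show ?thesis by (intro unstopped) (auto simp: halts_def unstopped_def)
next
  case False
  define k where "k = (LEAST i. stops_at alg \<omega> i)"
  from False obtain i where i: "i < n" "stops_at alg \<omega> i" by (auto simp: unstopped_def)
  have k: "stops_at alg \<omega> k" "\<And>j. j < k \<Longrightarrow> \<not> stops_at alg \<omega> j"
    unfolding k_def using i by (auto intro: LeastI dest: not_less_Least)
  have "k \<le> i" unfolding k_def using i by (auto intro: Least_le)
  show ?thesis
  proof (rule halts)
    show "k < n" using \<open>k \<le> i\<close> i by simp
    show "halts alg k \<omega>" using k by (simp add: halts_def unstopped_def)
    show "halts alg j \<omega> \<longleftrightarrow> j = k" for j
      using k by (auto simp: halts_def unstopped_def) (metis nat_neq_iff)
    show "unstopped alg (Suc j) \<omega> \<longleftrightarrow> j < k" for j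
      using k by (auto simp: unstopped_def not_less[symmetric]) (meson less_Suc_eq_le not_le)
  qed (use False in simp)
qed

lemma returned_eq:
  assumes "halts alg k \<omega>"
  shows "returned alg \<omega> = recommend alg k (fst (info k \<omega>)) (snd (info k \<omega>))"
proof -
  have "(LEAST i. stops_at alg \<omega> i) = k"
    using assms by (intro Least_equality) (auto simp: halts_def unstopped_def not_less[symmetric])
  then show ?thesis by (simp add: returned_def info_def)
qed

context interaction
begin

lemma measurable_info[measurable]: "info k \<in> measurable (run M H alg) (info_space H k)"
  unfolding info_def info_space_def measurable_cong_sets[OF sets_run refl]
  by (intro measurable_Pair measurable_restrict measurable_component_singleton
        measurable_compose[OF measurable_component_singleton[of k]]) (auto simp: round_space_def)

lemma measurable_last_trajectory[measurable]: "(\<lambda>\<omega>. snd (\<omega> k)) \<in> measurable (run M H alg) (traj_space H)"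
  unfolding measurable_cong_sets[OF sets_run refl]
  by (intro measurable_compose[OF measurable_component_singleton[of k]]) (auto simp: round_space_def)

lemma measurable_stops_at_extend:
  assumes "i \<le> k"
  shows "Measurable.pred (info_space H k) (\<lambda>z. stops_at alg (extend k z) i)"
proof -
  have stop: "(\<lambda>z. stop alg i (fst z) (snd z)) \<in> measurable (info_space H i) (count_space UNIV)"
    using algorithm by (auto simp: is_algorithm_def split_def)
  have "(\<lambda>z. (restrict (extend k z) {0..<i}, fst (extend k z i))) \<in> measurable (info_space H k) (info_space H i)"
  proof (cases "i = k")
    case True
    have "(restrict (extend k z) {0..<i}, fst (extend k z i)) = z" if "z \<in> space (info_space H k)" for z
      using that by (auto simp: True extend_def info_space_def space_pair_measure space_PiM PiE_def
          extensional_restrict intro!: prod_eqI ext simp: restrict_def extensional_def)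
    then show ?thesis
      by (subst measurable_cong[where g="\<lambda>z. z"]) (auto simp: True)
  next
    case False
    with assms have i: "i < k" by simp
    have eq: "(\<lambda>z. (restrict (extend k z) {0..<i}, fst (extend k z i))) =
      (\<lambda>z. (\<lambda>j\<in>{0..<i}. fst z j, fst (fst z i)))"
      using i by (auto simp: extend_def restrict_def fun_eq_iff)
    show ?thesis
      unfolding eq info_space_def
      by (intro measurable_Pair measurable_restrict measurable_compose[OF measurable_fst measurable_component_singleton]
          measurable_compose[OF measurable_fst measurable_compose[OF measurable_component_singleton[of i]]])
         (use i in \<open>auto simp: round_space_def\<close>)
  qed
  from measurable_compose[OF this stop] show ?thesis
    by (simp add: stops_at_def pred_def)
qed

lemma measurable_unstopped_extend:
  assumes "i \<le> Suc k"
  shows "Measurable.pred (info_space H k) (\<lambda>z. unstopped alg i (extend k z))"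
proof -
  have "(\<lambda>z. unstopped alg i (extend k z)) = (\<lambda>z. \<forall>j\<in>{..<i}. \<not> stops_at alg (extend k z) j)"
    by (auto simp: unstopped_def)
  then show ?thesis
    using assms by (simp only:) (intro pred_intros_finite pred_intros_logic measurable_stops_at_extend; simp)
qed

lemma measurable_halts_extend:
  assumes "i \<le> k"
  shows "Measurable.pred (info_space H k) (\<lambda>z. halts alg i (extend k z))"
  unfolding halts_def using assms
  by (intro pred_intros_logic measurable_stops_at_extend measurable_unstopped_extend) auto

lemma measurable_unstopped[measurable]: "Measurable.pred (run M H alg) (unstopped alg k)"
  using measurable_compose[OF measurable_info measurable_unstopped_extend[of k k]]
  by (simp add: unstopped_extend_info)

lemma measurable_halts[measurable]: "Measurable.pred (run M H alg) (halts alg k)"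
  using measurable_compose[OF measurable_info measurable_halts_extend[of k k]]
  by (simp add: halts_extend_info)

lemma nn_integral_run_round:
  assumes f: "f \<in> borel_measurable (info_space H k \<Otimes>\<^sub>M traj_space H)"
  shows "(\<integral>\<^sup>+\<omega>. f (info k \<omega>, snd (\<omega> k)) \<partial>run M H alg) =
    (\<integral>\<^sup>+x. \<integral>\<^sup>+u. \<integral>\<^sup>+\<tau>. f ((x, u), \<tau>) \<partial>episode M H (select alg k x u) \<partial>seed alg \<partial>prefix_law k)"
proof -
  define g where "g x = f ((restrict x {0..<k}, fst (x k)), snd (x k))" for x :: history
  have "(\<lambda>x. ((restrict x {0..<k}, fst (x k)), snd (x k)))
      \<in> measurable (PiM {0..<Suc k} (\<lambda>_. round_space H)) (info_space H k \<Otimes>\<^sub>M traj_space H)"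
    unfolding info_space_def
    by (intro measurable_Pair measurable_restrict measurable_component_singleton
        measurable_compose[OF measurable_component_singleton[of k]]) (auto simp: round_space_def)
  from measurable_compose[OF this f] have g: "g \<in> borel_measurable (PiM {0..<Suc k} (\<lambda>_. round_space H))"
    by (simp add: g_def[abs_def])
  have "f (info k \<omega>, snd (\<omega> k)) = g (restrict \<omega> {0..<Suc k})" for \<omega>
  proof -
    have "restrict (restrict \<omega> {0..<Suc k}) {0..<k} = restrict \<omega> {0..<k}"
      by (auto simp: restrict_def)
    then show ?thesis by (simp add: g_def info_def)
  qed
  then have "(\<integral>\<^sup>+\<omega>. f (info k \<omega>, snd (\<omega> k)) \<partial>run M H alg) = (\<integral>\<^sup>+x. g x \<partial>prefix_law (Suc k))"
    using nn_integral_run_prefix[OF g] by simp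
  also have "\<dots> = (\<integral>\<^sup>+x. \<integral>\<^sup>+u. \<integral>\<^sup>+\<tau>. f ((x, u), \<tau>) \<partial>episode M H (select alg k x u) \<partial>seed alg \<partial>prefix_law k)"
  proof (subst nn_integral_prefix_law_Suc[OF g], intro nn_integral_cong)
    fix x u \<tau> assume "x \<in> space (prefix_law k)"
    then have "restrict (x(k := (u, \<tau>))) {0..<k} = x"
      by (auto simp: space_prefix_law space_PiM PiE_iff extensional_def restrict_def fun_eq_iff)
    then show "g (x(k := (u, \<tau>))) = f ((x, u), \<tau>)"
      by (simp add: g_def)
  qed
  finally show ?thesis .
qed

lemma prob_space_episode: "prob_space (episode M H \<pi>)"
  by (simp add: episode_def prob_space_rewarded[OF is_mdp_valid_rewards[OF mdp]])

lemma nn_integral_run_info: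
  assumes f: "f \<in> borel_measurable (info_space H k)"
  shows "(\<integral>\<^sup>+\<omega>. f (info k \<omega>) \<partial>run M H alg) = (\<integral>\<^sup>+x. \<integral>\<^sup>+u. f (x, u) \<partial>seed alg \<partial>prefix_law k)"
  using nn_integral_run_round[of "\<lambda>z. f (fst z)" k] f
  by (simp add: prob_space.emeasure_space_1[OF prob_space_episode])

lemma nn_integral_episode_measurable:
  assumes f: "f \<in> borel_measurable (info_space H k \<Otimes>\<^sub>M traj_space H)"
  shows "(\<lambda>z. \<integral>\<^sup>+\<tau>. f (z, \<tau>) \<partial>episode M H (select alg k (fst z) (snd z))) \<in> borel_measurable (info_space H k)"
  using f by (intro nn_integral_measurable_subprob_algebra2[where N="traj_space H"]
      measurable_prob_algebraD[OF episode_select_kernel]) simp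

text \<open>The tower property for round \<open>k\<close>: given \<open>info k\<close>, the
  trajectory is an episode of the selected policy.\<close>

lemma nn_integral_run_select:
  assumes f: "f \<in> borel_measurable (info_space H k \<Otimes>\<^sub>M traj_space H)"
  shows "(\<integral>\<^sup>+\<omega>. f (info k \<omega>, snd (\<omega> k)) \<partial>run M H alg) =
    (\<integral>\<^sup>+\<omega>. \<integral>\<^sup>+\<tau>. f (info k \<omega>, \<tau>) \<partial>episode M H (select alg k (fst (info k \<omega>)) (snd (info k \<omega>))) \<partial>run M H alg)"
  unfolding nn_integral_run_round[OF f]
    nn_integral_run_info[OF nn_integral_episode_measurable[OF f]] by simp

text \<open>Log-likelihoods take both signs, so the nonnegative version does not apply to them
  directly. Applied to indicators, it identifies the joint law of information and trajectory as
  \<open>J \<bind> K\<close>, and that identity yields the Bochner integral.\<close>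

lemma integral_run_select:
  fixes f :: "(history \<times> real) \<times> trajectory \<Rightarrow> real"
  assumes f: "f \<in> borel_measurable (info_space H k \<Otimes>\<^sub>M traj_space H)" and B: "\<And>z. \<bar>f z\<bar> \<le> B"
  shows "(\<integral>\<omega>. f (info k \<omega>, snd (\<omega> k)) \<partial>run M H alg) =
    (\<integral>\<omega>. \<integral>\<tau>. f (info k \<omega>, \<tau>) \<partial>episode M H (select alg k (fst (info k \<omega>)) (snd (info k \<omega>))) \<partial>run M H alg)"
proof -
  let ?N = "info_space H k \<Otimes>\<^sub>M traj_space H"
  define K where "K z = distr (episode M H (select alg k (fst z) (snd z))) ?N (Pair z)" for z
  define J where "J = distr (run M H alg) (info_space H k) (info k)"
  have Kp: "K \<in> measurable (info_space H k) (prob_algebra ?N)"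
    unfolding K_def
    by (rule measurable_distr_prob_space2[OF episode_select_kernel]) simp
  have sJ: "sets J = sets (info_space H k)" by (simp add: J_def)
  have K: "K \<in> measurable J (subprob_algebra ?N)"
    unfolding measurable_cong_sets[OF sJ refl] by (rule measurable_prob_algebraD[OF Kp])
  interpret J: prob_space J unfolding J_def by (rule run.prob_space_distr) simp
  have P: "Pair z \<in> measurable (episode M H \<pi>) ?N" if "z \<in> space (info_space H k)" for z \<pi>
    unfolding measurable_cong_sets[OF sets_episode refl] using that by simp
  have pair: "(\<lambda>\<omega>. (info k \<omega>, snd (\<omega> k))) \<in> measurable (run M H alg) ?N" by simp
  have "distr (run M H alg) ?N (\<lambda>\<omega>. (info k \<omega>, snd (\<omega> k))) = J \<bind> K"
  proof (rule measure_eqI)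
    show "sets (distr (run M H alg) ?N (\<lambda>\<omega>. (info k \<omega>, snd (\<omega> k)))) = sets (J \<bind> K)"
      using J.not_empty by (subst sets_bind[of _ _ ?N]) (auto simp: K_def)
    fix X assume "X \<in> sets (distr (run M H alg) ?N (\<lambda>\<omega>. (info k \<omega>, snd (\<omega> k))))"
    then have X: "X \<in> sets ?N" by simp
    then have iX: "indicator X \<in> borel_measurable ?N" by simp
    have "emeasure (distr (run M H alg) ?N (\<lambda>\<omega>. (info k \<omega>, snd (\<omega> k)))) X =
      (\<integral>\<^sup>+\<omega>. indicator X (info k \<omega>, snd (\<omega> k)) \<partial>run M H alg)"
      using nn_integral_distr[OF pair, of "indicator X"] X by simp
    also have "\<dots> = (\<integral>\<^sup>+\<omega>. \<integral>\<^sup>+\<tau>. indicator X (info k \<omega>, \<tau>) \<partial>episode M H (select alg k (fst (info k \<omega>)) (snd (info k \<omega>))) \<partial>run M H alg)"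
      by (rule nn_integral_run_select[OF iX])
    also have "\<dots> = (\<integral>\<^sup>+z. \<integral>\<^sup>+\<tau>. indicator X (z, \<tau>) \<partial>episode M H (select alg k (fst z) (snd z)) \<partial>J)"
      unfolding J_def by (subst nn_integral_distr) (auto simp: nn_integral_episode_measurable[OF iX])
    also have "\<dots> = (\<integral>\<^sup>+z. emeasure (K z) X \<partial>J)"
    proof (rule nn_integral_cong)
      fix z assume "z \<in> space J"
      then have z: "z \<in> space (info_space H k)" by (simp add: J_def)
      show "(\<integral>\<^sup>+\<tau>. indicator X (z, \<tau>) \<partial>episode M H (select alg k (fst z) (snd z))) = emeasure (K z) X"
        unfolding K_def
        by (subst nn_integral_distr[OF P[OF z], symmetric]) (simp_all add: X iX)
    qed
    also have "\<dots> = emeasure (J \<bind> K) X"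
      by (rule emeasure_bind[OF J.not_empty K X, symmetric])
    finally show "emeasure (distr (run M H alg) ?N (\<lambda>\<omega>. (info k \<omega>, snd (\<omega> k)))) X = emeasure (J \<bind> K) X" .
  qed
  from this[symmetric] have "(\<integral>\<omega>. f (info k \<omega>, snd (\<omega> k)) \<partial>run M H alg) = integral\<^sup>L (J \<bind> K) f"
    by (simp only: integral_distr[OF pair f])
  also have "\<dots> = (\<integral>z. integral\<^sup>L (K z) f \<partial>J)"
  proof (rule integral_bind[where B=B and B'=1, OF f _ K])
    show "AE z in J. emeasure (K z) (space (K z)) \<le> ennreal 1"
      using measurable_space[OF Kp]
      by (intro AE_I2) (auto simp: J_def space_prob_algebra prob_space.emeasure_space_1)
  qed (use B J.finite_measure_axioms in auto)
  also have "\<dots> = (\<integral>\<omega>. integral\<^sup>L (K (info k \<omega>)) f \<partial>run M H alg)"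
    unfolding J_def
    by (rule integral_distr[OF measurable_info])
       (rule measurable_compose[OF measurable_prob_algebraD[OF Kp] integral_measurable_subprob_algebra[OF f]])
  also have "\<dots> = (\<integral>\<omega>. \<integral>\<tau>. f (info k \<omega>, \<tau>) \<partial>episode M H (select alg k (fst (info k \<omega>)) (snd (info k \<omega>))) \<partial>run M H alg)"
    unfolding K_def
    by (intro Bochner_Integration.integral_cong refl integral_distr P f measurable_space[OF measurable_info])
  finally show ?thesis .
qed

end

section \<open>Change of measure for stopped runs\<close>

text \<open>The cutoff \<open>n\<close> makes this event depend on finitely many rounds, so that a
  finite product of likelihood ratios transports it between models.\<close>

definition ends_well :: "algorithm \<Rightarrow> nat \<Rightarrow> (nat \<Rightarrow> history \<times> real \<Rightarrow> bool) \<Rightarrow> history \<Rightarrow> bool" where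
  "ends_well alg n ok \<omega> \<longleftrightarrow> (\<exists>k<n. halts alg k \<omega> \<and> ok k (info k \<omega>))"

lemma (in interaction) measurable_ends_well:
  assumes "\<And>k. Measurable.pred (info_space H k) (ok k)"
  shows "Measurable.pred (run M H alg) (ends_well alg n ok)"
proof -
  have okm: "Measurable.pred (run M H alg) (\<lambda>\<omega>. ok k (info k \<omega>))" for k
    using measurable_compose[OF measurable_info assms] by auto
  have eq: "ends_well alg n ok = (\<lambda>\<omega>. \<exists>k\<in>{..<n}. halts alg k \<omega> \<and> ok k (info k \<omega>))"
    by (auto simp: ends_well_def fun_eq_iff)
  show ?thesis
    unfolding eq by (intro pred_intros_finite pred_intros_logic okm measurable_halts; simp)
qed

text \<open>The inequality in \<open>dominates\<close> lets \<open>lr\<close> be the density of only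
  a part of the law under \<open>M'\<close>; the mass that jumps put on other paths is dropped. The
  uniform positive bounds keep all logarithms bounded and hence integrable.\<close>

locale likelihood_ratio =
  I: interaction S A H M alg + I': interaction S A H M' alg
  for S A H M M' alg +
  fixes lr :: "trajectory \<Rightarrow> real" and lo hi :: real
  assumes lr_measurable[measurable]: "lr \<in> borel_measurable (traj_space H)"
    and lo: "0 < lo" and lr_bounds: "\<And>\<tau>. lo \<le> lr \<tau>" "\<And>\<tau>. lr \<tau> \<le> hi"
    and dominates: "\<And>\<pi> f. \<pi> \<in> policies S A H \<Longrightarrow> f \<in> borel_measurable (traj_space H) \<Longrightarrow>
      (\<integral>\<^sup>+\<tau>. ennreal (lr \<tau>) * f \<tau> \<partial>episode M H \<pi>) \<le> (\<integral>\<^sup>+\<tau>. f \<tau> \<partial>episode M' H \<pi>)"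
begin

abbreviation lik :: "nat \<Rightarrow> history \<Rightarrow> ennreal" where
  "lik k x \<equiv> (\<Prod>j<k. ennreal (lr (snd (x j))))"

lemma lr_pos: "0 < lr \<tau>"
  using lo lr_bounds(1)[of \<tau>] by linarith

lemma select_policy: "select alg k x u \<in> policies S A H"
  using I.algorithm by (simp add: is_algorithm_def measurable_rule_def)

lemma measurable_lik[measurable]: "lik k \<in> borel_measurable (PiM {0..<k} (\<lambda>_. round_space H))"
proof (intro borel_measurable_prod_ennreal)
  fix j assume "j \<in> {..<k}"
  then have "(\<lambda>x. x j) \<in> measurable (PiM {0..<k} (\<lambda>_. round_space H)) (round_space H)"
    by simp
  moreover have "(\<lambda>y. ennreal (lr (snd y))) \<in> borel_measurable (round_space H)"
    unfolding round_space_def by measurable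
  ultimately show "(\<lambda>x. ennreal (lr (snd (x j)))) \<in> borel_measurable (PiM {0..<k} (\<lambda>_. round_space H))"
    by (rule measurable_compose)
qed

text \<open>Peeling off the last round, its factor is absorbed by \<open>dominates\<close>. Seeds
  and selected policies are the same functions of the history in both models and contribute no
  factor.\<close>

lemma lik_prefix_law:
  assumes "f \<in> borel_measurable (PiM {0..<k} (\<lambda>_. round_space H))"
  shows "(\<integral>\<^sup>+x. lik k x * f x \<partial>I.prefix_law k) \<le> (\<integral>\<^sup>+x. f x \<partial>I'.prefix_law k)"
  using assms
proof (induction k arbitrary: f)
  case 0
  then show ?case
    by (simp add: I.prefix_law_def I'.prefix_law_def)
next
  case (Suc k)
  let ?N = "PiM {0..<k} (\<lambda>_. round_space H)"
  define g where "g z = (\<integral>\<^sup>+\<tau>. f ((fst z)(k := (snd z, \<tau>))) \<partial>episode M' H (select alg k (fst z) (snd z)))" for z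
  have upd: "(\<lambda>z. (fst (fst z))(k := (snd (fst z), snd z)))
      \<in> measurable (info_space H k \<Otimes>\<^sub>M traj_space H) (PiM {0..<Suc k} (\<lambda>_. round_space H))"
    unfolding info_space_def round_space_def
    by (intro measurable_fun_upd[where J="{0..<k}"]) auto
  have m: "(\<lambda>z. f ((fst (fst z))(k := (snd (fst z), snd z)))) \<in> borel_measurable (info_space H k \<Otimes>\<^sub>M traj_space H)"
    by (rule measurable_compose[OF upd Suc.prems])
  have g: "g \<in> borel_measurable (info_space H k)"
    unfolding g_def using I'.nn_integral_episode_measurable[OF m] by simp
  have G: "(\<lambda>x. \<integral>\<^sup>+u. g (x, u) \<partial>seed alg) \<in> borel_measurable ?N"
    using g by (intro I.seed.borel_measurable_nn_integral)
      (simp add: info_space_def measurable_cong_sets[OF sets_pair_measure_cong[OF refl I.sets_seed] refl])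
  have "(\<integral>\<^sup>+x. lik (Suc k) x * f x \<partial>I.prefix_law (Suc k)) =
    (\<integral>\<^sup>+x. \<integral>\<^sup>+u. \<integral>\<^sup>+\<tau>. lik (Suc k) (x(k := (u, \<tau>))) * f (x(k := (u, \<tau>)))
      \<partial>episode M H (select alg k x u) \<partial>seed alg \<partial>I.prefix_law k)"
    by (rule I.nn_integral_prefix_law_Suc) (intro borel_measurable_times_ennreal measurable_lik Suc.prems)
  also have "\<dots> \<le> (\<integral>\<^sup>+x. \<integral>\<^sup>+u. lik k x * g (x, u) \<partial>seed alg \<partial>I.prefix_law k)"
  proof (intro nn_integral_mono)
    fix x u assume x: "x \<in> space (I.prefix_law k)"
    then have "(x, u) \<in> space (info_space H k)"
      by (simp add: info_space_def I.space_prefix_law space_pair_measure)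
    from measurable_compose[OF measurable_Pair1'[OF this] m]
    have mf: "(\<lambda>\<tau>. f (x(k := (u, \<tau>)))) \<in> borel_measurable (traj_space H)" by simp
    have "lik (Suc k) (x(k := (u, \<tau>))) = lik k x * ennreal (lr \<tau>)" for \<tau>
      by simp
    then have "(\<integral>\<^sup>+\<tau>. lik (Suc k) (x(k := (u, \<tau>))) * f (x(k := (u, \<tau>))) \<partial>episode M H (select alg k x u)) =
      (\<integral>\<^sup>+\<tau>. lik k x * (ennreal (lr \<tau>) * f (x(k := (u, \<tau>)))) \<partial>episode M H (select alg k x u))"
      by (simp only: mult.assoc)
    also have "\<dots> = lik k x * (\<integral>\<^sup>+\<tau>. ennreal (lr \<tau>) * f (x(k := (u, \<tau>))) \<partial>episode M H (select alg k x u))"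
      by (intro nn_integral_cmult)
         (subst measurable_cong_sets[OF I.sets_episode refl], intro borel_measurable_times_ennreal mf, simp)
    also have "\<dots> \<le> lik k x * g (x, u)"
      unfolding g_def by (intro mult_left_mono) (simp_all add: dominates select_policy mf)
    finally show "(\<integral>\<^sup>+\<tau>. lik (Suc k) (x(k := (u, \<tau>))) * f (x(k := (u, \<tau>))) \<partial>episode M H (select alg k x u))
      \<le> lik k x * g (x, u)" .
  qed
  also have "\<dots> = (\<integral>\<^sup>+x. lik k x * (\<integral>\<^sup>+u. g (x, u) \<partial>seed alg) \<partial>I.prefix_law k)"
  proof (intro nn_integral_cong nn_integral_cmult)
    fix x assume x: "x \<in> space (I.prefix_law k)"
    then have x': "x \<in> space ?N" by (simp add: I.space_prefix_law)
    show "(\<lambda>u. g (x, u)) \<in> borel_measurable (seed alg)"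
      unfolding measurable_cong_sets[OF I.sets_seed refl]
      using measurable_compose[OF measurable_Pair1'[OF x'] g[unfolded info_space_def]] .
  qed
  also have "\<dots> \<le> (\<integral>\<^sup>+x. (\<integral>\<^sup>+u. g (x, u) \<partial>seed alg) \<partial>I'.prefix_law k)"
    by (rule Suc.IH[OF G])
  also have "\<dots> = (\<integral>\<^sup>+x. f x \<partial>I'.prefix_law (Suc k))"
    by (subst I'.nn_integral_prefix_law_Suc[OF Suc.prems]) (simp add: g_def)
  finally show ?case .
qed

lemma lik_run:
  assumes f: "f \<in> borel_measurable (info_space H k)"
  shows "(\<integral>\<^sup>+\<omega>. lik k \<omega> * f (info k \<omega>) \<partial>run M H alg) \<le> (\<integral>\<^sup>+\<omega>. f (info k \<omega>) \<partial>run M' H alg)"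
proof -
  let ?N = "PiM {0..<k} (\<lambda>_. round_space H)"
  have G: "(\<lambda>x. \<integral>\<^sup>+u. f (x, u) \<partial>seed alg) \<in> borel_measurable ?N"
    using f by (intro I.seed.borel_measurable_nn_integral)
      (simp add: info_space_def measurable_cong_sets[OF sets_pair_measure_cong[OF refl I.sets_seed] refl])
  have "(\<lambda>z. lik k (fst z)) \<in> borel_measurable (info_space H k)"
    unfolding info_space_def by (rule measurable_compose[OF measurable_fst measurable_lik])
  then have m: "(\<lambda>z. lik k (fst z) * f z) \<in> borel_measurable (info_space H k)"
    using f by (intro borel_measurable_times_ennreal)
  have "lik k \<omega> = lik k (fst (info k \<omega>))" for \<omega>
    by (simp add: info_def)
  then have "(\<integral>\<^sup>+\<omega>. lik k \<omega> * f (info k \<omega>) \<partial>run M H alg) =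
      (\<integral>\<^sup>+x. \<integral>\<^sup>+u. lik k x * f (x, u) \<partial>seed alg \<partial>I.prefix_law k)"
    using I.nn_integral_run_info[OF m] by simp
  also have "\<dots> = (\<integral>\<^sup>+x. lik k x * (\<integral>\<^sup>+u. f (x, u) \<partial>seed alg) \<partial>I.prefix_law k)"
  proof (intro nn_integral_cong nn_integral_cmult)
    fix x assume x: "x \<in> space (I.prefix_law k)"
    then have x': "x \<in> space ?N" by (simp add: I.space_prefix_law)
    show "(\<lambda>u. f (x, u)) \<in> borel_measurable (seed alg)"
      unfolding measurable_cong_sets[OF I.sets_seed refl]
      using measurable_compose[OF measurable_Pair1'[OF x'] f[unfolded info_space_def]] .
  qed
  also have "\<dots> \<le> (\<integral>\<^sup>+\<omega>. f (info k \<omega>) \<partial>run M' H alg)"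
    unfolding I'.nn_integral_run_info[OF f] by (rule lik_prefix_law[OF G])
  finally show ?thesis .
qed

text \<open>Rounds that exist only formally, after the stopping time, get the factor
  \<open>1\<close>: their information could not be charged to the number of episodes.\<close>

definition stopped_lik :: "nat \<Rightarrow> history \<Rightarrow> real" where
  "stopped_lik n \<omega> = (\<Prod>j<n. if unstopped alg (Suc j) \<omega> then lr (snd (\<omega> j)) else 1)"

lemma stopped_lik_pos: "0 < stopped_lik n \<omega>"
  unfolding stopped_lik_def by (intro prod_pos) (simp add: lr_pos)

context
  fixes n :: nat and ok :: "nat \<Rightarrow> history \<times> real \<Rightarrow> bool" and \<alpha> \<beta> :: real
  assumes ok: "\<And>k. Measurable.pred (info_space H k) (ok k)"
    and \<alpha>: "0 \<le> \<alpha>" and \<beta>: "0 \<le> \<beta>"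
begin

text \<open>When round \<open>k\<close> is the halting round, \<open>stopped_lik n\<close> equals
  \<open>lik k\<close> and the weight is a function of \<open>info k\<close>, so
  \<open>lik_run\<close> applies to each such part separately. The part where no round below
  \<open>n\<close> stops uses \<open>lik n\<close> and has weight \<beta>.\<close>

lemma stopped_lik_transport:
  "(\<integral>\<^sup>+\<omega>. ennreal (stopped_lik n \<omega> * (if ends_well alg n ok \<omega> then \<alpha> else \<beta>)) \<partial>run M H alg)
    \<le> (\<integral>\<^sup>+\<omega>. ennreal (if ends_well alg n ok \<omega> then \<alpha> else \<beta>) \<partial>run M' H alg)"
proof -
  let ?g = "\<lambda>\<omega>. ennreal (if ends_well alg n ok \<omega> then \<alpha> else \<beta>)"
  define h where "h k z = (if halts alg k (extend k z) then ennreal (if ok k z then \<alpha> else \<beta>) else 0)" for k z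
  define h' where "h' z = (if unstopped alg n (extend n z) then ennreal \<beta> else 0)" for z
  have h[measurable]: "h k \<in> borel_measurable (info_space H k)" for k
    unfolding h_def using I.measurable_halts_extend[of k k] ok[of k] by measurable
  have h'[measurable]: "h' \<in> borel_measurable (info_space H n)"
    unfolding h'_def using I.measurable_unstopped_extend[of n n] by measurable
  have hi: "h k (info k \<omega>) = (if halts alg k \<omega> then ennreal (if ok k (info k \<omega>) then \<alpha> else \<beta>) else 0)" for k \<omega>
    by (simp add: h_def halts_extend_info)
  have h'i: "h' (info n \<omega>) = (if unstopped alg n \<omega> then ennreal \<beta> else 0)" for \<omega>
    by (simp add: h'_def unstopped_extend_info)
  have split1: "ennreal (stopped_lik n \<omega> * (if ends_well alg n ok \<omega> then \<alpha> else \<beta>)) =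
      (\<Sum>k<n. lik k \<omega> * h k (info k \<omega>)) + lik n \<omega> * h' (info n \<omega>)"
    and split2: "?g \<omega> = (\<Sum>k<n. h k (info k \<omega>)) + h' (info n \<omega>)" for \<omega>
  proof -
    have "ennreal (stopped_lik n \<omega> * (if ends_well alg n ok \<omega> then \<alpha> else \<beta>)) =
      (\<Sum>k<n. lik k \<omega> * h k (info k \<omega>)) + lik n \<omega> * h' (info n \<omega>) \<and> ?g \<omega> = (\<Sum>k<n. h k (info k \<omega>)) + h' (info n \<omega>)"
    proof (cases rule: halting_cases[of alg n \<omega>])
      case unstopped
      have "stopped_lik n \<omega> = (\<Prod>j<n. lr (snd (\<omega> j)))"
        unfolding stopped_lik_def using unstopped by (intro prod.cong) auto
      moreover have "\<not> ends_well alg n ok \<omega>" using unstopped by (auto simp: ends_well_def)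
      moreover have "(\<Prod>j<n. lr (snd (\<omega> j))) \<ge> 0" using lr_pos by (intro prod_nonneg) (simp add: less_imp_le)
      ultimately show ?thesis
        using unstopped \<beta> lr_pos by (simp add: hi h'i ennreal_mult prod_ennreal less_imp_le)
    next
      case (halts k)
      have "stopped_lik n \<omega> = (\<Prod>j\<in>{..<k}. lr (snd (\<omega> j)))"
        unfolding stopped_lik_def using halts
        by (subst prod.inter_filter[symmetric]) (auto intro!: prod.cong)
      moreover have "ends_well alg n ok \<omega> \<longleftrightarrow> ok k (info k \<omega>)" using halts by (auto simp: ends_well_def)
      moreover have "(\<Prod>j<k. lr (snd (\<omega> j))) \<ge> 0" using lr_pos by (intro prod_nonneg) (simp add: less_imp_le)
      moreover have "(\<Sum>i<n. F i * h i (info i \<omega>)) = F k * h k (info k \<omega>)" for F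
        using halts by (subst sum.mono_neutral_right[of "{..<n}" "{k}"]) (auto simp: hi)
      note this[of "\<lambda>i. lik i \<omega>"] this[of "\<lambda>i. 1"]
      ultimately show ?thesis
        using halts \<alpha> \<beta> lr_pos by (simp add: hi h'i ennreal_mult prod_ennreal less_imp_le)
    qed
    then show "ennreal (stopped_lik n \<omega> * (if ends_well alg n ok \<omega> then \<alpha> else \<beta>)) =
      (\<Sum>k<n. lik k \<omega> * h k (info k \<omega>)) + lik n \<omega> * h' (info n \<omega>)"
      and "?g \<omega> = (\<Sum>k<n. h k (info k \<omega>)) + h' (info n \<omega>)" by auto
  qed
  have ml: "lik k \<in> borel_measurable (run M H alg)" for k
    using I.measurable_last_trajectory by (intro borel_measurable_prod_ennreal) simp
  have mh: "(\<lambda>\<omega>. h k (info k \<omega>)) \<in> borel_measurable (run M H alg)"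
      "(\<lambda>\<omega>. h k (info k \<omega>)) \<in> borel_measurable (run M' H alg)"
      "(\<lambda>\<omega>. h' (info n \<omega>)) \<in> borel_measurable (run M H alg)"
      "(\<lambda>\<omega>. h' (info n \<omega>)) \<in> borel_measurable (run M' H alg)" for k
    using measurable_compose[OF I.measurable_info h] measurable_compose[OF I'.measurable_info h]
      measurable_compose[OF I.measurable_info h'] measurable_compose[OF I'.measurable_info h'] by auto
  have "(\<integral>\<^sup>+\<omega>. ennreal (stopped_lik n \<omega> * (if ends_well alg n ok \<omega> then \<alpha> else \<beta>)) \<partial>run M H alg) =
    (\<Sum>k<n. \<integral>\<^sup>+\<omega>. lik k \<omega> * h k (info k \<omega>) \<partial>run M H alg) + (\<integral>\<^sup>+\<omega>. lik n \<omega> * h' (info n \<omega>) \<partial>run M H alg)"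
    unfolding split1 using ml mh
    by (subst nn_integral_add; (subst nn_integral_sum)?) 
       (auto intro!: borel_measurable_sum borel_measurable_times_ennreal)
  also have "\<dots> \<le> (\<Sum>k<n. \<integral>\<^sup>+\<omega>. h k (info k \<omega>) \<partial>run M' H alg) + (\<integral>\<^sup>+\<omega>. h' (info n \<omega>) \<partial>run M' H alg)"
    by (intro add_mono sum_mono lik_run h h')
  also have "\<dots> = (\<integral>\<^sup>+\<omega>. ?g \<omega> \<partial>run M' H alg)"
    unfolding split2 using mh
    by (subst nn_integral_add; (subst nn_integral_sum)?) (auto intro!: borel_measurable_sum)
  finally show ?thesis .
qed

end

end

context interaction
begin

abbreviation played :: "nat \<Rightarrow> history \<Rightarrow> policy" where
  "played k \<omega> \<equiv> select alg k (fst (info k \<omega>)) (snd (info k \<omega>))"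

lemma policy_valued_played: "policy_valued S A H (run M H alg) (played k)"
  using policy_valued_select[of k] measurable_compose[OF measurable_info]
  unfolding policy_valued_def by fast

lemma num_episodes_ge: "(\<Sum>j<n. if unstopped alg (Suc j) \<omega> then 1 else 0) \<le> num_episodes alg \<omega>"
  unfolding num_episodes_def
proof (rule INF_greatest)
  fix k assume k: "k \<in> {k. stops_at alg \<omega> k}"
  have "(\<Sum>j<n. if unstopped alg (Suc j) \<omega> then 1 else 0 :: ennreal) \<le> (\<Sum>j<n. if j < k then 1 else 0)"
    using k by (intro sum_mono) (auto simp: unstopped_def less_Suc_eq_le not_le[symmetric])
  also have "\<dots> = of_nat (card ({..<n} \<inter> {j. j < k}))"
    by (simp add: sum.If_cases)
  also have "\<dots> \<le> of_nat k"
    using card_mono[of "{..<k}" "{..<n} \<inter> {j. j < k}"] by (intro of_nat_mono) auto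
  finally show "(\<Sum>j<n. if unstopped alg (Suc j) \<omega> then 1 else 0) \<le> (of_nat k :: ennreal)" .
qed

text \<open>The tail-sum formula for an expectation, cut off at \<open>n\<close>: the events are
  that more than \<open>j\<close> episodes are played.\<close>

lemma expected_episodes_ge:
  "ennreal (\<Sum>j<n. run.prob {\<omega> \<in> space (run M H alg). unstopped alg (Suc j) \<omega>}) \<le> expected_episodes M H alg"
proof -
  have "ennreal (\<Sum>j<n. run.prob {\<omega> \<in> space (run M H alg). unstopped alg (Suc j) \<omega>}) =
    (\<Sum>j<n. emeasure (run M H alg) {\<omega> \<in> space (run M H alg). unstopped alg (Suc j) \<omega>})"
    by (simp only: run.emeasure_eq_measure sum_ennreal measure_nonneg)
  also have "\<dots> = (\<Sum>j<n. \<integral>\<^sup>+\<omega>. (if unstopped alg (Suc j) \<omega> then 1 else 0) \<partial>run M H alg)"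
  proof (intro sum.cong refl)
    fix j
    let ?E = "{\<omega> \<in> space (run M H alg). unstopped alg (Suc j) \<omega>}"
    have "emeasure (run M H alg) ?E = (\<integral>\<^sup>+\<omega>. indicator ?E \<omega> \<partial>run M H alg)"
      by (intro nn_integral_indicator[symmetric]) measurable
    also have "\<dots> = (\<integral>\<^sup>+\<omega>. (if unstopped alg (Suc j) \<omega> then 1 else 0) \<partial>run M H alg)"
      by (intro nn_integral_cong) (simp split: split_indicator)
    finally show "emeasure (run M H alg) ?E = (\<integral>\<^sup>+\<omega>. (if unstopped alg (Suc j) \<omega> then 1 else 0) \<partial>run M H alg)" .
  qed
  also have "\<dots> = (\<integral>\<^sup>+\<omega>. (\<Sum>j<n. if unstopped alg (Suc j) \<omega> then 1 else 0) \<partial>run M H alg)"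
    by (rule nn_integral_sum[symmetric]) measurable
  also have "\<dots> \<le> expected_episodes M H alg"
    unfolding expected_episodes_def by (intro nn_integral_mono num_episodes_ge)
  finally show ?thesis .
qed

text \<open>Markov's inequality, read off from the tail sum, whose \<open>n\<close> events all
  contain the last one.\<close>

lemma prob_unstopped_le:
  "ennreal (real n * run.prob {\<omega> \<in> space (run M H alg). unstopped alg n \<omega>}) \<le> expected_episodes M H alg"
proof -
  have "(\<Sum>j<n. run.prob {\<omega> \<in> space (run M H alg). unstopped alg n \<omega>}) \<le>
    (\<Sum>j<n. run.prob {\<omega> \<in> space (run M H alg). unstopped alg (Suc j) \<omega>})"
  proof (intro sum_mono run.finite_measure_mono)
    show "{\<omega> \<in> space (run M H alg). unstopped alg (Suc j) \<omega>} \<in> run.events" for j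
      by measurable
  qed (auto simp: unstopped_def)
  then have "ennreal (real n * run.prob {\<omega> \<in> space (run M H alg). unstopped alg n \<omega>}) \<le>
      ennreal (\<Sum>j<n. run.prob {\<omega> \<in> space (run M H alg). unstopped alg (Suc j) \<omega>})"
    by (intro ennreal_leI) simp
  also note expected_episodes_ge
  finally show ?thesis .
qed

end

context likelihood_ratio
begin

text \<open>An elementary substitute for the data-processing inequality of relative entropy.
  Integrate \<open>ln x \<le> x - 1\<close> at
  \<open>x = stopped_lik n \<omega> * G \<omega>\<close>, where \<open>G\<close> is
  \<open>exp a\<close> or \<open>exp b\<close> according to the event: the logarithm gives the terms
  in \<open>p\<close> and the log-likelihood, and transport bounds the right-hand side in terms of
  \<open>p'\<close>. The free weights \<open>a\<close> and \<open>b\<close> can be tuned later, so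
  no binary entropy appears.\<close>

lemma change_of_measure:
  fixes a b :: real and n :: nat and ok :: "nat \<Rightarrow> history \<times> real \<Rightarrow> bool"
  assumes ok: "\<And>k. Measurable.pred (info_space H k) (ok k)"
  defines "p \<equiv> I.run.prob {\<omega> \<in> space (run M H alg). ends_well alg n ok \<omega>}"
    and "p' \<equiv> I'.run.prob {\<omega> \<in> space (run M' H alg). ends_well alg n ok \<omega>}"
  shows "a * p + b * (1 - p) + 1 - (exp a * p' + exp b * (1 - p')) \<le>
    (\<Sum>j<n. \<integral>\<omega>. (if unstopped alg (Suc j) \<omega>
        then - (\<integral>\<tau>. ln (lr \<tau>) \<partial>episode M H (I.played j \<omega>)) else 0) \<partial>run M H alg)"
proof -
  define X where "X j \<omega> = (if unstopped alg (Suc j) \<omega> then ln (lr (snd (\<omega> j))) else 0)" for j \<omega>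
  define B where "B = max \<bar>ln lo\<bar> \<bar>ln hi\<bar>"
  have lnB: "\<bar>ln (lr \<tau>)\<bar> \<le> B" for \<tau>
  proof -
    have "ln lo \<le> ln (lr \<tau>)" "ln (lr \<tau>) \<le> ln hi"
      using lo lr_bounds[of \<tau>] by auto
    then show ?thesis unfolding B_def by linarith
  qed
  then have B0: "0 \<le> B" using abs_ge_zero order.trans by blast
  note e = I.measurable_ends_well[OF ok] I'.measurable_ends_well[OF ok]
  have X_meas[measurable]: "X j \<in> borel_measurable (run M H alg)" for j
    unfolding X_def using measurable_compose[OF I.measurable_last_trajectory lr_measurable] by measurable
  have X_int: "integrable (run M H alg) (X j)" for j
    using lnB B0 by (intro I.run.integrable_const_bound[where B=B]) (auto simp: X_def)
  have g_int: "(\<integral>\<omega>. (if ends_well alg n ok \<omega> then u else v) \<partial>run M H alg) = u * p + v * (1 - p)"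
    "integrable (run M H alg) (\<lambda>\<omega>. if ends_well alg n ok \<omega> then u else v)" for u v :: real
  proof -
    have 1: "(if ends_well alg n ok \<omega> then u else v) = (u - v) * indicator {\<omega> \<in> space (run M H alg). ends_well alg n ok \<omega>} \<omega> + v"
      if "\<omega> \<in> space (run M H alg)" for \<omega>
      using that by (simp split: split_indicator)
    have s: "{\<omega> \<in> space (run M H alg). ends_well alg n ok \<omega>} \<in> sets (run M H alg)" using e(1) by (simp add: pred_def)
    have "(\<integral>\<omega>. (if ends_well alg n ok \<omega> then u else v) \<partial>run M H alg) =
      (\<integral>\<omega>. (u - v) * indicator {\<omega> \<in> space (run M H alg). ends_well alg n ok \<omega>} \<omega> + v \<partial>run M H alg)"
      by (rule Bochner_Integration.integral_cong[OF refl 1])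
    also have "\<dots> = (u - v) * p + v"
      using s by (subst Bochner_Integration.integral_add) (auto simp: p_def I.run.prob_space intro!: integrable_real_indicator simp: I.run.emeasure_eq_measure)
    finally show "(\<integral>\<omega>. (if ends_well alg n ok \<omega> then u else v) \<partial>run M H alg) = u * p + v * (1 - p)"
      by (simp add: algebra_simps)
    show "integrable (run M H alg) (\<lambda>\<omega>. if ends_well alg n ok \<omega> then u else v)"
      using e(1) by (intro I.run.integrable_const_bound[where B="max \<bar>u\<bar> \<bar>v\<bar>"]) auto
  qed
  have g'_int: "(\<integral>\<^sup>+\<omega>. ennreal (if ends_well alg n ok \<omega> then u else v) \<partial>run M' H alg) = ennreal (u * p' + v * (1 - p'))"
    if "0 \<le> u" "0 \<le> v" for u v :: real
  proof -
    let ?E = "{\<omega> \<in> space (run M' H alg). ends_well alg n ok \<omega>}"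
    have s: "?E \<in> sets (run M' H alg)" using e(2) by (simp add: pred_def)
    have "(\<integral>\<^sup>+\<omega>. ennreal (if ends_well alg n ok \<omega> then u else v) \<partial>run M' H alg) =
      (\<integral>\<^sup>+\<omega>. ennreal u * indicator ?E \<omega> + ennreal v * indicator (space (run M' H alg) - ?E) \<omega> \<partial>run M' H alg)"
      by (intro nn_integral_cong) (simp split: split_indicator)
    also have "\<dots> = ennreal u * emeasure (run M' H alg) ?E + ennreal v * emeasure (run M' H alg) (space (run M' H alg) - ?E)"
      using s by (subst nn_integral_add) (auto simp: nn_integral_cmult_indicator)
    also have "\<dots> = ennreal (u * p' + v * (1 - p'))"
      using that s by (simp add: I'.run.emeasure_eq_measure I'.run.prob_compl p'_def ennreal_mult[symmetric]
          ennreal_plus[symmetric] del: ennreal_plus)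
    finally show ?thesis .
  qed
  define G where "G \<omega> = (if ends_well alg n ok \<omega> then exp a else exp b)" for \<omega>
  have sl: "stopped_lik n \<omega> = exp (\<Sum>j<n. X j \<omega>)" for \<omega>
    unfolding stopped_lik_def exp_sum[OF finite_lessThan] X_def
    by (intro prod.cong) (auto simp: lr_pos)
  have sl_le: "stopped_lik n \<omega> \<le> exp (real n * B)" for \<omega>
  proof -
    have "(\<Sum>j<n. X j \<omega>) \<le> (\<Sum>j<n. B)"
      using lnB B0 by (intro sum_mono) (auto simp: X_def abs_le_iff)
    then show ?thesis by (simp add: sl)
  qed
  have LG_meas: "(\<lambda>\<omega>. stopped_lik n \<omega> * G \<omega>) \<in> borel_measurable (run M H alg)"
    unfolding sl G_def using e(1) by measurable
  have LG_b: "\<bar>stopped_lik n \<omega> * G \<omega>\<bar> \<le> exp (real n * B) * max (exp a) (exp b)" for \<omega>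
    using stopped_lik_pos[of n \<omega>] sl_le[of \<omega>]
    by (auto simp: G_def abs_mult intro!: mult_mono)
  have LG_int: "integrable (run M H alg) (\<lambda>\<omega>. stopped_lik n \<omega> * G \<omega>)"
    using LG_b LG_meas by (intro I.run.integrable_const_bound) (auto intro!: AE_I2)
  have "ennreal (\<integral>\<omega>. stopped_lik n \<omega> * G \<omega> \<partial>run M H alg) = (\<integral>\<^sup>+\<omega>. ennreal (stopped_lik n \<omega> * G \<omega>) \<partial>run M H alg)"
    using stopped_lik_pos[of n] by (intro nn_integral_eq_integral[symmetric] LG_int) (auto simp: G_def less_imp_le)
  also have "\<dots> \<le> (\<integral>\<^sup>+\<omega>. ennreal (G \<omega>) \<partial>run M' H alg)"
    unfolding G_def by (rule stopped_lik_transport[OF ok]) auto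
  also have "\<dots> = ennreal (exp a * p' + exp b * (1 - p'))"
    unfolding G_def by (rule g'_int) auto
  finally have LG: "(\<integral>\<omega>. stopped_lik n \<omega> * G \<omega> \<partial>run M H alg) \<le> exp a * p' + exp b * (1 - p')"
    by (rule ennreal_le_iff[THEN iffD1, rotated]) (auto simp: p'_def)
  have "a * p + b * (1 - p) + (\<Sum>j<n. \<integral>\<omega>. X j \<omega> \<partial>run M H alg) =
    (\<integral>\<omega>. (if ends_well alg n ok \<omega> then a else b) + (\<Sum>j<n. X j \<omega>) \<partial>run M H alg)"
    using X_int g_int(2)[of a b] by (simp add: g_int(1))
  also have "\<dots> \<le> (\<integral>\<omega>. stopped_lik n \<omega> * G \<omega> - 1 \<partial>run M H alg)"
  proof (rule integral_mono)
    fix \<omega>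
    have "ln (stopped_lik n \<omega> * G \<omega>) \<le> stopped_lik n \<omega> * G \<omega> - 1"
      by (rule ln_le_minus_one) (simp add: stopped_lik_pos G_def)
    moreover have "ln (stopped_lik n \<omega> * G \<omega>) = (if ends_well alg n ok \<omega> then a else b) + (\<Sum>j<n. X j \<omega>)"
      by (simp add: sl G_def ln_mult)
    ultimately show "(if ends_well alg n ok \<omega> then a else b) + (\<Sum>j<n. X j \<omega>) \<le> stopped_lik n \<omega> * G \<omega> - 1"
      by simp
  qed (use X_int g_int(2)[of a b] LG_int in auto)
  also have "\<dots> \<le> exp a * p' + exp b * (1 - p') - 1"
    using LG LG_int by (simp add: I.run.prob_space)
  finally have main: "a * p + b * (1 - p) + 1 - (exp a * p' + exp b * (1 - p')) \<le> (\<Sum>j<n. - (\<integral>\<omega>. X j \<omega> \<partial>run M H alg))"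
    by (simp add: sum_negf)
  \<comment> \<open>Whether round \<open>j\<close> plays is known from \<open>info j\<close>, so the
    observed log-ratio may be replaced by its mean over an episode of the played policy.\<close>
  have X: "(\<integral>\<omega>. X j \<omega> \<partial>run M H alg) = (\<integral>\<omega>. (if unstopped alg (Suc j) \<omega>
        then (\<integral>\<tau>. ln (lr \<tau>) \<partial>episode M H (I.played j \<omega>)) else 0) \<partial>run M H alg)" for j
  proof -
    define f where "f y = (if unstopped alg (Suc j) (extend j (fst y)) then ln (lr (snd y)) else 0)" for y
    have f: "f \<in> borel_measurable (info_space H j \<Otimes>\<^sub>M traj_space H)"
      unfolding f_def using measurable_compose[OF measurable_fst I.measurable_unstopped_extend[of "Suc j" j]]
      by measurable
    have "(\<integral>\<omega>. X j \<omega> \<partial>run M H alg) = (\<integral>\<omega>. f (info j \<omega>, snd (\<omega> j)) \<partial>run M H alg)"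
      by (simp add: f_def X_def unstopped_extend_info cong: if_cong)
    also have "\<dots> = (\<integral>\<omega>. \<integral>\<tau>. f (info j \<omega>, \<tau>) \<partial>episode M H (I.played j \<omega>) \<partial>run M H alg)"
      using lnB B0 by (intro I.integral_run_select[OF f, where B=B]) (auto simp: f_def)
    also have "\<dots> = (\<integral>\<omega>. (if unstopped alg (Suc j) \<omega>
        then (\<integral>\<tau>. ln (lr \<tau>) \<partial>episode M H (I.played j \<omega>)) else 0) \<partial>run M H alg)"
      by (intro Bochner_Integration.integral_cong) (auto simp: f_def unstopped_extend_info)
    finally show ?thesis .
  qed
  have "- (\<integral>\<omega>. X j \<omega> \<partial>run M H alg) = (\<integral>\<omega>. (if unstopped alg (Suc j) \<omega>
        then - (\<integral>\<tau>. ln (lr \<tau>) \<partial>episode M H (I.played j \<omega>)) else 0) \<partial>run M H alg)" for j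
  proof -
    let ?L = "\<lambda>\<omega>. (\<integral>\<tau>. ln (lr \<tau>) \<partial>episode M H (I.played j \<omega>))"
    have "(\<integral>\<omega>. (if unstopped alg (Suc j) \<omega> then - ?L \<omega> else 0) \<partial>run M H alg) =
      (\<integral>\<omega>. - (if unstopped alg (Suc j) \<omega> then ?L \<omega> else 0) \<partial>run M H alg)"
      by (intro Bochner_Integration.integral_cong) auto
    then show ?thesis
      using X[of j] by simp
  qed
  with main show ?thesis by simp
qed

end

section \<open>Averaging policies\<close>

text \<open>
  Occupancies of policies form a convex set: conditioning the averaged occupancy on the state
  yields a policy that realises it.
\<close>

lemma averaged_policy:
  fixes N :: "'a measure" and w :: "nat \<Rightarrow> 'a \<Rightarrow> real" and \<sigma> :: "nat \<Rightarrow> 'a \<Rightarrow> policy"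
  assumes M: "is_mdp S A H M" and A: "0 < A" and fin: "finite_measure N"
    and \<sigma>: "\<And>j. policy_valued S A H N (\<sigma> j)"
    and w[measurable]: "\<And>j. w j \<in> borel_measurable N" and w01: "\<And>j \<omega>. 0 \<le> w j \<omega>" "\<And>j \<omega>. w j \<omega> \<le> 1"
  shows "\<exists>\<pi>\<in>policies S A H. \<forall>h\<in>{1..H}. \<forall>s<S. \<forall>a<A.
    (\<Sum>j<n. \<integral>\<omega>. w j \<omega> * visit M H (\<sigma> j \<omega>) h s a \<partial>N) = (\<Sum>j<n. \<integral>\<omega>. w j \<omega> \<partial>N) * visit M H \<pi> h s a"
proof -
  interpret finite_measure N by (rule fin)
  define Q where "Q j i s \<omega> = pmf (state_law M (\<sigma> j \<omega>) 1 i (init M)) s" for j i s \<omega>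
  \<comment> \<open>\<open>R\<close> and \<open>W\<close> are the weighted occupancies of states and
    of pairs at step \<open>Suc i\<close>. The flow equations \<open>Wsum\<close> and
    \<open>Rstep\<close> are linear in the occupancies and involve the same kernel for all policies,
    so they survive averaging.\<close>
  define R where "R i s = (\<Sum>j<n. \<integral>\<omega>. w j \<omega> * Q j i s \<omega> \<partial>N)" for i s
  define W where "W i s a = (\<Sum>j<n. \<integral>\<omega>. w j \<omega> * (Q j i s \<omega> * pmf (\<sigma> j \<omega> (Suc i) s) a) \<partial>N)" for i s a
  define m where "m = (\<Sum>j<n. \<integral>\<omega>. w j \<omega> \<partial>N)"
  have pol: "\<sigma> j \<omega> \<in> policies S A H" for j \<omega> using \<sigma> by (simp add: policy_valued_def)
  have set\<sigma>: "set_pmf (\<sigma> j \<omega> h s) \<subseteq> {..<A}" if "h \<in> {1..H}" "s < S" for j \<omega> h s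
    using pol[of j \<omega>] that by (simp add: policies_def)
  have mpol: "(\<lambda>\<omega>. pmf (\<sigma> j \<omega> h s) a) \<in> borel_measurable N" if "h \<in> {1..H}" "s < S" "a < A" for j h s a
    using \<sigma>[of j] that by (simp add: policy_valued_def)
  have setQ: "set_pmf (state_law M \<pi> 1 i (init M)) \<subseteq> {..<S}" if "i < H" "\<pi> \<in> policies S A H" for \<pi> i
    using M that by (intro set_state_law[OF M]) (auto simp: is_mdp_def)
  have pmf_step: "pmf (state_law M \<pi> 1 (Suc i) (init M)) t = (\<Sum>s<S. \<Sum>a<A.
      pmf (state_law M \<pi> 1 i (init M)) s * pmf (\<pi> (Suc i) s) a * pmf (trans M (Suc i) s a) t)"
    if "Suc i < H" "\<pi> \<in> policies S A H" for \<pi> i t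
    using that setQ[of i \<pi>] by (simp, subst pmf_next_law[where S=S and A=A]) (auto simp: policies_def)
  have Qm: "Q j i s \<in> borel_measurable N" if "i < H" for j i s
    using that
  proof (induction i arbitrary: s)
    case (Suc i)
    have "Q j (Suc i) s = (\<lambda>\<omega>. \<Sum>t<S. \<Sum>a<A. Q j i t \<omega> * pmf (\<sigma> j \<omega> (Suc i) t) a * pmf (trans M (Suc i) t a) s)"
      unfolding Q_def using Suc.prems pol by (auto simp only: pmf_step)
    then show ?case
      using Suc by (simp only:) (intro borel_measurable_sum borel_measurable_times borel_measurable_const mpol; simp)
  qed (simp add: Q_def[abs_def])
  have Q01: "0 \<le> Q j i s \<omega>" "Q j i s \<omega> \<le> 1" for j i s \<omega> by (auto simp: Q_def pmf_le_1)
  have int: "integrable N (\<lambda>\<omega>. w j \<omega> * g \<omega>)" if "g \<in> borel_measurable N" "\<And>\<omega>. 0 \<le> g \<omega>" "\<And>\<omega>. g \<omega> \<le> 1" for j g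
    using that w01 by (intro integrable_const_bound[where B=1]) (auto intro!: mult_le_one simp: abs_mult)
  have intW: "integrable N (\<lambda>\<omega>. w j \<omega> * (Q j i s \<omega> * pmf (\<sigma> j \<omega> (Suc i) s) a))"
    if "i < H" "s < S" "a < A" for j i s a
    using that Qm[of i] Q01 mpol[of "Suc i" s a] by (intro int) (auto intro!: mult_le_one simp: pmf_le_1)
  have R0: "R 0 s = m * pmf (init M) s" for s
    by (simp add: R_def m_def Q_def sum_distrib_right)
  have W0: "0 \<le> W i s a" for i s a
    unfolding W_def using w01 Q01 by (intro sum_nonneg Bochner_Integration.integral_nonneg) auto
  have Wsum: "(\<Sum>a<A. W i s a) = R i s" if "i < H" "s < S" for i s
  proof -
    have "(\<Sum>a<A. W i s a) = (\<Sum>j<n. \<Sum>a<A. \<integral>\<omega>. w j \<omega> * (Q j i s \<omega> * pmf (\<sigma> j \<omega> (Suc i) s) a) \<partial>N)"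
      unfolding W_def by (rule sum.swap)
    also have "\<dots> = (\<Sum>j<n. \<integral>\<omega>. (\<Sum>a<A. w j \<omega> * (Q j i s \<omega> * pmf (\<sigma> j \<omega> (Suc i) s) a)) \<partial>N)"
      using intW that by (intro sum.cong refl Bochner_Integration.integral_sum[symmetric]) auto
    also have "\<dots> = R i s"
      unfolding R_def
    proof (intro sum.cong refl Bochner_Integration.integral_cong)
      fix j \<omega>
      have "(\<Sum>a<A. pmf (\<sigma> j \<omega> (Suc i) s) a) = 1"
        using that set\<sigma>[of "Suc i" s] by (intro sum_pmf_eq_1) auto
      then show "(\<Sum>a<A. w j \<omega> * (Q j i s \<omega> * pmf (\<sigma> j \<omega> (Suc i) s) a)) = w j \<omega> * Q j i s \<omega>"
        by (simp add: sum_distrib_left[symmetric])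
    qed
    finally show ?thesis .
  qed
  have Rstep: "R (Suc i) t = (\<Sum>s<S. \<Sum>a<A. W i s a * pmf (trans M (Suc i) s a) t)" if "Suc i < H" for i t
  proof -
    have "R (Suc i) t = (\<Sum>j<n. \<integral>\<omega>. (\<Sum>s<S. \<Sum>a<A. w j \<omega> * (Q j i s \<omega> * pmf (\<sigma> j \<omega> (Suc i) s) a) * pmf (trans M (Suc i) s a) t) \<partial>N)"
      unfolding R_def
      by (intro sum.cong refl Bochner_Integration.integral_cong)
         (simp only: Q_def pmf_step[OF that pol] sum_distrib_left mult.assoc)
    also have "\<dots> = (\<Sum>j<n. \<Sum>s<S. \<Sum>a<A. (\<integral>\<omega>. w j \<omega> * (Q j i s \<omega> * pmf (\<sigma> j \<omega> (Suc i) s) a) \<partial>N) * pmf (trans M (Suc i) s a) t)"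
    proof (intro sum.cong refl)
      fix j
      let ?F = "\<lambda>s a \<omega>. w j \<omega> * (Q j i s \<omega> * pmf (\<sigma> j \<omega> (Suc i) s) a)"
      have F: "integrable N (\<lambda>\<omega>. ?F s a \<omega> * pmf (trans M (Suc i) s a) t)" if "s < S" "a < A" for s a
        using intW \<open>Suc i < H\<close> that by (intro integrable_mult_left) auto
      have "(\<integral>\<omega>. (\<Sum>s<S. \<Sum>a<A. ?F s a \<omega> * pmf (trans M (Suc i) s a) t) \<partial>N) =
        (\<Sum>s<S. \<integral>\<omega>. (\<Sum>a<A. ?F s a \<omega> * pmf (trans M (Suc i) s a) t) \<partial>N)"
        using F by (intro Bochner_Integration.integral_sum Bochner_Integration.integrable_sum) auto
      also have "\<dots> = (\<Sum>s<S. \<Sum>a<A. (\<integral>\<omega>. ?F s a \<omega> * pmf (trans M (Suc i) s a) t \<partial>N))"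
        using F by (intro sum.cong refl Bochner_Integration.integral_sum) auto
      finally show "(\<integral>\<omega>. (\<Sum>s<S. \<Sum>a<A. ?F s a \<omega> * pmf (trans M (Suc i) s a) t) \<partial>N) =
        (\<Sum>s<S. \<Sum>a<A. (\<integral>\<omega>. ?F s a \<omega> \<partial>N) * pmf (trans M (Suc i) s a) t)"
        by simp
    qed
    also have "\<dots> = (\<Sum>s<S. \<Sum>j<n. \<Sum>a<A. (\<integral>\<omega>. w j \<omega> * (Q j i s \<omega> * pmf (\<sigma> j \<omega> (Suc i) s) a) \<partial>N) * pmf (trans M (Suc i) s a) t)"
      by (rule sum.swap)
    also have "\<dots> = (\<Sum>s<S. \<Sum>a<A. W i s a * pmf (trans M (Suc i) s a) t)"
      unfolding W_def sum_distrib_right by (rule sum.cong[OF refl], rule sum.swap)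
    finally show ?thesis .
  qed
  have Rnn: "0 \<le> R i s" if "i < H" "s < S" for i s
    unfolding Wsum[OF that, symmetric] by (intro sum_nonneg W0)
  \<comment> \<open>The conditional action law given the state; in states of zero average occupancy
    it is arbitrary, and action \<open>0\<close> is chosen.\<close>
  define \<pi> :: policy where
    "\<pi> h s = (if 0 < R (h - 1) s then embed_pmf (\<lambda>a. if a < A then W (h - 1) s a / R (h - 1) s else 0) else return_pmf 0)" for h s
  have pmf\<pi>: "pmf (\<pi> (Suc i) s) a = (if a < A then W i s a / R i s else 0)" if "i < H" "s < S" "0 < R i s" for i s a
  proof -
    have "(\<integral>\<^sup>+a. ennreal (if a < A then W i s a / R i s else 0) \<partial>count_space UNIV) = (\<Sum>a<A. ennreal (W i s a / R i s))"
      by (subst nn_integral_count_space'[of "{..<A}"]) auto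
    also have "\<dots> = ennreal (\<Sum>a<A. W i s a / R i s)"
      using W0 that by (intro sum_ennreal) auto
    also have "(\<Sum>a<A. W i s a / R i s) = 1"
      using that by (simp add: sum_divide_distrib[symmetric] Wsum)
    finally have "(\<integral>\<^sup>+a. ennreal (if a < A then W i s a / R i s else 0) \<partial>count_space UNIV) = 1"
      by simp
    moreover have "\<pi> (Suc i) s = embed_pmf (\<lambda>a. if a < A then W i s a / R i s else 0)"
      using that by (simp only: \<pi>_def diff_Suc_1 if_True)
    ultimately show ?thesis
      using that W0 by (simp only:) (rule pmf_embed_pmf; simp)
  qed
  have \<pi>: "\<pi> \<in> policies S A H"
    unfolding policies_def
  proof (intro CollectI ballI allI impI subsetI)
    fix h s a assume *: "h \<in> {1..H}" "s < S" "a \<in> set_pmf (\<pi> h s)"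
    show "a \<in> {..<A}"
    proof (cases "0 < R (h - 1) s")
      case True
      with * have "pmf (\<pi> (Suc (h - 1)) s) a = (if a < A then W (h - 1) s a / R (h - 1) s else 0)"
        by (intro pmf\<pi>) auto
      with * show ?thesis by (auto simp: set_pmf_eq split: if_splits)
    next
      case False
      with * A show ?thesis by (simp add: \<pi>_def)
    qed
  qed
  have RW: "R i s * pmf (\<pi> (Suc i) s) a = W i s a" if "i < H" "s < S" "a < A" for i s a
  proof (cases "0 < R i s")
    case True
    with that show ?thesis by (simp add: pmf\<pi>)
  next
    case False
    with Rnn[of i s] that have "R i s = 0" by simp
    moreover have "W i s a \<le> (\<Sum>a<A. W i s a)"
      using that W0 by (intro member_le_sum) auto
    ultimately have "W i s a = 0"
      using Wsum[of i s] that W0[of i s a] by simp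
    with \<open>R i s = 0\<close> show ?thesis by simp
  qed
  \<comment> \<open>The policy satisfies the same flow equations from the same start, up to the
    total weight \<open>m\<close>.\<close>
  have Req: "R i s = m * pmf (state_law M \<pi> 1 i (init M)) s" if "i < H" for i s
    using that
  proof (induction i arbitrary: s)
    case (Suc i)
    have "R (Suc i) s = (\<Sum>t<S. \<Sum>a<A. R i t * pmf (\<pi> (Suc i) t) a * pmf (trans M (Suc i) t a) s)"
      unfolding Rstep[OF Suc.prems] using Suc.prems RW by (intro sum.cong refl) simp
    also have "\<dots> = m * pmf (state_law M \<pi> 1 (Suc i) (init M)) s"
      unfolding pmf_step[OF Suc.prems \<pi>] sum_distrib_left
      using Suc by (intro sum.cong refl) simp
    finally show ?case .
  qed (simp add: R0)
  have "(\<Sum>j<n. \<integral>\<omega>. w j \<omega> * visit M H (\<sigma> j \<omega>) h s a \<partial>N) = m * visit M H \<pi> h s a"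
    if "h \<in> {1..H}" "s < S" "a < A" for h s a
  proof -
    have h: "Suc (h - 1) = h" "h - 1 < H" using that by auto
    have "(\<Sum>j<n. \<integral>\<omega>. w j \<omega> * visit M H (\<sigma> j \<omega>) h s a \<partial>N) = W (h - 1) s a"
      unfolding W_def Q_def visit_eq[OF that(1)] h ..
    also have "\<dots> = m * visit M H \<pi> h s a"
      unfolding visit_eq[OF that(1)] RW[OF h(2) that(2,3), symmetric] Req[OF h(2)] h by simp
    finally show ?thesis .
  qed
  with \<pi> show ?thesis unfolding m_def by blast
qed

lemma measurable_visit:
  assumes M: "is_mdp S A H M" and \<sigma>: "policy_valued S A H N \<sigma>" and h: "h \<in> {1..H}"
  shows "(\<lambda>\<omega>. visit M H (\<sigma> \<omega>) h s a) \<in> borel_measurable N"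
proof -
  have "(\<lambda>\<omega>. measure_pmf (paths M (\<sigma> \<omega>) H 1 (init M))) \<in> measurable N (prob_algebra (count_space UNIV))"
    using M by (intro measurable_pmf_kernel measurable_pmf_paths[OF \<sigma> M]) (auto simp: is_mdp_def)
  from measurable_compose[OF this measurable_measure_prob_algebra] show ?thesis
    unfolding visit_def by simp
qed

section \<open>Bernoulli rewards\<close>

definition bernoulli_reward :: "real \<Rightarrow> real measure" where
  "bernoulli_reward p = distr (measure_pmf (bernoulli_pmf p)) borel of_bool"

lemma sets_bernoulli_reward[simp, measurable_cong]: "sets (bernoulli_reward p) = sets borel"
  by (simp add: bernoulli_reward_def)

lemma prob_space_bernoulli_reward: "prob_space (bernoulli_reward p)"
  unfolding bernoulli_reward_def by (rule measure_pmf.prob_space_distr) simp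

lemma nn_integral_bernoulli_reward:
  assumes "f \<in> borel_measurable borel" "0 \<le> p" "p \<le> 1"
  shows "(\<integral>\<^sup>+r. f r \<partial>bernoulli_reward p) = f 1 * ennreal p + f 0 * ennreal (1 - p)"
  using assms by (simp add: bernoulli_reward_def nn_integral_distr)

lemma integral_bernoulli_reward:
  fixes f :: "real \<Rightarrow> real"
  assumes "f \<in> borel_measurable borel" "0 \<le> p" "p \<le> 1"
  shows "(\<integral>r. f r \<partial>bernoulli_reward p) = p * f 1 + (1 - p) * f 0"
  using assms by (simp add: bernoulli_reward_def integral_distr mult.commute)

lemma AE_bernoulli_reward: "AE r in bernoulli_reward p. 0 \<le> r \<and> r \<le> 1"
  unfolding bernoulli_reward_def by (subst AE_distr_iff) auto

text \<open>All reals other than \<open>1\<close> share the value at \<open>0\<close>; only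
  \<open>0\<close> and \<open>1\<close> carry mass.\<close>

definition bernoulli_ratio :: "real \<Rightarrow> real \<Rightarrow> real \<Rightarrow> real" where
  "bernoulli_ratio p q r = (if r = 1 then q / p else (1 - q) / (1 - p))"

lemma bernoulli_ratio_measurable[measurable]: "bernoulli_ratio p q \<in> borel_measurable borel"
  unfolding bernoulli_ratio_def by measurable

lemma bernoulli_reward_density:
  assumes "0 < p" "p < 1" "0 \<le> q" "q \<le> 1"
  shows "bernoulli_reward q = density (bernoulli_reward p) (\<lambda>r. ennreal (bernoulli_ratio p q r))"
proof (rule measure_eqI)
  fix X assume "X \<in> sets (bernoulli_reward q)"
  then have X[measurable]: "X \<in> sets borel" by simp
  have "emeasure (bernoulli_reward q) X = (\<integral>\<^sup>+r. indicator X r \<partial>bernoulli_reward q)"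
    by (intro nn_integral_indicator[symmetric]) simp
  also have "\<dots> = indicator X 1 * ennreal q + indicator X 0 * ennreal (1 - q)"
    using assms by (subst nn_integral_bernoulli_reward) auto
  also have "\<dots> = (\<integral>\<^sup>+r. ennreal (bernoulli_ratio p q r) * indicator X r \<partial>bernoulli_reward p)"
    using assms by (subst nn_integral_bernoulli_reward)
      (auto simp: bernoulli_ratio_def ennreal_mult[symmetric] split: split_indicator)
  also have "\<dots> = emeasure (density (bernoulli_reward p) (\<lambda>r. ennreal (bernoulli_ratio p q r))) X"
    by (subst emeasure_density) auto
  finally show "emeasure (bernoulli_reward q) X =
    emeasure (density (bernoulli_reward p) (\<lambda>r. ennreal (bernoulli_ratio p q r))) X" .
qed simp

text \<open>On rectangles the integral factorises and the density meets only its own coordinate;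
  rectangles determine the product measure. It is used for the single reward whose law the
  alternative changes.\<close>

lemma PiM_density_component:
  fixes N :: "'i \<Rightarrow> 'a measure"
  assumes I: "finite I" "i \<in> I" and N: "\<And>j. prob_space (N j)"
    and f: "f \<in> borel_measurable (N i)" and d: "prob_space (density (N i) f)"
  shows "PiM I (N(i := density (N i) f)) = density (PiM I N) (\<lambda>x. f (x i))"
proof -
  let ?N = "N(i := density (N i) f)"
  interpret Nj: prob_space "N j" for j by (rule N)
  interpret Nj': prob_space "?N j" for j using d by (cases "j = i") (simp_all add: N)
  interpret N: product_prob_space N I by unfold_locales
  interpret N': product_prob_space ?N I by unfold_locales
  have fi: "(\<lambda>x. f (x i)) \<in> borel_measurable (PiM I N)"
    using f I by measurable
  show ?thesis
  proof (rule N'.PiM_eqI[OF I(1), symmetric])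
    have "sets (PiM I N) = sets (PiM I ?N)" by (intro sets_PiM_cong) auto
    then show "sets (density (PiM I N) (\<lambda>x. f (x i))) = sets (PiM I ?N)" by simp
    fix X assume X: "\<And>j. j \<in> I \<Longrightarrow> X j \<in> sets (?N j)"
    have X': "X j \<in> sets (N j)" if "j \<in> I" for j using X[OF that] by (cases "j = i") auto
    let ?g = "\<lambda>j x. if j = i then f x * indicator (X j) x else indicator (X j) x"
    have "emeasure (density (PiM I N) (\<lambda>x. f (x i))) (Pi\<^sub>E I X) = (\<integral>\<^sup>+x. f (x i) * indicator (Pi\<^sub>E I X) x \<partial>PiM I N)"
      using X' I fi by (intro emeasure_density) (auto intro!: sets_PiM_I_finite)
    also have "\<dots> = (\<integral>\<^sup>+x. (\<Prod>j\<in>I. ?g j (x j)) \<partial>PiM I N)"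
    proof (rule nn_integral_cong)
      fix x assume x: "x \<in> space (PiM I N)"
      have "indicator (Pi\<^sub>E I X) x = (\<Prod>j\<in>I. indicator (X j) (x j) :: ennreal)"
        using x I by (auto simp: space_PiM PiE_iff indicator_def prod_zero_iff)
      also have "f (x i) * \<dots> = (\<Prod>j\<in>I. ?g j (x j))"
        using I by (simp add: prod.remove[of I i] mult.assoc)
      finally show "f (x i) * indicator (Pi\<^sub>E I X) x = (\<Prod>j\<in>I. ?g j (x j))" .
    qed
    also have "\<dots> = (\<Prod>j\<in>I. \<integral>\<^sup>+x. ?g j x \<partial>N j)"
    proof (intro N.product_nn_integral_prod I)
      fix j assume "j \<in> I"
      then show "?g j \<in> borel_measurable (N j)"
        using X' f by (cases "j = i") auto
    qed
    also have "\<dots> = (\<Prod>j\<in>I. emeasure (?N j) (X j))"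
      using X' f by (intro prod.cong) (auto simp: emeasure_density)
    finally show "emeasure (density (PiM I N) (\<lambda>x. f (x i))) (Pi\<^sub>E I X) = (\<Prod>j\<in>I. emeasure (?N j) (X j))" .
  qed
qed

section \<open>Alternative models and their likelihood ratios\<close>

definition bernoulli_mdp ::
    "nat pmf \<Rightarrow> (nat \<Rightarrow> nat \<Rightarrow> nat \<Rightarrow> nat pmf) \<Rightarrow> (nat \<Rightarrow> nat \<Rightarrow> nat \<Rightarrow> real) \<Rightarrow> mdp" where
  "bernoulli_mdp \<mu> T m = \<lparr>init = \<mu>, trans = T, reward = \<lambda>h s a. bernoulli_reward (m h s a)\<rparr>"

lemma bernoulli_mdp_simps[simp]:
  "init (bernoulli_mdp \<mu> T m) = \<mu>" "trans (bernoulli_mdp \<mu> T m) = T"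
  "reward (bernoulli_mdp \<mu> T m) h s a = bernoulli_reward (m h s a)"
  by (simp_all add: bernoulli_mdp_def)

lemma valid_rewards_bernoulli_mdp: "valid_rewards (bernoulli_mdp \<mu> T m)"
  unfolding valid_rewards_def bernoulli_mdp_simps
  using sets_bernoulli_reward prob_space_bernoulli_reward AE_bernoulli_reward by blast

lemma mean_reward_bernoulli_mdp:
  assumes "0 \<le> m h s a" "m h s a \<le> 1"
  shows "mean_reward (bernoulli_mdp \<mu> T m) h (s, a) = m h s a"
  using assms by (simp add: mean_reward_def integral_bernoulli_reward)

lemma is_mdp_bernoulli_mdp:
  "is_mdp S A H (bernoulli_mdp \<mu> T m) \<longleftrightarrow> set_pmf \<mu> \<subseteq> {..<S} \<and>
     (\<forall>h\<in>{1..<H}. \<forall>s<S. \<forall>a<A. set_pmf (T h s a) \<subseteq> {..<S})"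
  using valid_rewards_bernoulli_mdp[of \<mu> T m] by (auto simp: is_mdp_def valid_rewards_def)

definition mix :: "real \<Rightarrow> nat \<Rightarrow> nat pmf \<Rightarrow> nat pmf" where
  "mix \<eta> s D = bind_pmf (bernoulli_pmf \<eta>) (\<lambda>b. if b then return_pmf s else D)"

lemma pmf_mix:
  assumes "0 \<le> \<eta>" "\<eta> \<le> 1"
  shows "pmf (mix \<eta> s D) t = \<eta> * indicator {s} t + (1 - \<eta>) * pmf D t"
  using assms by (simp add: mix_def pmf_bind indicator_def mult.commute)

lemma set_mix: "set_pmf (mix \<eta> s D) \<subseteq> insert s (set_pmf D)"
  by (auto simp: mix_def split: if_splits)

text \<open>A path of length \<open>n\<close> involves \<open>n\<close> state draws, the initial one
  included, and each loses at most a factor \<open>c\<close>; the action factors agree.\<close>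

lemma pmf_paths_ge:
  assumes c: "0 \<le> c" and T: "\<And>h s a t. c * pmf (trans M h s a) t \<le> pmf (trans M' h s a) t"
    and \<mu>: "\<And>t. c * pmf \<mu> t \<le> pmf \<mu>' t"
  shows "c ^ n * pmf (paths M \<pi> n h \<mu>) p \<le> pmf (paths M' \<pi> n h \<mu>') p"
  using \<mu>
proof (induction n arbitrary: h \<mu> \<mu>' p)
  case (Suc n)
  show ?case
  proof (cases p)
    case (Cons z q)
    obtain s a where z: "z = (s, a)" by fastforce
    have "c ^ Suc n * pmf (paths M \<pi> (Suc n) h \<mu>) p =
      (c * pmf \<mu> s) * pmf (\<pi> h s) a * (c ^ n * pmf (paths M \<pi> n (Suc h) (trans M h s a)) q)"
      unfolding Cons z pmf_paths_Cons by simp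
    also have "\<dots> \<le> pmf \<mu>' s * pmf (\<pi> h s) a * pmf (paths M' \<pi> n (Suc h) (trans M' h s a)) q"
      using c by (intro mult_mono Suc.IH Suc.prems T order.refl) auto
    finally show ?thesis unfolding Cons z pmf_paths_Cons .
  qed (simp add: pmf_paths_Nil del: paths.simps)
qed simp

text \<open>
  The jumps make every policy visit the state of \<open>z\<close> at step \<open>g\<close>.
\<close>

definition perturbed ::
    "real \<Rightarrow> nat \<Rightarrow> nat \<times> nat \<Rightarrow> real \<Rightarrow> nat pmf \<Rightarrow> (nat \<Rightarrow> nat \<Rightarrow> nat \<Rightarrow> nat pmf)
     \<Rightarrow> (nat \<Rightarrow> nat \<Rightarrow> nat \<Rightarrow> real) \<Rightarrow> mdp" where
  "perturbed \<eta> g z q \<mu> T m = bernoulli_mdp (mix \<eta> (fst z) \<mu>) (\<lambda>h s a. mix \<eta> (fst z) (T h s a))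
     (\<lambda>h s a. if h = g \<and> (s, a) = z then q else m h s a)"

definition reward_ratio :: "nat \<Rightarrow> nat \<times> nat \<Rightarrow> real \<Rightarrow> real \<Rightarrow> trajectory \<Rightarrow> real" where
  "reward_ratio g z p q \<tau> = (if fst \<tau> ! (g - 1) = z then bernoulli_ratio p q (snd \<tau> (g - 1)) else 1)"

lemma reward_ratio_measurable:
  assumes "g \<in> {1..H}"
  shows "reward_ratio g z p q \<in> borel_measurable (traj_space H)"
proof -
  have "(\<lambda>\<tau>. snd \<tau> (g - 1)) \<in> borel_measurable (traj_space H)"
    using assms unfolding traj_space_def
    by (intro measurable_compose[OF measurable_snd measurable_component_singleton]) auto
  from measurable_compose[OF this bernoulli_ratio_measurable]
  have "(\<lambda>\<tau>. bernoulli_ratio p q (snd \<tau> (g - 1))) \<in> borel_measurable (traj_space H)" .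
  moreover have "Measurable.pred (traj_space H) (\<lambda>\<tau>. fst \<tau> ! (g - 1) = z)"
    unfolding traj_space_def by measurable
  ultimately show ?thesis
    unfolding reward_ratio_def by measurable
qed

context
  fixes H g :: nat and z :: "nat \<times> nat" and \<eta> p q :: real and \<mu> :: "nat pmf"
    and T :: "nat \<Rightarrow> nat \<Rightarrow> nat \<Rightarrow> nat pmf" and m :: "nat \<Rightarrow> nat \<Rightarrow> nat \<Rightarrow> real"
  assumes g: "g \<in> {1..H}" and p: "p = m g (fst z) (snd z)" and p01: "0 < p" "p < 1"
    and q01: "0 < q" "q < 1" and \<eta>: "0 \<le> \<eta>" "\<eta> < 1"
begin

lemma nn_integral_perturbed_reward_space:
  assumes f: "f \<in> borel_measurable (traj_space H)"
  shows "(\<integral>\<^sup>+r. f (x, r) \<partial>reward_space (perturbed \<eta> g z q \<mu> T m) H 1 x) =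
    (\<integral>\<^sup>+r. ennreal (reward_ratio g z p q (x, r)) * f (x, r) \<partial>reward_space (bernoulli_mdp \<mu> T m) H 1 x)"
proof (cases "x ! (g - 1) = z")
  case True
  let ?N = "\<lambda>i. bernoulli_reward (m (1 + i) (fst (x ! i)) (snd (x ! i)))"
  have f': "(\<lambda>r. f (x, r)) \<in> borel_measurable (PiM {..<H} ?N)"
  proof -
    have "Pair x \<in> measurable (reward_space (bernoulli_mdp \<mu> T m) H 1 x) (traj_space H)"
      by (rule measurable_Pair_reward_space[OF valid_rewards_bernoulli_mdp])
    from measurable_compose[OF this f] show ?thesis by simp
  qed
  have g1: "1 + (g - 1) = g" using g by simp
  have Ng: "?N (g - 1) = bernoulli_reward p" unfolding g1 True p ..
  have "reward_space (perturbed \<eta> g z q \<mu> T m) H 1 x =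
     PiM {..<H} (?N(g - 1 := density (?N (g - 1)) (\<lambda>r. ennreal (bernoulli_ratio p q r))))"
    unfolding Ng bernoulli_reward_density[symmetric, OF p01 less_imp_le less_imp_le, OF q01]
  proof (rule PiM_cong[OF refl])
    fix i
    show "reward (perturbed \<eta> g z q \<mu> T m) (1 + i) (fst (x ! i)) (snd (x ! i)) =
      (?N(g - 1 := bernoulli_reward q)) i"
    proof (cases "i = g - 1")
      case i: True
      then have "1 + i = g" using g by simp
      with i True show ?thesis by (simp add: perturbed_def)
    next
      case False
      then have "1 + i \<noteq> g" by auto
      with False show ?thesis by (simp add: perturbed_def)
    qed
  qed
  also have "\<dots> = density (PiM {..<H} ?N) (\<lambda>r. ennreal (bernoulli_ratio p q (r (g - 1))))"
  proof (rule PiM_density_component)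
    show "prob_space (density (?N (g - 1)) (\<lambda>r. ennreal (bernoulli_ratio p q r)))"
      unfolding Ng bernoulli_reward_density[symmetric, OF p01 less_imp_le less_imp_le, OF q01]
      by (rule prob_space_bernoulli_reward)
    show "(\<lambda>r. ennreal (bernoulli_ratio p q r)) \<in> borel_measurable (?N (g - 1))"
      unfolding measurable_cong_sets[OF sets_bernoulli_reward refl] by measurable
  qed (use g in \<open>simp_all add: prob_space_bernoulli_reward less_imp_diff_less Suc_le_lessD\<close>)
  finally have eq: "reward_space (perturbed \<eta> g z q \<mu> T m) H 1 x =
    density (PiM {..<H} ?N) (\<lambda>r. ennreal (bernoulli_ratio p q (r (g - 1))))" .
  have "(\<lambda>r. r (g - 1)) \<in> measurable (PiM {..<H} ?N) (?N (g - 1))"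
    using g by (intro measurable_component_singleton) auto
  then have "(\<lambda>r. r (g - 1)) \<in> borel_measurable (PiM {..<H} ?N)"
    unfolding measurable_cong_sets[OF refl sets_bernoulli_reward] .
  from measurable_compose[OF this bernoulli_ratio_measurable]
  have "(\<lambda>r. ennreal (bernoulli_ratio p q (r (g - 1)))) \<in> borel_measurable (PiM {..<H} ?N)" by simp
  then show ?thesis
    unfolding eq using True f' by (subst nn_integral_density) (simp_all add: reward_ratio_def)
next
  case False
  have "reward_space (perturbed \<eta> g z q \<mu> T m) H 1 x = reward_space (bernoulli_mdp \<mu> T m) H 1 x"
    using False by (intro PiM_cong refl) (auto simp: perturbed_def)
  with False show ?thesis by (simp add: reward_ratio_def)
qed

text \<open>Counting only the paths produced without jumps costs \<open>(1 - \<eta>) ^ H\<close>; on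
  a fixed path the reward laws have the exact density \<open>reward_ratio\<close>.\<close>

lemma nn_integral_episode_perturbed_ge:
  assumes f: "f \<in> borel_measurable (traj_space H)"
  shows "(\<integral>\<^sup>+\<tau>. ennreal ((1 - \<eta>) ^ H * reward_ratio g z p q \<tau>) * f \<tau> \<partial>episode (bernoulli_mdp \<mu> T m) H \<pi>)
    \<le> (\<integral>\<^sup>+\<tau>. f \<tau> \<partial>episode (perturbed \<eta> g z q \<mu> T m) H \<pi>)"
proof -
  let ?M = "bernoulli_mdp \<mu> T m" and ?M' = "perturbed \<eta> g z q \<mu> T m"
  have v: "valid_rewards ?M" "valid_rewards ?M'"
    by (simp_all add: perturbed_def valid_rewards_bernoulli_mdp)
  have rr: "0 \<le> reward_ratio g z p q \<tau>" for \<tau>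
    using p01 q01 by (simp add: reward_ratio_def bernoulli_ratio_def)
  have mf: "(\<lambda>\<tau>. ennreal ((1 - \<eta>) ^ H * reward_ratio g z p q \<tau>) * f \<tau>) \<in> borel_measurable (traj_space H)"
    using reward_ratio_measurable[OF g] f by measurable
  have mf': "(\<lambda>\<tau>. ennreal (reward_ratio g z p q \<tau>) * f \<tau>) \<in> borel_measurable (traj_space H)"
    using reward_ratio_measurable[OF g] f by measurable
  let ?G = "\<lambda>x. \<integral>\<^sup>+r. ennreal (reward_ratio g z p q (x, r)) * f (x, r) \<partial>reward_space ?M H 1 x"
  have "(\<integral>\<^sup>+\<tau>. ennreal ((1 - \<eta>) ^ H * reward_ratio g z p q \<tau>) * f \<tau> \<partial>episode ?M H \<pi>) =
    (\<integral>\<^sup>+x. \<integral>\<^sup>+r. ennreal ((1 - \<eta>) ^ H * reward_ratio g z p q (x, r)) * f (x, r) \<partial>reward_space ?M H 1 x \<partial>paths ?M \<pi> H 1 \<mu>)"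
    unfolding episode_def nn_integral_rewarded[OF v(1) mf] by simp
  also have "\<dots> = (\<integral>\<^sup>+x. ennreal ((1 - \<eta>) ^ H) * ?G x \<partial>paths ?M \<pi> H 1 \<mu>)"
  proof (rule nn_integral_cong)
    fix x
    have "(\<lambda>r. ennreal (reward_ratio g z p q (x, r)) * f (x, r)) \<in> borel_measurable (reward_space ?M H 1 x)"
      by (rule measurable_compose[OF measurable_Pair_reward_space[OF v(1)] mf'])
    then show "(\<integral>\<^sup>+r. ennreal ((1 - \<eta>) ^ H * reward_ratio g z p q (x, r)) * f (x, r) \<partial>reward_space ?M H 1 x) =
      ennreal ((1 - \<eta>) ^ H) * ?G x"
      using \<eta> rr by (simp add: ennreal_mult mult.assoc nn_integral_cmult)
  qed
  also have "\<dots> = (\<integral>\<^sup>+x. ennreal ((1 - \<eta>) ^ H * pmf (paths ?M \<pi> H 1 \<mu>) x) * ?G x \<partial>count_space UNIV)"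
    using \<eta> by (simp add: nn_integral_measure_pmf ennreal_mult mult_ac)
  also have "\<dots> \<le> (\<integral>\<^sup>+x. ennreal (pmf (paths ?M' \<pi> H 1 (init ?M')) x) * ?G x \<partial>count_space UNIV)"
    using \<eta> by (intro nn_integral_mono mult_right_mono ennreal_leI pmf_paths_ge)
       (auto simp: perturbed_def pmf_mix)
  also have "\<dots> = (\<integral>\<^sup>+\<tau>. f \<tau> \<partial>episode ?M' H \<pi>)"
    unfolding episode_def nn_integral_rewarded[OF v(2) f] nn_integral_perturbed_reward_space[OF f]
    by (simp add: nn_integral_measure_pmf)
  finally show ?thesis .
qed

text \<open>Beyond the constant price of the jumps, an episode is informative only if it passes
  through \<open>z\<close>; the last bracket is minus the relative entropy of Bernoulli
  \<open>p\<close> with respect to Bernoulli \<open>q\<close>.\<close>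

lemma integral_ln_reward_ratio:
  "(\<integral>\<tau>. ln ((1 - \<eta>) ^ H * reward_ratio g z p q \<tau>) \<partial>episode (bernoulli_mdp \<mu> T m) H \<pi>) =
     real H * ln (1 - \<eta>) + visit (bernoulli_mdp \<mu> T m) H \<pi> g (fst z) (snd z) *
       (p * ln (q / p) + (1 - p) * ln ((1 - q) / (1 - p)))"
proof -
  let ?M = "bernoulli_mdp \<mu> T m"
  let ?K = "p * ln (q / p) + (1 - p) * ln ((1 - q) / (1 - p))"
  let ?f = "\<lambda>\<tau>. ln ((1 - \<eta>) ^ H * reward_ratio g z p q \<tau>)"
  have v: "valid_rewards ?M" by (rule valid_rewards_bernoulli_mdp)
  have rr: "reward_ratio g z p q \<tau> \<in> {q / p, (1 - q) / (1 - p), 1}" "0 < reward_ratio g z p q \<tau>" for \<tau>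
    using p01 q01 by (auto simp: reward_ratio_def bernoulli_ratio_def)
  have f: "?f \<tau> = real H * ln (1 - \<eta>) + ln (reward_ratio g z p q \<tau>)" for \<tau>
    using rr(2)[of \<tau>] \<eta> by (simp add: ln_mult ln_realpow)
  have mf: "?f \<in> borel_measurable (traj_space H)"
    using reward_ratio_measurable[OF g] by measurable
  have B: "\<bar>?f \<tau>\<bar> \<le> \<bar>real H * ln (1 - \<eta>)\<bar> + (\<bar>ln (q / p)\<bar> + \<bar>ln ((1 - q) / (1 - p))\<bar>)" for \<tau>
    unfolding f using rr(1)[of \<tau>] by auto
  have "(\<integral>\<tau>. ?f \<tau> \<partial>episode ?M H \<pi>) = (\<integral>x. (\<integral>r. ?f (x, r) \<partial>reward_space ?M H 1 x) \<partial>paths ?M \<pi> H 1 \<mu>)"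
    unfolding episode_def integral_rewarded[OF v mf B] by simp
  also have "\<dots> = (\<integral>x. real H * ln (1 - \<eta>) + indicator {x. x ! (g - 1) = z} x * ?K \<partial>paths ?M \<pi> H 1 \<mu>)"
  proof (rule Bochner_Integration.integral_cong[OF refl])
    fix x
    let ?N = "\<lambda>i. bernoulli_reward (m (1 + i) (fst (x ! i)) (snd (x ! i)))"
    interpret N: prob_space "PiM {..<H} ?N"
      by (intro prob_space_PiM prob_space_bernoulli_reward)
    show "(\<integral>r. ?f (x, r) \<partial>reward_space ?M H 1 x) = real H * ln (1 - \<eta>) + indicator {x. x ! (g - 1) = z} x * ?K"
    proof (cases "x ! (g - 1) = z")
      case True
      then have Ng: "?N (g - 1) = bernoulli_reward p" using g p by simp
      have comp: "(\<lambda>r. r (g - 1)) \<in> measurable (PiM {..<H} ?N) (?N (g - 1))"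
        using g by (intro measurable_component_singleton) auto
      let ?h = "\<lambda>r. real H * ln (1 - \<eta>) + ln (bernoulli_ratio p q r)"
      have "(\<integral>r. ?f (x, r) \<partial>reward_space ?M H 1 x) = (\<integral>r. ?h (r (g - 1)) \<partial>PiM {..<H} ?N)"
        unfolding f using True by (simp add: reward_ratio_def)
      also have "\<dots> = (\<integral>y. ?h y \<partial>distr (PiM {..<H} ?N) (?N (g - 1)) (\<lambda>r. r (g - 1)))"
        by (subst integral_distr[OF comp]) simp_all
      also have "distr (PiM {..<H} ?N) (?N (g - 1)) (\<lambda>r. r (g - 1)) = ?N (g - 1)"
        by (rule distr_PiM_component) (use g prob_space_bernoulli_reward in auto)
      also have "(\<integral>y. ?h y \<partial>?N (g - 1)) = real H * ln (1 - \<eta>) + ?K"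
        unfolding Ng using p01
        by (subst integral_bernoulli_reward) (auto simp: bernoulli_ratio_def algebra_simps)
      finally show ?thesis using True by simp
    next
      case False
      then show ?thesis unfolding f by (simp add: reward_ratio_def N.prob_space[simplified])
    qed
  qed
  also have "\<dots> = real H * ln (1 - \<eta>) + measure_pmf.prob (paths ?M \<pi> H 1 \<mu>) {x. x ! (g - 1) = z} * ?K"
    by (subst Bochner_Integration.integral_add) (auto intro!: integrable_mult_left integrable_real_indicator simp: measure_pmf.emeasure_eq_measure)
  finally show ?thesis by (simp add: visit_def)
qed

end

text \<open>The \<open>1\<close> in the minimum and maximum accounts for trajectories that miss
  \<open>z\<close>.\<close>

lemma likelihood_ratio_perturbed:
  fixes g H :: nat and z :: "nat \<times> nat"
  assumes g: "g \<in> {1..H}" and p: "p = m g (fst z) (snd z)" and p01: "0 < p" "p < 1"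
    and q01: "0 < q" "q < 1" and \<eta>: "0 \<le> \<eta>" "\<eta> < 1"
    and M: "is_mdp S A H (bernoulli_mdp \<mu> T m)" "is_mdp S A H (perturbed \<eta> g z q \<mu> T m)"
    and alg: "is_algorithm S A H alg"
  shows "likelihood_ratio S A H (bernoulli_mdp \<mu> T m) (perturbed \<eta> g z q \<mu> T m) alg
    (\<lambda>\<tau>. (1 - \<eta>) ^ H * reward_ratio g z p q \<tau>)
    ((1 - \<eta>) ^ H * min 1 (min (q / p) ((1 - q) / (1 - p))))
    ((1 - \<eta>) ^ H * max 1 (max (q / p) ((1 - q) / (1 - p))))"
proof -
  interpret I: interaction S A H "bernoulli_mdp \<mu> T m" alg
    using M alg by unfold_locales
  interpret I': interaction S A H "perturbed \<eta> g z q \<mu> T m" alg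
    using M alg by unfold_locales
  have rr: "reward_ratio g z p q \<tau> \<in> {q / p, (1 - q) / (1 - p), 1}" for \<tau>
    using p01 q01 by (auto simp: reward_ratio_def bernoulli_ratio_def)
  show ?thesis
  proof
    show "(\<lambda>\<tau>. (1 - \<eta>) ^ H * reward_ratio g z p q \<tau>) \<in> borel_measurable (traj_space H)"
      using reward_ratio_measurable[OF g] by measurable
    show "0 < (1 - \<eta>) ^ H * min 1 (min (q / p) ((1 - q) / (1 - p)))"
      using p01 q01 \<eta> by simp
    show "(1 - \<eta>) ^ H * min 1 (min (q / p) ((1 - q) / (1 - p))) \<le> (1 - \<eta>) ^ H * reward_ratio g z p q \<tau>"
      "(1 - \<eta>) ^ H * reward_ratio g z p q \<tau> \<le> (1 - \<eta>) ^ H * max 1 (max (q / p) ((1 - q) / (1 - p)))" for \<tau>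
      using rr[of \<tau>] \<eta> by (auto intro!: mult_left_mono)
    show "(\<integral>\<^sup>+\<tau>. ennreal ((1 - \<eta>) ^ H * reward_ratio g z p q \<tau>) * f \<tau> \<partial>episode (bernoulli_mdp \<mu> T m) H \<pi>)
      \<le> (\<integral>\<^sup>+\<tau>. f \<tau> \<partial>episode (perturbed \<eta> g z q \<mu> T m) H \<pi>)"
      if "f \<in> borel_measurable (traj_space H)" for \<pi> f
      by (rule nn_integral_episode_perturbed_ge[where m=m]) (fact g p p01 q01 \<eta> that)+
  qed
qed

text \<open>Relative entropy is at most the chi-square divergence, by
  \<open>ln x \<le> x - 1\<close> for each outcome.\<close>

lemma relative_entropy_bernoulli_le:
  fixes p q :: real
  assumes "0 < p" "p < 1" "0 < q" "q < 1"
  shows "- (p * ln (q / p) + (1 - p) * ln ((1 - q) / (1 - p))) \<le> (p - q)\<^sup>2 / (q * (1 - q))"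
proof -
  have "- (p * ln (q / p) + (1 - p) * ln ((1 - q) / (1 - p))) = p * ln (p / q) + (1 - p) * ln ((1 - p) / (1 - q))"
    using assms by (simp add: ln_div algebra_simps)
  also have "\<dots> \<le> p * (p / q - 1) + (1 - p) * ((1 - p) / (1 - q) - 1)"
    using assms by (intro add_mono mult_left_mono ln_le_minus_one) auto
  also have "\<dots> = (p - q)\<^sup>2 / (q * (1 - q))"
    using assms by (simp add: divide_simps power2_eq_square) algebra
  finally show ?thesis .
qed

text \<open>The most recent state draw jumps to \<open>fst z\<close> with probability \<eta>,
  whatever happened before.\<close>

lemma pmf_state_law_perturbed_ge:
  assumes "0 \<le> \<eta>" "\<eta> \<le> 1"
  shows "\<eta> \<le> pmf (state_law (perturbed \<eta> g z q \<mu> T m) \<pi> h i (init (perturbed \<eta> g z q \<mu> T m))) (fst z)"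
proof (cases i)
  case 0
  then show ?thesis using assms by (simp add: perturbed_def pmf_mix)
next
  case (Suc j)
  let ?D = "pair_law \<pi> (h + j) (state_law (perturbed \<eta> g z q \<mu> T m) \<pi> h j (init (perturbed \<eta> g z q \<mu> T m)))"
  have "\<eta> \<le> (\<integral>x. pmf (case x of (s, a) \<Rightarrow> trans (perturbed \<eta> g z q \<mu> T m) (h + j) s a) (fst z) \<partial>?D)"
    using assms
    by (intro measure_pmf.integral_ge_const AE_I2 measure_pmf.integrable_const_bound[where B=1])
       (auto simp: perturbed_def pmf_mix pmf_le_1 split: prod.splits)
  then show ?thesis by (simp add: Suc next_law_def pmf_bind)
qed

lemma (in interaction) PAC_prob_le:
  assumes PAC: "PAC S A H \<epsilon> \<delta> alg" and \<delta>: "\<delta> < 1"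
    and E: "E \<in> run.events"
    and bad: "\<And>\<omega>. \<omega> \<in> E \<Longrightarrow> (\<exists>k. stops_at alg \<omega> k) \<and> \<not> V0_opt S A H M - V0 M H (returned alg \<omega>) \<le> \<epsilon>"
  shows "run.prob E \<le> \<delta>"
proof -
  let ?G = "{\<omega> \<in> space (run M H alg). (\<exists>k. stops_at alg \<omega> k) \<longrightarrow>
             V0_opt S A H M - V0 M H (returned alg \<omega>) \<le> \<epsilon>}"
  have G: "1 - \<delta> \<le> run.prob ?G" using PAC mdp by (simp add: PAC_def)
  \<comment> \<open>a non-measurable set would have measure \<open>0\<close>\<close>
  have "?G \<in> run.events"
  proof (rule ccontr)
    assume "?G \<notin> run.events"
    then have "run.prob ?G = 0" by (rule measure_notin_sets)
    with G \<delta> show False by simp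
  qed
  then have "run.prob E + run.prob ?G = run.prob (E \<union> ?G)"
    using E bad by (intro run.finite_measure_Union[symmetric]) auto
  also have "\<dots> \<le> 1" by (rule run.prob_le_1)
  finally show ?thesis using G by simp
qed

section \<open>The hard instance\<close>

text \<open>
  Out-of-range pairs at step \<open>g\<close> get mean \<open>0\<close> because \<open>gap\<close> is unconstrained there.
\<close>

definition hard_mean :: "nat \<Rightarrow> nat \<Rightarrow> nat \<Rightarrow> (nat \<Rightarrow> nat \<Rightarrow> real) \<Rightarrow> nat \<Rightarrow> nat \<Rightarrow> nat \<Rightarrow> real" where
  "hard_mean S A g gap h s a =
     (if h = g then (if a = 0 then 1 / 2 else if s < S \<and> a < A then 1 / 2 - gap s (a - 1) else 0)
      else if a = 0 then 1 else 0)"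

text \<open>From step \<open>g\<close> on the next state ignores the current pair, as
  \<open>optimal_plays_best\<close> requires; mixing in jumps preserves this.\<close>

definition hard_trans ::
    "nat \<Rightarrow> (nat \<Rightarrow> nat \<Rightarrow> nat \<Rightarrow> nat pmf) \<Rightarrow> nat \<Rightarrow> nat \<Rightarrow> nat \<Rightarrow> nat pmf" where
  "hard_trans g P h s a = (if h < g then P h s a else return_pmf 0)"

abbreviation hard_mdp ::
    "nat \<Rightarrow> nat \<Rightarrow> nat \<Rightarrow> (nat \<Rightarrow> nat \<Rightarrow> nat \<Rightarrow> nat pmf) \<Rightarrow> (nat \<Rightarrow> nat \<Rightarrow> real) \<Rightarrow> mdp" where
  "hard_mdp S A g P gap \<equiv> bernoulli_mdp (return_pmf 0) (hard_trans g P) (hard_mean S A g gap)"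

locale hard_instance =
  fixes S A H g :: nat and P :: "nat \<Rightarrow> nat \<Rightarrow> nat \<Rightarrow> nat pmf" and gap :: "nat \<Rightarrow> nat \<Rightarrow> real"
  assumes S: "1 < S" and A: "1 < A" and g: "g \<in> {1..H}"
    and P: "\<And>h s a. h \<in> {1..<g} \<Longrightarrow> s < S \<Longrightarrow> a < A \<Longrightarrow> set_pmf (P h s a) \<subseteq> {..<S}"
    and gap: "\<And>s j. s < S \<Longrightarrow> j < A - 1 \<Longrightarrow> 0 < gap s j \<and> gap s j < 1 / 2"
begin

abbreviation M :: mdp where "M \<equiv> hard_mdp S A g P gap"

lemma gap': "s < S \<Longrightarrow> a < A \<Longrightarrow> 0 < a \<Longrightarrow> 0 < gap s (a - 1) \<and> gap s (a - 1) < 1 / 2"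
  by (rule gap) auto

lemma hard_mean_01: "0 \<le> hard_mean S A g gap h s a" "hard_mean S A g gap h s a \<le> 1"
  using gap'[of s a] by (auto simp: hard_mean_def)

lemma mean_reward_hard: "mean_reward M h (s, a) = hard_mean S A g gap h s a"
  by (rule mean_reward_bernoulli_mdp) (rule hard_mean_01)+

lemma set_hard_trans:
  "h \<in> {1..<H} \<Longrightarrow> s < S \<Longrightarrow> a < A \<Longrightarrow> set_pmf (hard_trans g P h s a) \<subseteq> {..<S}"
  using P[of h s a] S by (auto simp: hard_trans_def)

lemma is_mdp_hard: "is_mdp S A H M"
  unfolding is_mdp_bernoulli_mdp using S set_hard_trans by auto

lemma is_mdp_perturbed:
  "fst z < S \<Longrightarrow> is_mdp S A H (perturbed \<eta> g z q (return_pmf 0) (hard_trans g P) (hard_mean S A g gap))"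
  unfolding perturbed_def is_mdp_bernoulli_mdp
  using S set_hard_trans set_mix by fastforce

lemma Delta_hard:
  assumes "h \<le> H"
  shows "Delta S A H M h s a = (if h = g then 1 / 2 else 1) - hard_mean S A g gap h s a"
  using A gap' assms
  by (subst Delta_eq[where R="\<lambda>h. if h = g then 1 / 2 else 1"])
     (auto simp: valid_rewards_bernoulli_mdp mean_reward_hard, auto simp: hard_mean_def less_imp_le)

lemma optimal_det_hard: "optimal_det S A H M (\<lambda>h s. 0)"
  using A gap'
  by (intro optimal_det_const_0[where R="\<lambda>h. if h = g then 1 / 2 else 1"])
     (auto simp: valid_rewards_bernoulli_mdp mean_reward_hard, auto simp: hard_mean_def less_imp_le)

text \<open>Covers both alternatives: with \<open>b = 0\<close> the rewards at \<open>(s, 0)\<close>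
  stay as they are and only jumps are added, otherwise \<open>(s, b)\<close> is raised above the
  best mean \<open>1 / 2\<close>. In both \<open>s\<close> is reached and \<open>b\<close> is
  strictly best there.\<close>

lemma optimal_in_perturbed:
  assumes s: "s < S" and b: "b < A" and \<eta>: "0 < \<eta>" "\<eta> < 1" and q: "0 \<le> q" "q \<le> 1"
    and best: "b = 0 \<and> q = 1 / 2 \<or> 0 < b \<and> 1 / 2 < q"
    and M': "M' = perturbed \<eta> g (s, b) q (return_pmf 0) (hard_trans g P) (hard_mean S A g gap)"
    and \<pi>: "\<pi> \<in> policies S A H" and opt: "V0_opt S A H M' - V0 M' H \<pi> \<le> 0"
  shows "pmf (\<pi> g s) b = 1"
proof (rule optimal_plays_best[OF _ g s b _ _ _ \<pi> opt])
  show "is_mdp S A H M'" unfolding M' by (rule is_mdp_perturbed) (simp add: s)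
  show "trans M' h s' a' = trans M' h 0 0" if "g \<le> h" for h s' a'
    using that by (simp add: M' perturbed_def hard_trans_def)
  show "0 < pmf (state_law M' \<rho> 1 (g - 1) (init M')) s" for \<rho>
    using pmf_state_law_perturbed_ge[of \<eta> g "(s, b)" q "return_pmf 0" "hard_trans g P" "hard_mean S A g gap" \<rho> 1 "g - 1"] \<eta>
    unfolding M' by simp
  show "mean_reward M' g (s, a) < mean_reward M' g (s, b)" if "a < A" "a \<noteq> b" for a
  proof -
    have m: "mean_reward M' g (s, a) = (if a = b then q else hard_mean S A g gap g s a)" for a
      unfolding M' perturbed_def using q hard_mean_01 by (subst mean_reward_bernoulli_mdp) auto
    have "hard_mean S A g gap g s a < q"
      using best that gap'[OF s that(1)] s by (auto simp: hard_mean_def)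
    with that show ?thesis by (simp add: m)
  qed
qed


section \<open>The information required about one pair\<close>

context
  fixes alg :: algorithm and \<delta> :: real and s a :: nat
  assumes PAC: "PAC S A H 0 \<delta> alg" and \<delta>: "0 < \<delta>" "2.4 * \<delta> < 1" and s: "s < S" and a: "0 < a" "a < A"
begin

lemma alg: "is_algorithm S A H alg"
  using PAC by (simp add: PAC_def)

interpretation I: interaction S A H M alg
  using is_mdp_hard alg by unfold_locales

text \<open>The test that separates the two alternatives: an optimal policy passes it when only
  jumps are added and fails it when \<open>(s, a)\<close> is raised.\<close>

definition recommends_0 :: "nat \<Rightarrow> history \<times> real \<Rightarrow> bool" where
  "recommends_0 k z \<longleftrightarrow> pmf (recommend alg k (fst z) (snd z) g s) 0 = 1"

lemma measurable_recommends_0: "Measurable.pred (info_space H k) (recommends_0 k)"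
proof -
  have "(\<lambda>z. pmf (recommend alg k (fst z) (snd z) g s) 0) \<in> borel_measurable (info_space H k)"
    using alg g s a by (auto simp: is_algorithm_def measurable_rule_def split_def)
  then show ?thesis unfolding recommends_0_def by measurable
qed

lemma returned_policy:
  assumes "halts alg k \<omega>"
  shows "returned alg \<omega> \<in> policies S A H" "pmf (returned alg \<omega> g s) 0 = 1 \<longleftrightarrow> recommends_0 k (info k \<omega>)"
  using alg by (auto simp: returned_eq[OF assms] recommends_0_def is_algorithm_def measurable_rule_def)

text \<open>The guarantee on the hard MDP is silent about \<open>s\<close> if \<open>s\<close> is
  unreachable. It is therefore used on the alternative with jumps alone, whose law over
  \<open>n\<close> rounds is close to the original one, and \<eta> tends to
  \<open>0\<close>.\<close>

lemma prob_recommends_other: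
  "I.run.prob {\<omega> \<in> space (run M H alg). ends_well alg n (\<lambda>k z. \<not> recommends_0 k z) \<omega>} \<le> \<delta>" (is "I.run.prob ?E \<le> \<delta>")
proof -
  have "((1 - \<eta>) ^ H) ^ n * I.run.prob ?E \<le> \<delta>" if \<eta>: "0 < \<eta>" "\<eta> < 1" for \<eta>
  proof -
    define M' where "M' = perturbed \<eta> g (s, 0) (1 / 2) (return_pmf 0) (hard_trans g P) (hard_mean S A g gap)"
    have M': "is_mdp S A H M'" unfolding M'_def by (rule is_mdp_perturbed) (simp add: s)
    have half: "1 / 2 = hard_mean S A g gap g (fst (s, 0)) (snd (s, 0))" by (simp add: hard_mean_def)
    interpret L: likelihood_ratio S A H M M' alg "\<lambda>\<tau>. (1 - \<eta>) ^ H * reward_ratio g (s, 0) (1 / 2) (1 / 2) \<tau>"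
      "(1 - \<eta>) ^ H * min 1 (min ((1 / 2) / (1 / 2)) ((1 - 1 / 2) / (1 - 1 / 2)))"
      "(1 - \<eta>) ^ H * max 1 (max ((1 / 2) / (1 / 2)) ((1 - 1 / 2) / (1 - 1 / 2)))"
      unfolding M'_def
      by (rule likelihood_ratio_perturbed[where m="hard_mean S A g gap", OF g half])
         (use \<eta> is_mdp_hard M'[unfolded M'_def] alg in auto)
    let ?ok = "\<lambda>k z. \<not> recommends_0 k z"
    have ok: "Measurable.pred (info_space H k) (?ok k)" for k
      using measurable_recommends_0 by (intro pred_intros_logic)
    let ?E' = "{\<omega> \<in> space (run M' H alg). ends_well alg n ?ok \<omega>}"
    have E: "?E \<in> I.run.events" using I.measurable_ends_well[OF ok] by (simp add: pred_def)
    have E': "?E' \<in> L.I'.run.events" using L.I'.measurable_ends_well[OF ok] by (simp add: pred_def)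
    have "L.I'.run.prob ?E' \<le> \<delta>"
    proof (rule L.I'.PAC_prob_le[OF PAC _ E'])
      fix \<omega> assume "\<omega> \<in> ?E'"
      then obtain k where k: "halts alg k \<omega>" "\<not> recommends_0 k (info k \<omega>)"
        by (auto simp: ends_well_def)
      then have "pmf (returned alg \<omega> g s) 0 \<noteq> 1" using returned_policy[OF k(1)] by simp
      then have "\<not> V0_opt S A H M' - V0 M' H (returned alg \<omega>) \<le> 0"
        using optimal_in_perturbed[OF s _ \<eta> _ _ _ M'_def returned_policy(1)[OF k(1)]] A by auto
      then show "(\<exists>k. stops_at alg \<omega> k) \<and> \<not> V0_opt S A H M' - V0 M' H (returned alg \<omega>) \<le> 0"
        using k by (auto simp: halts_def)
    qed (use \<delta> in simp)
    \<comment> \<open>With equal means the reward ratio is \<open>1\<close>, so each played episode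
      contributes exactly the price of the jumps, and the other rounds contribute
      \<open>1\<close>.\<close>
    have "((1 - \<eta>) ^ H) ^ n \<le> L.stopped_lik n \<omega>" for \<omega>
    proof -
      have "(\<Prod>j<n. (1 - \<eta>) ^ H) \<le> L.stopped_lik n \<omega>"
        unfolding L.stopped_lik_def using \<eta>
        by (intro prod_mono) (auto simp: reward_ratio_def bernoulli_ratio_def power_le_one)
      then show ?thesis by simp
    qed
    then have "ennreal (((1 - \<eta>) ^ H) ^ n) * emeasure (run M H alg) ?E \<le>
      (\<integral>\<^sup>+\<omega>. ennreal (L.stopped_lik n \<omega> * (if ends_well alg n ?ok \<omega> then 1 else 0)) \<partial>run M H alg)"
      unfolding nn_integral_cmult_indicator[OF E, symmetric]
      by (intro nn_integral_mono) (auto split: split_indicator intro!: ennreal_leI)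
    also have "\<dots> \<le> (\<integral>\<^sup>+\<omega>. ennreal (if ends_well alg n ?ok \<omega> then 1 else 0) \<partial>run M' H alg)"
      by (rule L.stopped_lik_transport[OF ok]) auto
    also have "\<dots> = (\<integral>\<^sup>+\<omega>. indicator ?E' \<omega> \<partial>run M' H alg)"
      by (intro nn_integral_cong) (simp split: split_indicator)
    also have "\<dots> = emeasure (run M' H alg) ?E'"
      by (rule nn_integral_indicator[OF E'])
    finally have "ennreal (((1 - \<eta>) ^ H) ^ n * I.run.prob ?E) \<le> ennreal (L.I'.run.prob ?E')"
      using \<eta> by (simp add: I.run.emeasure_eq_measure L.I'.run.emeasure_eq_measure ennreal_mult)
    then have "((1 - \<eta>) ^ H) ^ n * I.run.prob ?E \<le> L.I'.run.prob ?E'"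
      by (simp add: ennreal_le_iff)
    with \<open>L.I'.run.prob ?E' \<le> \<delta>\<close> show ?thesis by simp
  qed
  then have ev: "eventually (\<lambda>\<eta>. ((1 - \<eta>) ^ H) ^ n * I.run.prob ?E \<le> \<delta>) (at_right 0)"
    by (auto simp: eventually_at_right_field intro!: exI[of _ 1])
  have "((\<lambda>\<eta>. ((1 - \<eta>) ^ H) ^ n * I.run.prob ?E) \<longlongrightarrow> ((1 - 0) ^ H) ^ n * I.run.prob ?E) (at_right (0::real))"
    by (intro tendsto_intros)
  from tendsto_upperbound[OF this ev] show ?thesis by simp
qed

text \<open>The event of recommending \<open>0\<close> is likely under the hard MDP and has
  probability at most \<delta> under the alternative raising \<open>(s, a)\<close>. By
  \<open>change_of_measure\<close> this needs information, which only visits of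
  \<open>(s, a)\<close> provide once the jumps have vanished.\<close>

lemma visits_ge:
  assumes n: "I.run.prob {\<omega> \<in> space (run M H alg). unstopped alg n \<omega>} \<le> 1 / 24"
  shows "ln (1 / (2.4 * \<delta>)) / 12 \<le> 12 * (gap s (a - 1))\<^sup>2 *
    (\<Sum>j<n. \<integral>\<omega>. (if unstopped alg (Suc j) \<omega> then 1 else 0) * visit M H (I.played j \<omega>) g s a \<partial>run M H alg)"
proof -
  define \<Gamma> where "\<Gamma> = gap s (a - 1)"
  have \<Gamma>: "0 < \<Gamma>" "\<Gamma> < 1 / 2" unfolding \<Gamma>_def using gap'[OF s a(2,1)] by auto
  define p where "p = 1 / 2 - \<Gamma>"
  \<comment> \<open>Above the optimal mean \<open>1 / 2\<close>, yet at distance only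
    \<open>3 / 2 * \<Gamma>\<close> from \<open>p\<close>. As \<open>\<Gamma> < 1 / 2\<close>, the
    variance \<open>q * (1 - q)\<close> is at least \<open>3 / 16\<close>, and
    \<open>(9 / 4) / (3 / 16) = 12\<close>.\<close>
  define q where "q = 1 / 2 + \<Gamma> / 2"
  define K where "K = - (p * ln (q / p) + (1 - p) * ln ((1 - q) / (1 - p)))"
  have p: "p = hard_mean S A g gap g (fst (s, a)) (snd (s, a))"
    using a s by (simp add: p_def \<Gamma>_def hard_mean_def)
  have p01: "0 < p" "p < 1" and q01: "0 < q" "q < 1" using \<Gamma> by (auto simp: p_def q_def)
  have K: "K \<le> 12 * \<Gamma>\<^sup>2"
  proof -
    have "K \<le> (p - q)\<^sup>2 / (q * (1 - q))"
      unfolding K_def using p01 q01 by (rule relative_entropy_bernoulli_le)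
    also have "\<dots> \<le> (p - q)\<^sup>2 / (3 / 16)"
    proof (rule divide_left_mono)
      have "\<Gamma>\<^sup>2 \<le> (1 / 2)\<^sup>2" using \<Gamma> by (intro power_mono) auto
      then show "3 / 16 \<le> q * (1 - q)" by (simp add: q_def power2_eq_square algebra_simps)
    qed (use q01 in auto)
    also have "\<dots> = 12 * \<Gamma>\<^sup>2" by (simp add: p_def q_def power2_eq_square algebra_simps)
    finally show ?thesis .
  qed
  define V where "V j \<omega> = visit M H (I.played j \<omega>) g s a" for j \<omega>
  define u where "u j \<omega> = (if unstopped alg (Suc j) \<omega> then 1 else 0 :: real)" for j \<omega>
  have V_meas: "V j \<in> borel_measurable (run M H alg)" for j
    unfolding V_def by (rule measurable_visit[OF is_mdp_hard I.policy_valued_played g])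
  have u_meas: "u j \<in> borel_measurable (run M H alg)" for j
    unfolding u_def using I.measurable_unstopped by measurable
  have V01: "0 \<le> V j \<omega>" "V j \<omega> \<le> 1" for j \<omega> by (auto simp: V_def visit_def)
  have u01: "0 \<le> u j \<omega>" "u j \<omega> \<le> 1" for j \<omega> by (auto simp: u_def)
  have int_u: "integrable (run M H alg) (u j)" for j
    using u01 u_meas by (intro I.run.integrable_const_bound[where B=1]) auto
  have int_uV: "integrable (run M H alg) (\<lambda>\<omega>. u j \<omega> * V j \<omega>)" for j
    using u01 V01 u_meas V_meas by (intro I.run.integrable_const_bound[where B=1]) (auto simp: abs_mult intro!: mult_le_one)
  \<comment> \<open>The weights in \<open>change_of_measure\<close> are \<open>L\<close> and
    \<open>- L\<close>: the log-odds make
    \<open>exp L * \<delta> + exp (- L) * (1 - \<delta>)\<close> equal to \<open>1\<close>,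
    cancelling the constant there.\<close>
  define L where "L = ln ((1 - \<delta>) / \<delta>)"
  have expL: "exp L = (1 - \<delta>) / \<delta>" "exp (- L) = \<delta> / (1 - \<delta>)"
    using \<delta> by (simp_all add: L_def exp_minus)
  have L: "ln (1 / (2.4 * \<delta>)) \<le> L" "0 \<le> L"
  proof -
    have "1 / (2.4 * \<delta>) \<le> (1 - \<delta>) / \<delta>" using \<delta> by (simp add: divide_simps)
    then show "ln (1 / (2.4 * \<delta>)) \<le> L" unfolding L_def using \<delta> by (intro ln_mono) auto
    show "0 \<le> L" unfolding L_def using \<delta> by (intro ln_ge_zero) (simp add: divide_simps)
  qed
  let ?p = "I.run.prob {\<omega> \<in> space (run M H alg). ends_well alg n recommends_0 \<omega>}"
  have "L / 12 \<le> 12 * \<Gamma>\<^sup>2 * (\<Sum>j<n. \<integral>\<omega>. u j \<omega> * V j \<omega> \<partial>run M H alg) + real n * real H * (- ln (1 - \<eta>))"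
    if \<eta>: "0 < \<eta>" "\<eta> < 1" for \<eta>
  proof -
    define M' where "M' = perturbed \<eta> g (s, a) q (return_pmf 0) (hard_trans g P) (hard_mean S A g gap)"
    have M': "is_mdp S A H M'" unfolding M'_def by (rule is_mdp_perturbed) (simp add: s)
    interpret L: likelihood_ratio S A H M M' alg "\<lambda>\<tau>. (1 - \<eta>) ^ H * reward_ratio g (s, a) p q \<tau>"
      "(1 - \<eta>) ^ H * min 1 (min (q / p) ((1 - q) / (1 - p)))"
      "(1 - \<eta>) ^ H * max 1 (max (q / p) ((1 - q) / (1 - p)))"
      unfolding M'_def
      by (rule likelihood_ratio_perturbed[where m="hard_mean S A g gap", OF g p p01 q01])
         (use \<eta> is_mdp_hard M'[unfolded M'_def] alg in auto)
    let ?E' = "{\<omega> \<in> space (run M' H alg). ends_well alg n recommends_0 \<omega>}"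
    let ?p' = "L.I'.run.prob ?E'"
    have E': "?E' \<in> L.I'.run.events"
      using L.I'.measurable_ends_well[OF measurable_recommends_0] by (simp add: pred_def)
    have p': "?p' \<le> \<delta>"
    proof (rule L.I'.PAC_prob_le[OF PAC _ E'])
      fix \<omega> assume "\<omega> \<in> ?E'"
      then obtain k where k: "halts alg k \<omega>" "recommends_0 k (info k \<omega>)"
        by (auto simp: ends_well_def)
      then have one: "pmf (returned alg \<omega> g s) 0 = 1" using returned_policy[OF k(1)] by simp
      have "pmf (returned alg \<omega> g s) a \<noteq> 1"
      proof
        assume "pmf (returned alg \<omega> g s) a = 1"
        with one have "measure_pmf.prob (returned alg \<omega> g s) {0, a} = 2"
          using a by (subst measure_measure_pmf_finite) auto
        then show False using measure_pmf.prob_le_1[of "returned alg \<omega> g s" "{0, a}"] by simp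
      qed
      then have "\<not> V0_opt S A H M' - V0 M' H (returned alg \<omega>) \<le> 0"
        using optimal_in_perturbed[OF s a(2) \<eta> _ _ _ M'_def returned_policy(1)[OF k(1)]] a q01 \<Gamma> by (auto simp: q_def)
      then show "(\<exists>k. stops_at alg \<omega> k) \<and> \<not> V0_opt S A H M' - V0 M' H (returned alg \<omega>) \<le> 0"
        using k by (auto simp: halts_def)
    qed (use \<delta> in simp)
    let ?U = "{\<omega> \<in> space (run M H alg). unstopped alg n \<omega>}"
    let ?E = "{\<omega> \<in> space (run M H alg). ends_well alg n recommends_0 \<omega>}"
    let ?F = "{\<omega> \<in> space (run M H alg). ends_well alg n (\<lambda>k z. \<not> recommends_0 k z) \<omega>}"
    have sets: "?U \<in> I.run.events" "?E \<in> I.run.events" "?F \<in> I.run.events"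
      using I.measurable_unstopped I.measurable_ends_well[OF measurable_recommends_0]
        I.measurable_ends_well[of "\<lambda>k z. \<not> recommends_0 k z", OF pred_intros_logic(2)[OF measurable_recommends_0]]
      by (simp_all add: pred_def)
    have "space (run M H alg) \<subseteq> ?U \<union> (?E \<union> ?F)"
    proof
      fix \<omega> assume "\<omega> \<in> space (run M H alg)"
      then show "\<omega> \<in> ?U \<union> (?E \<union> ?F)"
        by (cases rule: halting_cases[of alg n \<omega>]) (auto simp: ends_well_def)
    qed
    then have "1 \<le> I.run.prob (?U \<union> (?E \<union> ?F))"
      using sets by (subst I.run.prob_space[symmetric], intro I.run.finite_measure_mono) auto
    also have "\<dots> \<le> I.run.prob ?U + I.run.prob (?E \<union> ?F)"
      using sets by (intro measure_Un_le) auto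
    also have "\<dots> \<le> I.run.prob ?U + (I.run.prob ?E + I.run.prob ?F)"
      using sets by (intro add_left_mono measure_Un_le) auto
    finally have pp: "1 - \<delta> - 1 / 24 \<le> ?p"
      using n prob_recommends_other[of n] by simp
    have "L / 12 \<le> L * (2 * ?p - 1)"
    proof -
      \<comment> \<open>From \<open>\<delta> < 5 / 12\<close> the probability is at least
        \<open>1 - 5 / 12 - 1 / 24 = 13 / 24\<close>.\<close>
      have "1 / 12 \<le> 2 * ?p - 1" using pp \<delta> by simp
      from mult_left_mono[OF this L(2)] show ?thesis by simp
    qed
    also have "\<dots> \<le> L * ?p + - L * (1 - ?p) + 1 - (exp L * ?p' + exp (- L) * (1 - ?p'))"
    proof -
      \<comment> \<open>The exponential term increases with the probability under the alternative,
        so it is largest at \<delta>, where it equals \<open>1\<close>.\<close>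
      have "exp (- L) \<le> exp L" using L by simp
      then have "(exp L - exp (- L)) * ?p' \<le> (exp L - exp (- L)) * \<delta>"
        using p' by (intro mult_left_mono) auto
      moreover have "exp L * \<delta> + exp (- L) * (1 - \<delta>) = 1"
        unfolding expL using \<delta> by simp
      ultimately show ?thesis by (simp add: algebra_simps)
    qed
    also have "\<dots> \<le> (\<Sum>j<n. \<integral>\<omega>. (if unstopped alg (Suc j) \<omega>
        then - (\<integral>\<tau>. ln ((1 - \<eta>) ^ H * reward_ratio g (s, a) p q \<tau>) \<partial>episode M H (I.played j \<omega>)) else 0) \<partial>run M H alg)"
      by (rule L.change_of_measure[OF measurable_recommends_0])
    also have "\<dots> = (\<Sum>j<n. \<integral>\<omega>. real H * (- ln (1 - \<eta>)) * u j \<omega> + K * (u j \<omega> * V j \<omega>) \<partial>run M H alg)"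
    proof (intro sum.cong refl Bochner_Integration.integral_cong)
      fix j \<omega>
      show "(if unstopped alg (Suc j) \<omega>
        then - (\<integral>\<tau>. ln ((1 - \<eta>) ^ H * reward_ratio g (s, a) p q \<tau>) \<partial>episode M H (I.played j \<omega>)) else 0)
        = real H * (- ln (1 - \<eta>)) * u j \<omega> + K * (u j \<omega> * V j \<omega>)"
        using integral_ln_reward_ratio[where m="hard_mean S A g gap", OF g p p01 q01 less_imp_le[OF \<eta>(1)] \<eta>(2), of "return_pmf 0" "hard_trans g P" "I.played j \<omega>"]
        by (simp add: u_def V_def K_def algebra_simps)
    qed
    also have "\<dots> = (\<Sum>j<n. real H * (- ln (1 - \<eta>)) * (\<integral>\<omega>. u j \<omega> \<partial>run M H alg) + K * (\<integral>\<omega>. u j \<omega> * V j \<omega> \<partial>run M H alg))"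
      using int_u int_uV by simp
    also have "\<dots> \<le> (\<Sum>j<n. real H * (- ln (1 - \<eta>)) * 1 + 12 * \<Gamma>\<^sup>2 * (\<integral>\<omega>. u j \<omega> * V j \<omega> \<partial>run M H alg))"
    proof (intro sum_mono add_mono mult_left_mono mult_right_mono K)
      show "(\<integral>\<omega>. u j \<omega> \<partial>run M H alg) \<le> 1" for j
        using u01 int_u by (intro I.run.integral_le_const) auto
      show "0 \<le> (\<integral>\<omega>. u j \<omega> * V j \<omega> \<partial>run M H alg)" for j
        using u01 V01 by (intro Bochner_Integration.integral_nonneg) auto
      show "0 \<le> real H * (- ln (1 - \<eta>))" using \<eta> by (intro mult_nonneg_nonneg) auto
    qed
    also have "\<dots> = 12 * \<Gamma>\<^sup>2 * (\<Sum>j<n. \<integral>\<omega>. u j \<omega> * V j \<omega> \<partial>run M H alg) + real n * real H * (- ln (1 - \<eta>))"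
      by (simp add: sum.distrib sum_subtractf sum_distrib_left)
    finally show ?thesis .
  qed
  then have ev: "eventually (\<lambda>\<eta>. L / 12 \<le> 12 * \<Gamma>\<^sup>2 * (\<Sum>j<n. \<integral>\<omega>. u j \<omega> * V j \<omega> \<partial>run M H alg)
      + real n * real H * (- ln (1 - \<eta>))) (at_right 0)"
    by (auto simp: eventually_at_right_field intro!: exI[of _ 1])
  \<comment> \<open>The visits are those under the hard MDP and do not depend on \<eta>; with
    \<open>n\<close> fixed, the price of the jumps disappears in the limit.\<close>
  have "((\<lambda>\<eta>. 12 * \<Gamma>\<^sup>2 * (\<Sum>j<n. \<integral>\<omega>. u j \<omega> * V j \<omega> \<partial>run M H alg) + real n * real H * (- ln (1 - \<eta>)))
    \<longlongrightarrow> 12 * \<Gamma>\<^sup>2 * (\<Sum>j<n. \<integral>\<omega>. u j \<omega> * V j \<omega> \<partial>run M H alg) + real n * real H * (- ln (1 - 0))) (at_right (0::real))"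
    by (intro tendsto_intros) auto
  from tendsto_lowerbound[OF this ev]
  have "L / 12 \<le> 12 * \<Gamma>\<^sup>2 * (\<Sum>j<n. \<integral>\<omega>. u j \<omega> * V j \<omega> \<partial>run M H alg)" by simp
  with L(1) show ?thesis
    unfolding \<Gamma>_def u_def V_def by simp
qed

end

text \<open>One averaged policy represents the expected visits of all pairs at once, with the
  expected number of played episodes as common factor. Its worst pair bounds the complexity, and
  \<open>visits_ge\<close> for that pair bounds the factor from below.\<close>

lemma complexity_le_expected_episodes:
  assumes PAC: "PAC S A H 0 \<delta> alg" and \<delta>: "0 < \<delta>"
  shows "ennreal (1 / 144) * complexity S A H M (\<lambda>h s. 0) g * ennreal (ln (1 / (2.4 * \<delta>))) \<le> expected_episodes M H alg"
proof (cases "2.4 * \<delta> < 1")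
  case False
  \<comment> \<open>For large \<delta> the logarithm is not positive and \<open>ennreal\<close>
    turns it into \<open>0\<close>.\<close>
  then have "ln (1 / (2.4 * \<delta>)) \<le> 0" using \<delta> by (subst ln_le_zero_iff) (auto simp: divide_simps)
  then show ?thesis by (simp add: ennreal_neg)
next
  case small: True
  show ?thesis
  proof (cases "expected_episodes M H alg")
    case (real e)
    have alg: "is_algorithm S A H alg" using PAC by (simp add: PAC_def)
    interpret I: interaction S A H M alg
      using is_mdp_hard alg by unfold_locales
    define l where "l = ln (1 / (2.4 * \<delta>))"
    have l: "0 < l" unfolding l_def using \<delta> small by (intro ln_gt_zero) (simp add: divide_simps)
    \<comment> \<open>At least \<open>24\<close> times the expected number of episodes, so that
      Markov's inequality leaves at most \<open>1 / 24\<close>; the successor keeps it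
      positive.\<close>
    define n where "n = Suc (nat \<lceil>24 * e\<rceil>)"
    have n: "24 * e \<le> real n" "0 < real n" unfolding n_def by linarith+
    have "real n * I.run.prob {\<omega> \<in> space (run M H alg). unstopped alg n \<omega>} \<le> e"
      using I.prob_unstopped_le[of n] real by simp
    also have "e \<le> real n * (1 / 24)" using n by simp
    finally have un: "I.run.prob {\<omega> \<in> space (run M H alg). unstopped alg n \<omega>} \<le> 1 / 24"
      using n by (simp only: mult_le_cancel_left_pos)
    define u where "u j \<omega> = (if unstopped alg (Suc j) \<omega> then 1 else 0 :: real)" for j \<omega>
    define t where "t = (\<Sum>j<n. \<integral>\<omega>. u j \<omega> \<partial>run M H alg)"
    have u_meas: "u j \<in> borel_measurable (run M H alg)" for j
      unfolding u_def using I.measurable_unstopped by measurable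
    have u01: "0 \<le> u j \<omega>" "u j \<omega> \<le> 1" for j \<omega> by (auto simp: u_def)
    have "\<exists>\<pi>\<in>policies S A H. \<forall>h\<in>{1..H}. \<forall>s<S. \<forall>a<A.
      (\<Sum>j<n. \<integral>\<omega>. u j \<omega> * visit M H (I.played j \<omega>) h s a \<partial>run M H alg) = t * visit M H \<pi> h s a"
      unfolding t_def
      by (rule averaged_policy[OF is_mdp_hard _ I.run.finite_measure_axioms I.policy_valued_played u_meas u01]) (use A in simp)
    then obtain \<pi> where \<pi>: "\<pi> \<in> policies S A H" and
      avg: "\<And>s a. s < S \<Longrightarrow> a < A \<Longrightarrow>
        (\<Sum>j<n. \<integral>\<omega>. u j \<omega> * visit M H (I.played j \<omega>) g s a \<partial>run M H alg) = t * visit M H \<pi> g s a"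
      using g by blast
    have t: "t \<le> e"
    proof -
      have "(\<integral>\<omega>. u j \<omega> \<partial>run M H alg) = I.run.prob {\<omega> \<in> space (run M H alg). unstopped alg (Suc j) \<omega>}" for j
      proof -
        have "(\<integral>\<omega>. u j \<omega> \<partial>run M H alg) = (\<integral>\<omega>. indicator {\<omega> \<in> space (run M H alg). unstopped alg (Suc j) \<omega>} \<omega> \<partial>run M H alg)"
          by (intro Bochner_Integration.integral_cong) (auto simp: u_def)
        then show ?thesis by simp
      qed
      then have "ennreal t \<le> ennreal e"
        unfolding t_def using I.expected_episodes_ge[of n] real by simp
      then show ?thesis using real by simp
    qed
    let ?Z = "{(s, a). s < S \<and> a < A \<and> a \<noteq> (0::nat)}"
    let ?f = "\<lambda>(s, a). 1 / (ennreal (visit M H \<pi> g s a) * ennreal ((Delta S A H M g s a)\<^sup>2))"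
    have Z: "finite ?Z" "?Z \<noteq> {}"
    proof -
      have "?Z \<subseteq> {..<S} \<times> {..<A}" by auto
      then show "finite ?Z" by (rule finite_subset) simp
      have "(0, 1) \<in> ?Z" using S A by simp
      then show "?Z \<noteq> {}" by blast
    qed
    \<comment> \<open>The infimum is bounded by its value at the averaged policy, and the maximum
      over the finite nonempty set of pairs is attained at one of them.\<close>
    have "complexity S A H M (\<lambda>h s. 0) g \<le> Max (?f ` ?Z)"
      unfolding complexity_def using \<pi> by (rule INF_lower)
    moreover have "Max (?f ` ?Z) \<in> ?f ` ?Z" using Z by (intro Max_in) auto
    ultimately obtain s a where sa: "s < S" "a < A" "0 < a" and
      c: "complexity S A H M (\<lambda>h s. 0) g \<le> 1 / (ennreal (visit M H \<pi> g s a) * ennreal ((Delta S A H M g s a)\<^sup>2))"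
      by auto
    define v where "v = visit M H \<pi> g s a"
    define d where "d = gap s (a - 1)"
    have D: "Delta S A H M g s a = d" using g sa by (simp add: Delta_hard hard_mean_def d_def)
    have d: "0 < d" unfolding d_def using gap'[OF sa] by simp
    have v0: "0 \<le> v" by (simp add: v_def visit_def)
    have key: "l / 12 \<le> 12 * d\<^sup>2 * (t * v)"
      using visits_ge[OF PAC \<delta> small sa(1,3,2) un] avg[OF sa(1,2)]
      unfolding u_def l_def d_def v_def by simp
    \<comment> \<open>A pair that the averaged policy never visits would make the quotient infinite;
      \<open>key\<close> excludes it, as its left-hand side is positive.\<close>
    have v: "0 < v"
    proof (rule ccontr)
      assume "\<not> 0 < v"
      with v0 have "v = 0" by simp
      with key l show False by simp
    qed
    have "complexity S A H M (\<lambda>h s. 0) g \<le> ennreal (1 / (v * d\<^sup>2))"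
      using c v d unfolding D v_def[symmetric]
      by (simp add: ennreal_mult[symmetric] divide_ennreal[symmetric])
    then have "ennreal (1 / 144) * complexity S A H M (\<lambda>h s. 0) g * ennreal l \<le> ennreal (1 / 144) * ennreal (1 / (v * d\<^sup>2)) * ennreal l"
      by (intro mult_right_mono mult_left_mono) auto
    also have "\<dots> = ennreal (1 / 144 * (1 / (v * d\<^sup>2)) * l)"
      using v d l by (simp add: ennreal_mult[symmetric])
    also have "\<dots> \<le> ennreal e"
    proof (rule ennreal_leI)
      have "1 / 144 * (1 / (v * d\<^sup>2)) * l \<le> t"
        using key v d by (simp add: divide_simps mult_ac)
      with t show "1 / 144 * (1 / (v * d\<^sup>2)) * l \<le> e" by simp
    qed
    finally show ?thesis using real by (simp add: l_def)
  qed simp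
qed

end

theorem proposition3:
  shows "\<exists>c::real. c > 0 \<and>
    (\<forall>(S::nat) (A::nat) (H::nat) (hbar::nat)
       (P :: nat \<Rightarrow> nat \<Rightarrow> nat \<Rightarrow> nat pmf) (gap :: nat \<Rightarrow> nat \<Rightarrow> real).
      S > 1 \<longrightarrow> A > 1 \<longrightarrow> H > 1 \<longrightarrow> hbar \<in> {1..H} \<longrightarrow>
      (\<forall>h\<in>{1..<hbar}. \<forall>s<S. \<forall>a<A. set_pmf (P h s a) \<subseteq> {..<S}) \<longrightarrow>
      (\<forall>s<S. \<forall>j<A - 1. 0 < gap s j \<and> gap s j < 1 / 2) \<longrightarrow>
      (\<exists>(M::mdp) (\<pi>s :: nat \<Rightarrow> nat \<Rightarrow> nat) (idx :: nat \<Rightarrow> nat \<Rightarrow> nat).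
         is_mdp S A H M \<and>
         (\<forall>h\<in>{1..<hbar}. \<forall>s<S. \<forall>a<A. trans M h s a = P h s a) \<and>
         optimal_det S A H M \<pi>s \<and>
         (\<forall>s<S. bij_betw (idx s) ({..<A} - {\<pi>s hbar s}) {..<A - 1}) \<and>
         (\<forall>s<S. \<forall>a<A. a \<noteq> \<pi>s hbar s \<longrightarrow> Delta S A H M hbar s a = gap s (idx s a)) \<and>
         (\<forall>s<S. \<forall>h\<in>{1..H} - {hbar}. \<forall>a<A. a \<noteq> \<pi>s h s \<longrightarrow> Delta S A H M h s a \<ge> 1) \<and>
         (\<forall>(\<delta>::real) (alg::algorithm). 0 < \<delta> \<longrightarrow> \<delta> < 1 \<longrightarrow> PAC S A H 0 \<delta> alg \<longrightarrow>
            expected_episodes M H alg \<ge>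
              ennreal c * complexity S A H M \<pi>s hbar * ennreal (ln (1 / (2.4 * \<delta>))))))"
proof (intro exI[of _ "1 / 144"] conjI allI impI)
  fix S A H g :: nat and P :: "nat \<Rightarrow> nat \<Rightarrow> nat \<Rightarrow> nat pmf" and gap :: "nat \<Rightarrow> nat \<Rightarrow> real"
  assume S: "1 < S" and A: "1 < A" and "1 < H" and g: "g \<in> {1..H}"
    and P: "\<forall>h\<in>{1..<g}. \<forall>s<S. \<forall>a<A. set_pmf (P h s a) \<subseteq> {..<S}"
    and gap: "\<forall>s<S. \<forall>j<A - 1. 0 < gap s j \<and> gap s j < 1 / 2"
  interpret hard_instance S A H g P gap
    using S A g P gap by unfold_locales auto
  show "\<exists>M \<pi>s idx. is_mdp S A H M \<and>
         (\<forall>h\<in>{1..<g}. \<forall>s<S. \<forall>a<A. trans M h s a = P h s a) \<and>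
         optimal_det S A H M \<pi>s \<and>
         (\<forall>s<S. bij_betw (idx s) ({..<A} - {\<pi>s g s}) {..<A - 1}) \<and>
         (\<forall>s<S. \<forall>a<A. a \<noteq> \<pi>s g s \<longrightarrow> Delta S A H M g s a = gap s (idx s a)) \<and>
         (\<forall>s<S. \<forall>h\<in>{1..H} - {g}. \<forall>a<A. a \<noteq> \<pi>s h s \<longrightarrow> Delta S A H M h s a \<ge> 1) \<and>
         (\<forall>(\<delta>::real) (alg::algorithm). 0 < \<delta> \<longrightarrow> \<delta> < 1 \<longrightarrow> PAC S A H 0 \<delta> alg \<longrightarrow>
            expected_episodes M H alg \<ge>
              ennreal (1 / 144) * complexity S A H M \<pi>s g * ennreal (ln (1 / (2.4 * \<delta>))))"
  proof (intro exI conjI)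
    show "is_mdp S A H M" by (rule is_mdp_hard)
    show "\<forall>h\<in>{1..<g}. \<forall>s<S. \<forall>a<A. trans M h s a = P h s a" by (simp add: hard_trans_def)
    show "optimal_det S A H M (\<lambda>h s. 0)" by (rule optimal_det_hard)
    show "\<forall>s<S. bij_betw (\<lambda>a. a - 1) ({..<A} - {0}) {..<A - 1}"
      using A by (intro allI impI bij_betwI[where g=Suc]) auto
    show "\<forall>s<S. \<forall>a<A. a \<noteq> 0 \<longrightarrow> Delta S A H M g s a = gap s (a - 1)"
      using g by (simp add: Delta_hard hard_mean_def)
    show "\<forall>s<S. \<forall>h\<in>{1..H} - {g}. \<forall>a<A. a \<noteq> 0 \<longrightarrow> Delta S A H M h s a \<ge> 1"
      by (simp add: Delta_hard hard_mean_def)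
    show "\<forall>(\<delta>::real) (alg::algorithm). 0 < \<delta> \<longrightarrow> \<delta> < 1 \<longrightarrow> PAC S A H 0 \<delta> alg \<longrightarrow>
            expected_episodes M H alg \<ge>
              ennreal (1 / 144) * complexity S A H M (\<lambda>h s. 0) g * ennreal (ln (1 / (2.4 * \<delta>)))"
      using complexity_le_expected_episodes by blast
  qed
qed simp

end
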